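(* Let $M$ be a graded $R$-module and $F_\bullet$ be a graded complex of free $R$-modules, with $F_i=0$ for $i<0$ and $H_0(F_\bullet)=M$. Write $F_i = \bigoplus_{j\in E_i} R[-\gamma_{ij}]$ and $T_i:=\{ \gamma_{ij} : j\in E_i\}$. Let $\ell \geq 0$ and assume $\mathrm{cd}_B(H_j(F_\bullet ))\leq \ell +j$ for all $j\geq 1$. Then $$\mathrm{Supp}_{G}(H^\ell_B(M))\subset \bigcup_{i\geq 0}\bigl(\mathrm{Supp}_{G}(H^{\ell +i}_B(R))+T_i\bigr).$$
   Context: $G$ is a finitely generated abelian group, $S$ is a commutative ring, and $R=S[X_1,\ldots,X_n]$ is $G$-graded with $\deg(X_i)=\gamma_i\in G$ and $\deg(s)=0$ for $s\in S$. $B\subseteq (X_1,\ldots,X_n)$ is a finitely generated graded $R$-ideal. $H^i_B(M)$ denotes the $i$-th cohomology of the Čech complex of $M$ on a finite set of homogeneous generators of $B$. $\mathrm{cd}_B(M):=\inf\{i : H^j_B(M)=0\ \forall j>i\}$. $\mathrm{Supp}_G(M):=\{\gamma\in G: M_\gamma\neq 0\}$. The shifted module $M[\gamma']$ is defined by $M[\gamma']_\gamma:=M_{\gamma'+\gamma}$. The index sets $E_i$ may be infinite. For subsets $A,A'$ of $G$, $A+A'=\{a+a'\}$ (empty if one of them is empty). *)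

theory Defs
  imports
    "HOL-Algebra.Algebra"
    "HOL-Library.Set_Algebras"
    "HOL-Computational_Algebra.Group_Closure"
begin

section \<open>Graded rings and graded modules\<close>

definition finitely_generated_group :: "'g::ab_group_add itself \<Rightarrow> bool" where
  "finitely_generated_group _ \<longleftrightarrow> (\<exists>A :: 'g set. finite A \<and> group_closure A = UNIV)"

record ('r, 'g) gring = "'r ring" +
  rpart :: "'g \<Rightarrow> 'r set"

text \<open>As in HOL-Algebra, a module is a record extending rings whose fields \<open>mult\<close> and
  \<open>one\<close> carry no information; the modules constructed below leave them \<open>undefined\<close>.\<close>

record ('r, 'm, 'g) gmodule = "('r, 'm) module" +
  mpart :: "'g \<Rightarrow> 'm set"

definition direct_decomposition :: "('m, 'x) ring_scheme \<Rightarrow> ('g \<Rightarrow> 'm set) \<Rightarrow> bool" where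
  "direct_decomposition M P \<longleftrightarrow>
     (\<forall>\<gamma>. additive_subgroup (P \<gamma>) M) \<and>
     (\<forall>x\<in>carrier M. \<exists>!c. (\<forall>\<gamma>. c \<gamma> \<in> P \<gamma>) \<and> finite {\<gamma>. c \<gamma> \<noteq> \<zero>\<^bsub>M\<^esub>} \<and>
        x = (\<Oplus>\<^bsub>M\<^esub>\<gamma>\<in>{\<gamma>. c \<gamma> \<noteq> \<zero>\<^bsub>M\<^esub>}. c \<gamma>))"

locale graded_ring = cring R for R :: "('r, 'g::ab_group_add) gring" (structure) +
  assumes ring_decomposition: "direct_decomposition R (rpart R)"
    and rpart_mult:
      "\<lbrakk>a \<in> rpart R \<gamma>; b \<in> rpart R \<delta>\<rbrakk> \<Longrightarrow> a \<otimes> b \<in> rpart R (\<gamma> + \<delta>)"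

locale graded_module = graded_ring R + module R M
  for R :: "('r, 'g::ab_group_add) gring" (structure)
    and M :: "('r, 'm, 'g) gmodule" (structure) +
  assumes module_decomposition: "direct_decomposition M (mpart M)"
    and mpart_smult:
      "\<lbrakk>a \<in> rpart R \<gamma>; x \<in> mpart M \<delta>\<rbrakk> \<Longrightarrow> a \<odot>\<^bsub>M\<^esub> x \<in> mpart M (\<gamma> + \<delta>)"

definition graded_ideal :: "('r, 'g::ab_group_add) gring \<Rightarrow> 'r set \<Rightarrow> bool" where
  "graded_ideal R B \<longleftrightarrow> ideal B R \<and>
     (\<forall>x\<in>B. \<exists>\<Gamma> c. finite \<Gamma> \<and> (\<forall>\<gamma>\<in>\<Gamma>. c \<gamma> \<in> B \<inter> rpart R \<gamma>) \<and>
        x = (\<Oplus>\<^bsub>R\<^esub>\<gamma>\<in>\<Gamma>. c \<gamma>))"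

definition homogeneous :: "('r, 'g) gring \<Rightarrow> 'r \<Rightarrow> bool" where
  "homogeneous R f \<longleftrightarrow> (\<exists>\<gamma>. f \<in> rpart R \<gamma>)"

definition Supp :: "('r, 'm, 'g) gmodule \<Rightarrow> 'g set" where
  "Supp M = {\<gamma>. mpart M \<gamma> \<noteq> {\<zero>\<^bsub>M\<^esub>}}"

definition shift :: "('r, 'm, 'g::ab_group_add) gmodule \<Rightarrow> 'g \<Rightarrow> ('r, 'm, 'g) gmodule" where
  "shift M \<gamma>' = M\<lparr>mpart := \<lambda>\<gamma>. mpart M (\<gamma>' + \<gamma>)\<rparr>"

definition regular_module :: "('r, 'g) gring \<Rightarrow> ('r, 'r, 'g) gmodule" where
  "regular_module R =
     \<lparr>carrier = carrier R, monoid.mult = monoid.mult R, one = one R, ring.zero = ring.zero R, add = add R,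
      smult = monoid.mult R, mpart = rpart R\<rparr>"

text \<open>Graded homomorphisms preserve degrees.\<close>

definition graded_hom ::
    "('r, 'g) gring \<Rightarrow> ('r, 'm, 'g) gmodule \<Rightarrow> ('r, 'n, 'g) gmodule \<Rightarrow> ('m \<Rightarrow> 'n) set" where
  "graded_hom R M N = {h \<in> carrier M \<rightarrow> carrier N.
     (\<forall>x\<in>carrier M. \<forall>y\<in>carrier M. h (x \<oplus>\<^bsub>M\<^esub> y) = h x \<oplus>\<^bsub>N\<^esub> h y) \<and>
     (\<forall>a\<in>carrier R. \<forall>x\<in>carrier M. h (a \<odot>\<^bsub>M\<^esub> x) = a \<odot>\<^bsub>N\<^esub> h x) \<and>
     (\<forall>\<gamma>. h ` mpart M \<gamma> \<subseteq> mpart N \<gamma>)}"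

definition graded_iso ::
    "('r, 'g) gring \<Rightarrow> ('r, 'm, 'g) gmodule \<Rightarrow> ('r, 'n, 'g) gmodule \<Rightarrow> bool" where
  "graded_iso R M N \<longleftrightarrow> (\<exists>h\<in>graded_hom R M N. bij_betw h (carrier M) (carrier N) \<and>
     (\<forall>\<gamma>. h ` mpart M \<gamma> = mpart N \<gamma>))"

definition direct_sum :: "'e set \<Rightarrow> ('e \<Rightarrow> ('r, 'm, 'g) gmodule) \<Rightarrow> ('r, 'e \<Rightarrow> 'm, 'g) gmodule" where
  "direct_sum E N =
     \<lparr>carrier = {x \<in> \<Pi>\<^sub>E j\<in>E. carrier (N j). finite {j \<in> E. x j \<noteq> \<zero>\<^bsub>N j\<^esub>}},
      monoid.mult = undefined, one = undefined,
      ring.zero = (\<lambda>j\<in>E. \<zero>\<^bsub>N j\<^esub>),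
      add = (\<lambda>x y. \<lambda>j\<in>E. x j \<oplus>\<^bsub>N j\<^esub> y j),
      smult = (\<lambda>a x. \<lambda>j\<in>E. a \<odot>\<^bsub>N j\<^esub> x j),
      mpart = (\<lambda>\<gamma>. {x \<in> \<Pi>\<^sub>E j\<in>E. mpart (N j) \<gamma>. finite {j \<in> E. x j \<noteq> \<zero>\<^bsub>N j\<^esub>}})\<rparr>"

text \<open>The quotient \<open>Z / N\<close> of graded submodules \<open>N \<subseteq> Z\<close> of \<open>M\<close>, by cosets.\<close>

definition subquotient :: "('r, 'm, 'g) gmodule \<Rightarrow> 'm set \<Rightarrow> 'm set \<Rightarrow> ('r, 'm set, 'g) gmodule" where
  "subquotient M Z N =
     \<lparr>carrier = (\<lambda>z. N +>\<^bsub>M\<^esub> z) ` Z,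
      monoid.mult = undefined, one = undefined,
      ring.zero = N,
      add = set_add M,
      smult = (\<lambda>a U. \<Union>u\<in>U. N +>\<^bsub>M\<^esub> (a \<odot>\<^bsub>M\<^esub> u)),
      mpart = (\<lambda>\<gamma>. (\<lambda>z. N +>\<^bsub>M\<^esub> z) ` (Z \<inter> mpart M \<gamma>))\<rparr>"

text \<open>Complexes are homologically graded: \<open>d i\<close> maps \<open>F i\<close> to \<open>F (i - 1)\<close>.\<close>

definition graded_complex ::
    "('r, 'g::ab_group_add) gring \<Rightarrow> (int \<Rightarrow> ('r, 'm, 'g) gmodule) \<Rightarrow> (int \<Rightarrow> 'm \<Rightarrow> 'm) \<Rightarrow> bool" where
  "graded_complex R F d \<longleftrightarrow>
     (\<forall>i. graded_module R (F i)) \<and>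
     (\<forall>i. d i \<in> graded_hom R (F i) (F (i - 1))) \<and>
     (\<forall>i. \<forall>x\<in>carrier (F i). d (i - 1) (d i x) = \<zero>\<^bsub>F (i - 1 - 1)\<^esub>)"

definition homology ::
    "(int \<Rightarrow> ('r, 'm, 'g) gmodule) \<Rightarrow> (int \<Rightarrow> 'm \<Rightarrow> 'm) \<Rightarrow> int \<Rightarrow> ('r, 'm set, 'g) gmodule" where
  "homology F d i = subquotient (F i)
     {x \<in> carrier (F i). d i x = \<zero>\<^bsub>F (i - 1)\<^esub>} (d (i + 1) ` carrier (F (i + 1)))"


section \<open>Cech cohomology\<close>

text \<open>The fraction \<open>m / f^k\<close> in the localization \<open>M_f\<close>, as the set of the pairs
  \<open>(m', k')\<close> with \<open>m' / f^k' = m / f^k\<close>.\<close>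

definition fraction :: "('r, 'g) gring \<Rightarrow> ('r, 'm, 'g) gmodule \<Rightarrow> 'r \<Rightarrow> 'm \<Rightarrow> nat \<Rightarrow> ('m \<times> nat) set" where
  "fraction R M f m k = {(m', k'). m' \<in> carrier M \<and>
     (\<exists>l::nat. (f [^]\<^bsub>R\<^esub> l) \<odot>\<^bsub>M\<^esub> ((f [^]\<^bsub>R\<^esub> k') \<odot>\<^bsub>M\<^esub> m) = (f [^]\<^bsub>R\<^esub> l) \<odot>\<^bsub>M\<^esub> ((f [^]\<^bsub>R\<^esub> k) \<odot>\<^bsub>M\<^esub> m'))}"

text \<open>For homogeneous \<open>f\<close>, the fraction \<open>m / f^k\<close> has degree \<open>deg m - deg (f^k)\<close>. In
  the unions, the set under the union sign does not depend on the chosen representatives.\<close>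

definition localization ::
    "('r, 'g::ab_group_add) gring \<Rightarrow> ('r, 'm, 'g) gmodule \<Rightarrow> 'r \<Rightarrow> ('r, ('m \<times> nat) set, 'g) gmodule" where
  "localization R M f =
     \<lparr>carrier = {fraction R M f m k | m k. m \<in> carrier M},
      monoid.mult = undefined, one = undefined,
      ring.zero = fraction R M f \<zero>\<^bsub>M\<^esub> 0,
      add = (\<lambda>U V. \<Union>(m, k)\<in>U. \<Union>(m', k')\<in>V.
        fraction R M f (((f [^]\<^bsub>R\<^esub> k') \<odot>\<^bsub>M\<^esub> m) \<oplus>\<^bsub>M\<^esub> ((f [^]\<^bsub>R\<^esub> k) \<odot>\<^bsub>M\<^esub> m')) (k + k')),
      smult = (\<lambda>a U. \<Union>(m, k)\<in>U. fraction R M f (a \<odot>\<^bsub>M\<^esub> m) k),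
      mpart = (\<lambda>\<gamma>. {fraction R M f m k | m k \<delta>.
        f [^]\<^bsub>R\<^esub> k \<in> rpart R \<delta> \<and> m \<in> mpart M (\<gamma> + \<delta>)})\<rparr>"

text \<open>The canonical map \<open>M_f \<rightarrow> M_h\<close> for \<open>h = f g\<close>, which sends \<open>m / f^k\<close> to \<open>g^k m / h^k\<close>.\<close>

definition localization_map ::
    "('r, 'g) gring \<Rightarrow> ('r, 'm, 'g) gmodule \<Rightarrow> 'r \<Rightarrow> 'r \<Rightarrow> ('m \<times> nat) set \<Rightarrow> ('m \<times> nat) set" where
  "localization_map R M g h U = (\<Union>(m, k)\<in>U. fraction R M h ((g [^]\<^bsub>R\<^esub> k) \<odot>\<^bsub>M\<^esub> m) k)"

definition cech_elem :: "('r, 'g) gring \<Rightarrow> 'r list \<Rightarrow> nat set \<Rightarrow> 'r" where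
  "cech_elem R fs I = (\<Otimes>\<^bsub>R\<^esub>i\<in>I. fs ! i)"

definition cech_index :: "'r list \<Rightarrow> nat \<Rightarrow> nat set set" where
  "cech_index fs p = {I. I \<subseteq> {..<length fs} \<and> card I = p}"

text \<open>In degree \<open>0\<close> the only index is \<open>{}\<close>, with localization \<open>M_1 = M\<close>.\<close>

definition cech_cochains ::
    "('r, 'g::ab_group_add) gring \<Rightarrow> 'r list \<Rightarrow> ('r, 'm, 'g) gmodule \<Rightarrow> nat \<Rightarrow>
     ('r, nat set \<Rightarrow> ('m \<times> nat) set, 'g) gmodule" where
  "cech_cochains R fs M p =
     direct_sum (cech_index fs p) (\<lambda>I. localization R M (cech_elem R fs I))"

definition cech_diff ::
    "('r, 'g::ab_group_add) gring \<Rightarrow> 'r list \<Rightarrow> ('r, 'm, 'g) gmodule \<Rightarrow> nat \<Rightarrow>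
     (nat set \<Rightarrow> ('m \<times> nat) set) \<Rightarrow> nat set \<Rightarrow> ('m \<times> nat) set" where
  "cech_diff R fs M p c = (\<lambda>J\<in>cech_index fs (Suc p).
     let L = localization R M (cech_elem R fs J);
         r = (\<lambda>j. localization_map R M (fs ! j) (cech_elem R fs J) (c (J - {j})))
     in \<Oplus>\<^bsub>L\<^esub>j\<in>J. if even (card {i \<in> J. i < j}) then r j else \<ominus>\<^bsub>L\<^esub> r j)"

definition cech_cocycles where
  "cech_cocycles R fs M p = {c \<in> carrier (cech_cochains R fs M p).
     cech_diff R fs M p c = \<zero>\<^bsub>cech_cochains R fs M (Suc p)\<^esub>}"

definition cech_coboundaries where
  "cech_coboundaries R fs M p = (case p of
     0 \<Rightarrow> {\<zero>\<^bsub>cech_cochains R fs M 0\<^esub>}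
   | Suc q \<Rightarrow> cech_diff R fs M q ` carrier (cech_cochains R fs M q))"

text \<open>\<open>H\<^sup>p\<^sub>B(M)\<close> for the ideal \<open>B\<close> generated by the homogeneous elements \<open>fs\<close>.\<close>

definition cech_cohomology ::
    "('r, 'g::ab_group_add) gring \<Rightarrow> 'r list \<Rightarrow> ('r, 'm, 'g) gmodule \<Rightarrow> nat \<Rightarrow>
     ('r, (nat set \<Rightarrow> ('m \<times> nat) set) set, 'g) gmodule" where
  "cech_cohomology R fs M p =
     subquotient (cech_cochains R fs M p) (cech_cocycles R fs M p) (cech_coboundaries R fs M p)"

text \<open>The infimum is taken over a nonempty set: \<open>H\<^sup>j\<^sub>B(M) = 0\<close> for \<open>j > length fs\<close>.
  It is \<open>0\<close> if the cohomology vanishes in all degrees.\<close>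

definition cohomological_dim ::
    "('r, 'g::ab_group_add) gring \<Rightarrow> 'r list \<Rightarrow> ('r, 'm, 'g) gmodule \<Rightarrow> nat" where
  "cohomological_dim R fs M =
     Inf {i. \<forall>j>i. carrier (cech_cohomology R fs M j) = {\<zero>\<^bsub>cech_cohomology R fs M j\<^esub>}}"


section \<open>The graded polynomial ring\<close>

text \<open>\<open>S[X\<^sub>1, \<dots>, X\<^sub>n]\<close> with \<open>deg X\<^sub>i = dg i\<close>. As in \<^theory>\<open>HOL-Algebra.Indexed_Polynomials\<close>,
  monomials are multisets of indices and polynomials are coefficient functions.\<close>

definition poly_gring ::
    "('a, 'x) ring_scheme \<Rightarrow> nat \<Rightarrow> (nat \<Rightarrow> 'g::ab_group_add) \<Rightarrow> (nat multiset \<Rightarrow> 'a, 'g) gring" where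
  "poly_gring S n dg =
     \<lparr>carrier = ring.indexed_pset S {1..n} (carrier S),
      monoid.mult = (\<lambda>p q m. \<Oplus>\<^bsub>S\<^esub>a\<in>{a. a \<subseteq># m}. p a \<otimes>\<^bsub>S\<^esub> q (m - a)),
      one = ring.indexed_const S \<one>\<^bsub>S\<^esub>,
      ring.zero = ring.indexed_const S \<zero>\<^bsub>S\<^esub>,
      add = ring.indexed_padd S,
      rpart = (\<lambda>\<gamma>. {p \<in> ring.indexed_pset S {1..n} (carrier S).
        \<forall>m. p m \<noteq> \<zero>\<^bsub>S\<^esub> \<longrightarrow> (\<Sum>i\<in>#m. dg i) = \<gamma>})\<rparr>"

subsection \<open>The polynomial ring is a graded ring\<close>

lemma finite_submultisets: "finite {a. a \<subseteq># (m :: 'c multiset)}"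
proof (induction m)
  case empty
  have "{a. a \<subseteq># ({#} :: 'c multiset)} = {{#}}" by auto
  then show ?case by simp
next
  case (add x m)
  have "{a. a \<subseteq># add_mset x m} \<subseteq> {a. a \<subseteq># m} \<union> add_mset x ` {a. a \<subseteq># m}"
  proof
    fix a assume "a \<in> {a. a \<subseteq># add_mset x m}"
    then have a: "a \<subseteq># add_mset x m" by simp
    show "a \<in> {a. a \<subseteq># m} \<union> add_mset x ` {a. a \<subseteq># m}"
    proof (cases "x \<in># a")
      case True
      then obtain b where "a = add_mset x b" by (meson multi_member_split)
      then show ?thesis using a by auto
    next
      case False
      then show ?thesis using a
        by (metis UnI1 add_mset_remove_trivial diff_single_trivial mem_Collect_eq subset_eq_diff_conv union_commute add_mset_add_single)
    qed
  qed
  then show ?case using add by (meson finite_Un finite_imageI finite_subset)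
qed

context cring begin

lemma indexed_pset_eq:
  "indexed_pset I (carrier R) =
    {p. (\<forall>m. p m \<in> carrier R) \<and> finite {m. p m \<noteq> \<zero>} \<and> (\<forall>m. p m \<noteq> \<zero> \<longrightarrow> set_mset m \<subseteq> I)}"
  (is "?A = ?B")
proof
  show "?A \<subseteq> ?B"
  proof
    fix p assume "p \<in> ?A"
    then show "p \<in> ?B"
    proof (induction)
      case (indexed_const k)
      have "{m. indexed_const k m \<noteq> \<zero>} \<subseteq> {{#}}" by (auto simp: indexed_const_def)
      then show ?case using indexed_const finite_subset by (auto simp: indexed_const_def)
    next
      case (indexed_padd P Q)
      have "{m. indexed_padd P Q m \<noteq> \<zero>} \<subseteq> {m. P m \<noteq> \<zero>} \<union> {m. Q m \<noteq> \<zero>}"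
        by (auto simp: indexed_padd_def)
      then have "finite {m. indexed_padd P Q m \<noteq> \<zero>}"
        by (rule finite_subset) (use indexed_padd.IH in auto)
      moreover have "set_mset m \<subseteq> I" if "indexed_padd P Q m \<noteq> \<zero>" for m
      proof -
        have "P m \<noteq> \<zero> \<or> Q m \<noteq> \<zero>" using that by (auto simp: indexed_padd_def)
        then show ?thesis using indexed_padd.IH by blast
      qed
      moreover have "indexed_padd P Q m \<in> carrier R" for m
        using indexed_padd.IH by (auto simp: indexed_padd_def)
      ultimately show ?case by blast
    next
      case (indexed_pmult P i)
      have "{m. indexed_pmult P i m \<noteq> \<zero>} \<subseteq> add_mset i ` {m. P m \<noteq> \<zero>}"
      proof
        fix m assume "m \<in> {m. indexed_pmult P i m \<noteq> \<zero>}"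
        then have "i \<in># m" "P (m - {#i#}) \<noteq> \<zero>" by (auto simp: indexed_pmult_def split: if_splits)
        then show "m \<in> add_mset i ` {m. P m \<noteq> \<zero>}"
          by (intro image_eqI[of _ _ "m - {#i#}"]) auto
      qed
      then have "finite {m. indexed_pmult P i m \<noteq> \<zero>}"
        by (rule finite_subset) (use indexed_pmult.IH in auto)
      moreover have "set_mset m \<subseteq> I" if "indexed_pmult P i m \<noteq> \<zero>" for m
      proof -
        have "i \<in># m" "P (m - {#i#}) \<noteq> \<zero>" using that by (auto simp: indexed_pmult_def split: if_splits)
        then have "set_mset (m - {#i#}) \<subseteq> I" using indexed_pmult.IH by blast
        then show ?thesis using \<open>i \<in># m\<close> \<open>i \<in> I\<close>
          by (metis insert_DiffM insert_subset set_mset_add_mset_insert)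
      qed
      ultimately show ?case using indexed_pmult.IH by (auto simp: indexed_pmult_def)
    qed
  qed
next
  have mono: "(\<lambda>m. if m = m0 then k else \<zero>) \<in> ?A" if "k \<in> carrier R" "set_mset m0 \<subseteq> I" for k m0
    using that(2)
  proof (induction m0)
    case empty
    then show ?case using indexed_pset.indexed_const[of k "carrier R" I] that(1)
      by (simp add: indexed_const_def)
  next
    case (add x m0)
    have "(\<lambda>m. if m = add_mset x m0 then k else \<zero>) = indexed_pmult (\<lambda>m. if m = m0 then k else \<zero>) x"
      by (auto simp: indexed_pmult_def fun_eq_iff)
    then show ?case using add by (auto intro: indexed_pset.indexed_pmult)
  qed
  show "?B \<subseteq> ?A"
  proof
    fix p assume "p \<in> ?B"
    then have "finite {m. p m \<noteq> \<zero>}" "\<forall>m. p m \<in> carrier R" "\<forall>m. p m \<noteq> \<zero> \<longrightarrow> set_mset m \<subseteq> I" by auto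
    then show "p \<in> ?A"
    proof (induction "{m. p m \<noteq> \<zero>}" arbitrary: p rule: finite_induct)
      case empty
      then have "p = indexed_const \<zero>" by (auto simp: indexed_const_def)
      then show ?case using indexed_pset.indexed_const[of \<zero> "carrier R" I] by simp
    next
      case (insert x A)
      define q where "q = p(x := \<zero>)"
      have "q \<in> ?A" using insert by (intro insert.hyps(3)) (auto simp: q_def)
      moreover have "(\<lambda>m. if m = x then p x else \<zero>) \<in> ?A"
        using insert by (intro mono) blast+
      moreover have "p = indexed_padd q (\<lambda>m. if m = x then p x else \<zero>)"
        using insert by (auto simp: indexed_padd_def q_def fun_eq_iff)
      ultimately show ?case using indexed_pset.indexed_padd by metis
    qed
  qed
qed

lemma finsum_Sigma:
  assumes "finite A" "\<And>a. a \<in> A \<Longrightarrow> finite (B a)"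
    and "\<And>a b. a \<in> A \<Longrightarrow> b \<in> B a \<Longrightarrow> f a b \<in> carrier R"
  shows "(\<Oplus>a\<in>A. \<Oplus>b\<in>B a. f a b) = (\<Oplus>z\<in>Sigma A B. f (fst z) (snd z))"
proof -
  have eq: "Sigma A B = (\<Union>a\<in>A. Pair a ` B a)" by auto
  have "(\<Oplus>z\<in>Sigma A B. f (fst z) (snd z)) = (\<Oplus>a\<in>A. \<Oplus>z\<in>Pair a ` B a. f (fst z) (snd z))"
    unfolding eq using assms
    by (intro add.finprod_UN_disjoint) (auto simp: pairwise_def disjnt_def)
  also have "\<dots> = (\<Oplus>a\<in>A. \<Oplus>b\<in>B a. f a b)"
  proof (rule finsum_cong')
    fix a assume a: "a \<in> A"
    show "(\<Oplus>z\<in>Pair a ` B a. f (fst z) (snd z)) = (\<Oplus>b\<in>B a. f a b)"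
      using assms a by (subst finsum_reindex) (auto simp: inj_on_def)
  qed (use assms in auto)
  finally show ?thesis by simp
qed

lemma poly_conv_assoc:
  assumes "\<And>m. p m \<in> carrier R" "\<And>m. q m \<in> carrier R" "\<And>m. r m \<in> carrier R"
  shows "(\<Oplus>a\<in>{a. a \<subseteq># m}. (\<Oplus>b\<in>{b. b \<subseteq># a}. p b \<otimes> q (a - b)) \<otimes> r (m - a)) =
    (\<Oplus>a\<in>{a. a \<subseteq># (m::'c multiset)}. p a \<otimes> (\<Oplus>b\<in>{b. b \<subseteq># m - a}. q b \<otimes> r (m - a - b)))"
    (is "?L = ?R")
proof -
  let ?S = "SIGMA a:{a. a \<subseteq># m}. {b. b \<subseteq># a}"
  let ?T = "SIGMA a:{a. a \<subseteq># m}. {b. b \<subseteq># m - a}"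
  have "?L = (\<Oplus>a\<in>{a. a \<subseteq># m}. \<Oplus>b\<in>{b. b \<subseteq># a}. p b \<otimes> q (a - b) \<otimes> r (m - a))"
    using assms by (intro finsum_cong') (auto intro!: finsum_ldistr finite_submultisets)
  also have "\<dots> = (\<Oplus>z\<in>?S. p (snd z) \<otimes> q (fst z - snd z) \<otimes> r (m - fst z))"
    using assms by (intro finsum_Sigma) (auto intro!: finite_submultisets)
  also have "?S = (\<lambda>(a, b). (a + b, a)) ` ?T"
    by (auto simp: image_iff subset_eq_diff_conv add.commute mset_subset_eq_exists_conv)
  also have "(\<Oplus>z\<in>(\<lambda>(a, b). (a + b, a)) ` ?T. p (snd z) \<otimes> q (fst z - snd z) \<otimes> r (m - fst z)) =
     (\<Oplus>z\<in>?T. p (fst z) \<otimes> (q (snd z) \<otimes> r (m - fst z - snd z)))"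
    using assms
    by (subst finsum_reindex) (auto simp: inj_on_def m_assoc intro!: finsum_cong')
  also have "\<dots> = (\<Oplus>a\<in>{a. a \<subseteq># m}. \<Oplus>b\<in>{b. b \<subseteq># m - a}. p a \<otimes> (q b \<otimes> r (m - a - b)))"
    using assms by (intro finsum_Sigma[symmetric]) (auto intro!: finite_submultisets)
  also have "\<dots> = ?R"
    using assms by (intro finsum_cong') (auto intro!: finsum_rdistr[symmetric] finite_submultisets)
  finally show ?thesis .
qed

lemma poly_conv_comm:
  assumes "\<And>m. p m \<in> carrier R" "\<And>m. q m \<in> carrier R"
  shows "(\<Oplus>a\<in>{a. a \<subseteq># m}. p a \<otimes> q (m - a)) = (\<Oplus>a\<in>{a. a \<subseteq># (m::'c multiset)}. q a \<otimes> p (m - a))"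
proof -
  have img: "{a. a \<subseteq># m} = (\<lambda>a. m - a) ` {a. a \<subseteq># m}"
    by (auto simp: image_iff) (metis diff_subset_eq_self subset_mset.add_diff_inverse add_diff_cancel_right')
  have inj: "inj_on (\<lambda>a. m - a) {a. a \<subseteq># m}"
    by (auto simp: inj_on_def) (metis subset_mset.diff_add add_left_cancel)
  have dd: "m - (m - a) = a" if "a \<subseteq># m" for a
    using that by (metis add_diff_cancel_right' subset_mset.add_diff_inverse)
  have "(\<Oplus>a\<in>{a. a \<subseteq># m}. p a \<otimes> q (m - a)) = (\<Oplus>a\<in>(\<lambda>a. m - a) ` {a. a \<subseteq># m}. p a \<otimes> q (m - a))"
    using img by simp
  also have "\<dots> = (\<Oplus>a\<in>{a. a \<subseteq># m}. p (m - a) \<otimes> q (m - (m - a)))"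
    using assms inj by (subst finsum_reindex) auto
  also have "\<dots> = (\<Oplus>a\<in>{a. a \<subseteq># m}. q a \<otimes> p (m - a))"
    using assms by (intro finsum_cong') (auto simp: m_comm dd)
  finally show ?thesis .
qed


lemma poly_carrier:
  "carrier (poly_gring R n dg) =
    {p. (\<forall>m. p m \<in> carrier R) \<and> finite {m. p m \<noteq> \<zero>} \<and> (\<forall>m. p m \<noteq> \<zero> \<longrightarrow> set_mset m \<subseteq> {1..n})}"
  by (simp add: poly_gring_def indexed_pset_eq)

lemma poly_ops:
  "ring.zero (poly_gring R n dg) = (\<lambda>m. \<zero>)"
  "monoid.one (poly_gring R n dg) = (\<lambda>m. if m = {#} then \<one> else \<zero>)"
  "p \<oplus>\<^bsub>poly_gring R n dg\<^esub> q = (\<lambda>m. p m \<oplus> q m)"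
  "p \<otimes>\<^bsub>poly_gring R n dg\<^esub> q = (\<lambda>m. \<Oplus>a\<in>{a. a \<subseteq># m}. p a \<otimes> q (m - a))"
  by (simp_all add: poly_gring_def indexed_const_def indexed_padd_def fun_eq_iff)

lemma poly_rpart:
  "rpart (poly_gring R n dg) \<gamma> = {p \<in> carrier (poly_gring R n dg). \<forall>m. p m \<noteq> \<zero> \<longrightarrow> (\<Sum>i\<in>#m. dg i) = \<gamma>}"
  by (simp add: poly_gring_def)

lemma conv_nonzero:
  assumes "(\<Oplus>a\<in>{a. a \<subseteq># m}. p a \<otimes> q (m - a)) \<noteq> \<zero>" "\<And>m. p m \<in> carrier R" "\<And>m. q m \<in> carrier R"
  shows "\<exists>a b. m = a + b \<and> p a \<noteq> \<zero> \<and> q b \<noteq> \<zero>"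
proof (rule ccontr)
  assume neg: "\<not> ?thesis"
  have "p a \<otimes> q (m - a) = \<zero>" if "a \<subseteq># m" for a
  proof -
    have "m = a + (m - a)" using that by simp
    then have "p a = \<zero> \<or> q (m - a) = \<zero>" using neg by blast
    then show ?thesis using assms by auto
  qed
  then have "(\<Oplus>a\<in>{a. a \<subseteq># m}. p a \<otimes> q (m - a)) = \<zero>"
    by (intro add.finprod_one_eqI) auto
  then show False using assms by simp
qed

lemma conv_closed:
  assumes "p \<in> carrier (poly_gring R n dg)" "q \<in> carrier (poly_gring R n dg)"
  shows "p \<otimes>\<^bsub>poly_gring R n dg\<^esub> q \<in> carrier (poly_gring R n dg)"
proof -
  let ?r = "\<lambda>m. \<Oplus>a\<in>{a. a \<subseteq># m}. p a \<otimes> q (m - a)"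
  have c: "\<And>m. p m \<in> carrier R" "\<And>m. q m \<in> carrier R" using assms by (auto simp: poly_carrier)
  have "{m. ?r m \<noteq> \<zero>} \<subseteq> (\<lambda>(a, b). a + b) ` ({m. p m \<noteq> \<zero>} \<times> {m. q m \<noteq> \<zero>})"
    using conv_nonzero[of p q, OF _ c] by fastforce
  then have "finite {m. ?r m \<noteq> \<zero>}"
    by (rule finite_subset) (use assms in \<open>auto simp: poly_carrier\<close>)
  moreover have "set_mset m \<subseteq> {1..n}" if "?r m \<noteq> \<zero>" for m
  proof -
    obtain a b where "m = a + b" "p a \<noteq> \<zero>" "q b \<noteq> \<zero>" using conv_nonzero[of p q m, OF _ c] \<open>?r m \<noteq> \<zero>\<close> by blast
    then show ?thesis using assms by (auto simp: poly_carrier) 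
  qed
  moreover have "?r m \<in> carrier R" for m using c by (intro finsum_closed) auto
  ultimately show ?thesis unfolding poly_carrier poly_ops by blast
qed

lemma poly_gring_cring: "cring (poly_gring R n dg)"
proof (rule cringI)
  let ?P = "poly_gring R n dg"
  show "abelian_group ?P"
  proof (rule abelian_groupI)
    fix p q assume pq: "p \<in> carrier ?P" "q \<in> carrier ?P"
    have "{m. p m \<oplus> q m \<noteq> \<zero>} \<subseteq> {m. p m \<noteq> \<zero>} \<union> {m. q m \<noteq> \<zero>}" by auto
    then have "finite {m. p m \<oplus> q m \<noteq> \<zero>}"
      by (rule finite_subset) (use pq in \<open>auto simp: poly_carrier\<close>)
    moreover have "set_mset m \<subseteq> {1..n}" if "p m \<oplus> q m \<noteq> \<zero>" for m
    proof -
      have "p m \<noteq> \<zero> \<or> q m \<noteq> \<zero>" using that by auto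
      then show ?thesis using pq unfolding poly_carrier by blast
    qed
    moreover have "p m \<oplus> q m \<in> carrier R" for m using pq by (auto simp: poly_carrier)
    ultimately show "p \<oplus>\<^bsub>?P\<^esub> q \<in> carrier ?P" unfolding poly_carrier poly_ops by blast
  next
    fix p assume p: "p \<in> carrier ?P"
    then have e: "(\<ominus> p m \<noteq> \<zero>) = (p m \<noteq> \<zero>)" for m
      by (auto simp: poly_carrier)
    have "(\<lambda>m. \<ominus> p m) \<in> carrier ?P"
      using p by (simp add: poly_carrier e)
    moreover have "(\<lambda>m. \<ominus> p m) \<oplus>\<^bsub>?P\<^esub> p = \<zero>\<^bsub>?P\<^esub>"
      using p by (simp add: poly_ops fun_eq_iff poly_carrier l_neg)
    ultimately show "\<exists>q\<in>carrier ?P. q \<oplus>\<^bsub>?P\<^esub> p = \<zero>\<^bsub>?P\<^esub>" by blast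
  qed (auto simp: poly_ops poly_carrier fun_eq_iff a_ac)
  show "Group.comm_monoid ?P"
  proof (rule comm_monoidI)
    have "{m. (if m = {#} then \<one> else \<zero>) \<noteq> \<zero>} \<subseteq> {{#}}" by auto
    then have "finite {m. (if m = {#} then \<one> else \<zero>) \<noteq> \<zero>}" using finite_subset by blast
    then show "\<one>\<^bsub>?P\<^esub> \<in> carrier ?P"
      by (auto simp: poly_ops poly_carrier)
    show "p \<otimes>\<^bsub>?P\<^esub> q \<in> carrier ?P" if "p \<in> carrier ?P" "q \<in> carrier ?P" for p q
      using conv_closed that .
    show "p \<otimes>\<^bsub>?P\<^esub> q \<otimes>\<^bsub>?P\<^esub> r = p \<otimes>\<^bsub>?P\<^esub> (q \<otimes>\<^bsub>?P\<^esub> r)"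
      if "p \<in> carrier ?P" "q \<in> carrier ?P" "r \<in> carrier ?P" for p q r
      using that by (simp add: poly_ops poly_conv_assoc poly_carrier)
    show "p \<otimes>\<^bsub>?P\<^esub> q = q \<otimes>\<^bsub>?P\<^esub> p" if "p \<in> carrier ?P" "q \<in> carrier ?P" for p q
      using that unfolding poly_ops poly_carrier by (intro ext poly_conv_comm) auto
    show "\<one>\<^bsub>?P\<^esub> \<otimes>\<^bsub>?P\<^esub> p = p" if "p \<in> carrier ?P" for p
    proof
      fix m
      have c: "\<And>m. p m \<in> carrier R" using that by (auto simp: poly_carrier)
      have "(\<Oplus>a\<in>{a. a \<subseteq># m}. (if a = {#} then \<one> else \<zero>) \<otimes> p (m - a)) =
        (\<Oplus>a\<in>{a. a \<subseteq># m}. if {#} = a then p (m - a) else \<zero>)"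
        using c by (intro finsum_cong') auto
      also have "\<dots> = p m"
        using c by (subst add.finprod_singleton) (auto intro: finite_submultisets)
      finally show "(\<one>\<^bsub>?P\<^esub> \<otimes>\<^bsub>?P\<^esub> p) m = p m" unfolding poly_ops .
    qed
  qed
  show "(p \<oplus>\<^bsub>?P\<^esub> q) \<otimes>\<^bsub>?P\<^esub> r = p \<otimes>\<^bsub>?P\<^esub> r \<oplus>\<^bsub>?P\<^esub> q \<otimes>\<^bsub>?P\<^esub> r"
    if "p \<in> carrier ?P" "q \<in> carrier ?P" "r \<in> carrier ?P" for p q r
  proof
    fix m
    have c: "\<And>m. p m \<in> carrier R" "\<And>m. q m \<in> carrier R" "\<And>m. r m \<in> carrier R"
      using that by (auto simp: poly_carrier)
    have "(\<Oplus>a\<in>{a. a \<subseteq># m}. (p a \<oplus> q a) \<otimes> r (m - a)) =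
      (\<Oplus>a\<in>{a. a \<subseteq># m}. p a \<otimes> r (m - a) \<oplus> q a \<otimes> r (m - a))"
      using c by (intro finsum_cong') (auto simp: l_distr)
    also have "\<dots> = (\<Oplus>a\<in>{a. a \<subseteq># m}. p a \<otimes> r (m - a)) \<oplus> (\<Oplus>a\<in>{a. a \<subseteq># m}. q a \<otimes> r (m - a))"
      using c by (intro finsum_addf) auto
    finally show "((p \<oplus>\<^bsub>?P\<^esub> q) \<otimes>\<^bsub>?P\<^esub> r) m = (p \<otimes>\<^bsub>?P\<^esub> r \<oplus>\<^bsub>?P\<^esub> q \<otimes>\<^bsub>?P\<^esub> r) m"
      unfolding poly_ops .
  qed
qed

lemma poly_finsum:
  assumes "finite A" "\<And>a. a \<in> A \<Longrightarrow> c a \<in> carrier (poly_gring R n dg)"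
  shows "(\<Oplus>\<^bsub>poly_gring R n dg\<^esub>a\<in>A. c a) m = (\<Oplus>a\<in>A. c a m)"
proof -
  interpret P: cring "poly_gring R n dg" by (rule poly_gring_cring)
  show ?thesis using assms
  proof (induction A)
    case empty
    then show ?case by (simp add: poly_ops P.finsum_empty)
  next
    case (insert x A)
    then have "\<And>a. a \<in> insert x A \<Longrightarrow> c a m \<in> carrier R" by (auto simp: poly_carrier)
    then have "(\<Oplus>a\<in>insert x A. c a m) = c x m \<oplus> (\<Oplus>a\<in>A. c a m)"
      using insert by (intro finsum_insert) auto
    moreover have "(\<Oplus>\<^bsub>poly_gring R n dg\<^esub>a\<in>insert x A. c a) = c x \<oplus>\<^bsub>poly_gring R n dg\<^esub> (\<Oplus>\<^bsub>poly_gring R n dg\<^esub>a\<in>A. c a)"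
      using insert by (intro P.finsum_insert) auto
    ultimately show ?case using insert by (simp add: poly_ops)
  qed
qed

lemma poly_gring_graded_ring: "graded_ring (poly_gring R n dg)"
proof -
  let ?P = "poly_gring R n dg"
  let ?deg = "\<lambda>m. \<Sum>i\<in>#m. dg i"
  interpret P: cring ?P by (rule poly_gring_cring)
  have sub: "additive_subgroup (rpart ?P \<gamma>) ?P" for \<gamma>
  proof (rule additive_subgroup.intro, rule P.add.subgroupI)
    show "rpart ?P \<gamma> \<subseteq> carrier ?P" by (auto simp: poly_rpart)
    have "\<zero>\<^bsub>?P\<^esub> \<in> rpart ?P \<gamma>" unfolding poly_rpart using P.zero_closed by (simp add: poly_ops(1))
    then show "rpart ?P \<gamma> \<noteq> {}" by blast
  next
    fix p assume p: "p \<in> rpart ?P \<gamma>"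
    then have pc: "p \<in> carrier ?P" by (simp add: poly_rpart)
    have "(\<ominus>\<^bsub>?P\<^esub> p) m = \<ominus> p m" for m
    proof -
      have "(\<ominus>\<^bsub>?P\<^esub> p \<oplus>\<^bsub>?P\<^esub> p) m = \<zero>" using pc P.l_neg by (simp add: poly_ops)
      then have "(\<ominus>\<^bsub>?P\<^esub> p) m \<oplus> p m = \<zero>" by (simp add: poly_ops)
      moreover have "\<ominus>\<^bsub>?P\<^esub> p \<in> carrier ?P" using pc by simp
      ultimately show ?thesis using pc by (metis (mono_tags, lifting) mem_Collect_eq minus_equality poly_carrier)
    qed
    moreover have "\<ominus> p m \<noteq> \<zero> \<Longrightarrow> p m \<noteq> \<zero>" for m by auto
    ultimately show "\<ominus>\<^bsub>?P\<^esub> p \<in> rpart ?P \<gamma>" using p pc unfolding poly_rpart by auto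
  next
    fix p q assume pq: "p \<in> rpart ?P \<gamma>" "q \<in> rpart ?P \<gamma>"
    have "?deg m = \<gamma>" if "p m \<oplus> q m \<noteq> \<zero>" for m
    proof -
      have "p m \<noteq> \<zero> \<or> q m \<noteq> \<zero>" using that by auto
      then show ?thesis using pq unfolding poly_rpart by blast
    qed
    moreover have "p \<oplus>\<^bsub>?P\<^esub> q \<in> carrier ?P" using pq by (simp add: poly_rpart)
    ultimately show "p \<oplus>\<^bsub>?P\<^esub> q \<in> rpart ?P \<gamma>" unfolding poly_rpart by (simp add: poly_ops)
  qed
  have dec: "\<exists>!c. (\<forall>\<gamma>. c \<gamma> \<in> rpart ?P \<gamma>) \<and> finite {\<gamma>. c \<gamma> \<noteq> \<zero>\<^bsub>?P\<^esub>} \<and>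
        p = (\<Oplus>\<^bsub>?P\<^esub>\<gamma>\<in>{\<gamma>. c \<gamma> \<noteq> \<zero>\<^bsub>?P\<^esub>}. c \<gamma>)" if p: "p \<in> carrier ?P" for p
  proof (rule ex1I)
    let ?c = "\<lambda>\<gamma> m. if ?deg m = \<gamma> then p m else \<zero>"
    have val: "(\<Oplus>\<^bsub>?P\<^esub>\<gamma>\<in>{\<gamma>. c \<gamma> \<noteq> \<zero>\<^bsub>?P\<^esub>}. c \<gamma>) m = c (?deg m) m"
      if "\<forall>\<gamma>. c \<gamma> \<in> rpart ?P \<gamma>" "finite {\<gamma>. c \<gamma> \<noteq> \<zero>\<^bsub>?P\<^esub>}" for c m
    proof -
      let ?A = "{\<gamma>. c \<gamma> \<noteq> \<zero>\<^bsub>?P\<^esub>}"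
      have cc: "c \<gamma> \<in> carrier ?P" for \<gamma> using that by (auto simp: poly_rpart)
      then have cm: "c \<gamma> m \<in> carrier R" for \<gamma> by (auto simp: poly_carrier)
      have z: "c \<gamma> m = \<zero>" if "?deg m \<noteq> \<gamma>" for \<gamma>
        using that \<open>\<forall>\<gamma>. c \<gamma> \<in> rpart ?P \<gamma>\<close> unfolding poly_rpart by blast
      have "(\<Oplus>\<^bsub>?P\<^esub>\<gamma>\<in>?A. c \<gamma>) m = (\<Oplus>\<gamma>\<in>?A. c \<gamma> m)"
        using that cc by (intro poly_finsum) auto
      also have "\<dots> = (\<Oplus>\<gamma>\<in>?A. if ?deg m = \<gamma> then c \<gamma> m else \<zero>)"
        using cm z by (intro finsum_cong') auto
      also have "\<dots> = c (?deg m) m"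
      proof (cases "?deg m \<in> ?A")
        case True
        then show ?thesis using that cm by (intro add.finprod_singleton) auto
      next
        case False
        then have "c (?deg m) m = \<zero>" by (simp add: poly_ops)
        moreover have "(\<Oplus>\<gamma>\<in>?A. if ?deg m = \<gamma> then c \<gamma> m else \<zero>) = \<zero>"
          using False by (intro add.finprod_one_eqI) auto
        ultimately show ?thesis by simp
      qed
      finally show ?thesis .
    qed
    have "{m. ?c \<gamma> m \<noteq> \<zero>} \<subseteq> {m. p m \<noteq> \<zero>}" for \<gamma> by auto
    then have "finite {m. ?c \<gamma> m \<noteq> \<zero>}" for \<gamma>
      by (rule finite_subset) (use p in \<open>auto simp: poly_carrier\<close>)
    then have c1: "\<forall>\<gamma>. ?c \<gamma> \<in> rpart ?P \<gamma>" using p by (auto simp: poly_rpart poly_carrier)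
    have "{\<gamma>. ?c \<gamma> \<noteq> \<zero>\<^bsub>?P\<^esub>} \<subseteq> ?deg ` {m. p m \<noteq> \<zero>}" by (auto simp: poly_ops fun_eq_iff)
    then have c2: "finite {\<gamma>. ?c \<gamma> \<noteq> \<zero>\<^bsub>?P\<^esub>}"
      by (rule finite_subset) (use p in \<open>auto simp: poly_carrier\<close>)
    show "(\<forall>\<gamma>. ?c \<gamma> \<in> rpart ?P \<gamma>) \<and> finite {\<gamma>. ?c \<gamma> \<noteq> \<zero>\<^bsub>?P\<^esub>} \<and>
        p = (\<Oplus>\<^bsub>?P\<^esub>\<gamma>\<in>{\<gamma>. ?c \<gamma> \<noteq> \<zero>\<^bsub>?P\<^esub>}. ?c \<gamma>)"
    proof (intro conjI c1 c2)
      show "p = (\<Oplus>\<^bsub>?P\<^esub>\<gamma>\<in>{\<gamma>. ?c \<gamma> \<noteq> \<zero>\<^bsub>?P\<^esub>}. ?c \<gamma>)"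
        using val[OF c1 c2] by (intro ext) simp
    qed
    fix c assume c: "(\<forall>\<gamma>. c \<gamma> \<in> rpart ?P \<gamma>) \<and> finite {\<gamma>. c \<gamma> \<noteq> \<zero>\<^bsub>?P\<^esub>} \<and>
        p = (\<Oplus>\<^bsub>?P\<^esub>\<gamma>\<in>{\<gamma>. c \<gamma> \<noteq> \<zero>\<^bsub>?P\<^esub>}. c \<gamma>)"
    then have pm: "p m = c (?deg m) m" for m using val[of c m] by metis
    show "c = ?c"
    proof (intro ext)
      fix \<gamma> m
      have "c \<gamma> m = \<zero>" if "?deg m \<noteq> \<gamma>" using that c unfolding poly_rpart by blast
      then show "c \<gamma> m = ?c \<gamma> m" using pm[of m] by auto
    qed
  qed
  show ?thesis
  proof
    show "direct_decomposition ?P (rpart ?P)"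
      unfolding direct_decomposition_def using sub dec by blast
    fix p q \<gamma> \<delta> assume pq: "p \<in> rpart ?P \<gamma>" "q \<in> rpart ?P \<delta>"
    then have pqc: "p \<in> carrier ?P" "q \<in> carrier ?P" by (auto simp: poly_rpart)
    then have c: "\<And>m. p m \<in> carrier R" "\<And>m. q m \<in> carrier R" by (auto simp: poly_carrier)
    have "?deg m = \<gamma> + \<delta>" if "(p \<otimes>\<^bsub>?P\<^esub> q) m \<noteq> \<zero>" for m
    proof -
      obtain a b where "m = a + b" "p a \<noteq> \<zero>" "q b \<noteq> \<zero>"
        using conv_nonzero[of p q m, OF _ c] \<open>(p \<otimes>\<^bsub>?P\<^esub> q) m \<noteq> \<zero>\<close> unfolding poly_ops by blast
      then show ?thesis using pq by (simp add: poly_rpart)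
    qed
    then show "p \<otimes>\<^bsub>?P\<^esub> q \<in> rpart ?P (\<gamma> + \<delta>)"
      using pqc conv_closed unfolding poly_rpart by blast
  qed
qed

end

end

theory Submission
  imports Defs
begin

text \<open>The classical argument compares the two spectral sequences of the double complex
  \<open>C\<^sup>p(F\<^sub>q)\<close>, where \<open>C\<close> is the Cech complex. The proof below replaces them by dimension shifting
  along the cycles \<open>Z\<^sub>i\<close> and the boundaries \<open>B\<^sub>i\<close> of \<open>F\<close>, in one fixed degree \<open>\<delta>\<close>. If \<open>\<delta>\<close> is not in the
  union, then \<open>H\<^sup>l\<^sup>+\<^sup>i(F\<^sub>i)\<close> vanishes in degree \<open>\<delta>\<close> for all \<open>i\<close>, because Cech cohomology commutes with
  direct sums and shifts (\<open>koszul_acyclic_free\<close>). From this, \<open>H\<^sup>l\<^sup>+\<^sup>i\<^sup>+\<^sup>1(B\<^sub>i)\<close> vanishes in degree \<open>\<delta>\<close> for all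
  \<open>i\<close>, by descending induction on \<open>i\<close> (\<open>koszul_acyclic_boundaries\<close>): it does so if \<open>l + i + 1\<close> exceeds
  the number of generators of the ideal, and the step from \<open>i + 1\<close> to \<open>i\<close> uses the exact sequences
  \<open>0 \<rightarrow> B\<^sub>i\<^sub>+\<^sub>1 \<rightarrow> Z\<^sub>i\<^sub>+\<^sub>1 \<rightarrow> H\<^sub>i\<^sub>+\<^sub>1(F) \<rightarrow> 0\<close> and \<open>0 \<rightarrow> Z\<^sub>i\<^sub>+\<^sub>1 \<rightarrow> F\<^sub>i\<^sub>+\<^sub>1 \<rightarrow> B\<^sub>i \<rightarrow> 0\<close>. The bound on the
  cohomological dimension enters in the first one: it gives \<open>H\<^sup>l\<^sup>+\<^sup>i\<^sup>+\<^sup>2(H\<^sub>i\<^sub>+\<^sub>1(F)) = 0\<close>. At the end,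
  \<open>0 \<rightarrow> B\<^sub>0 \<rightarrow> F\<^sub>0 \<rightarrow> M \<rightarrow> 0\<close> together with \<open>H\<^sup>l(F\<^sub>0) = 0\<close> and \<open>H\<^sup>l\<^sup>+\<^sup>1(B\<^sub>0) = 0\<close> in degree \<open>\<delta>\<close> shows that
  \<open>H\<^sup>l(M)\<close> vanishes in degree \<open>\<delta>\<close>.

  Localizations are removed before any exact sequence is considered. The index set of the Cech
  complex is finite, so the entries of a cochain have a common exponent, \<open>c\<^sub>I = m\<^sub>I / f\<^sub>I\<^sup>k\<close> with
  \<open>f\<^sub>I = \<Prod>\<^sub>i\<^sub>\<in>\<^sub>I f\<^sub>i\<close>, and the Cech differential becomes the Koszul differential of the powers \<open>f\<^sub>i\<^sup>k\<close> on the
  numerators \<open>m\<^sub>I\<close> (\<open>cech_diff_fraction_cochain\<close>). Passing from \<open>k\<close> to \<open>k + s\<close> multiplies \<open>m\<^sub>I\<close> by \<open>f\<^sub>I\<^sup>s\<close>; a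
  fraction is zero exactly if its numerator becomes zero after such a step. Thus Cech cohomology is
  the direct limit over \<open>k\<close> of Koszul cohomology, and its vanishing in degree \<open>\<delta>\<close> says that every
  homogeneous Koszul cocycle of exponent \<open>k\<close> becomes a coboundary at some exponent \<open>k + s\<close>. This
  condition, \<open>koszul_acyclic\<close>, only speaks of elements of the module. It can therefore be stated for
  a subquotient \<open>Z / N\<close> by means of elements of \<open>Z\<close> and congruences modulo \<open>N\<close>, and the two diagram
  chases \<open>koszul_acyclic_extension\<close> and \<open>koszul_acyclic_image\<close> take place inside the modules \<open>F\<^sub>i\<close>.\<close>

section \<open>Fractions\<close>

locale localizable_module = module R M
  for R :: "('r, 'g::ab_group_add) gring" (structure)
    and M :: "('r, 'm, 'g) gmodule" (structure)
begin

lemma pow_smult: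
  assumes "f \<in> carrier R" "x \<in> carrier M"
  shows "(f [^] (a::nat)) \<odot>\<^bsub>M\<^esub> ((f [^] (b::nat)) \<odot>\<^bsub>M\<^esub> x) = (f [^] (a + b)) \<odot>\<^bsub>M\<^esub> x"
  using assms by (simp add: smult_assoc1[symmetric] nat_pow_mult)

lemma smult_commute:
  assumes "a \<in> carrier R" "b \<in> carrier R" "x \<in> carrier M"
  shows "a \<odot>\<^bsub>M\<^esub> (b \<odot>\<^bsub>M\<^esub> x) = b \<odot>\<^bsub>M\<^esub> (a \<odot>\<^bsub>M\<^esub> x)"
  using assms by (simp add: smult_assoc1[symmetric] m_comm)

lemma mem_fraction:
  assumes "f \<in> carrier R" "m \<in> carrier M"
  shows "(m', k') \<in> fraction R M f m k \<longleftrightarrow>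
    m' \<in> carrier M \<and> (\<exists>l. (f [^] (l + k')) \<odot>\<^bsub>M\<^esub> m = (f [^] (l + k)) \<odot>\<^bsub>M\<^esub> m')"
  using assms by (auto simp: fraction_def pow_smult)

text \<open>The common factor \<open>f\<^sup>k\<^sup>2\<close> has to be kept in the exponent, because \<open>f\<close> may be a zero divisor on the
  module.\<close>

lemma fraction_trans:
  fixes a b k1 k2 k3 :: nat
  assumes f: "f \<in> carrier R" and c: "m1 \<in> carrier M" "m2 \<in> carrier M" "m3 \<in> carrier M"
    and 1: "(f [^] (a + k2)) \<odot>\<^bsub>M\<^esub> m1 = (f [^] (a + k1)) \<odot>\<^bsub>M\<^esub> m2"
    and 2: "(f [^] (b + k3)) \<odot>\<^bsub>M\<^esub> m2 = (f [^] (b + k2)) \<odot>\<^bsub>M\<^esub> m3"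
  shows "(f [^] ((a + b + k2) + k3)) \<odot>\<^bsub>M\<^esub> m1 = (f [^] ((a + b + k2) + k1)) \<odot>\<^bsub>M\<^esub> m3"
proof -
  have "(f [^] ((a + b + k2) + k3)) \<odot>\<^bsub>M\<^esub> m1 = (f [^] (b + k3)) \<odot>\<^bsub>M\<^esub> ((f [^] (a + k2)) \<odot>\<^bsub>M\<^esub> m1)"
    using f c by (simp add: pow_smult ac_simps)
  also have "\<dots> = (f [^] (a + k1)) \<odot>\<^bsub>M\<^esub> ((f [^] (b + k3)) \<odot>\<^bsub>M\<^esub> m2)"
    unfolding 1 using f c by (simp add: smult_commute)
  also have "\<dots> = (f [^] ((a + b + k2) + k1)) \<odot>\<^bsub>M\<^esub> m3"
    unfolding 2 using f c by (simp add: pow_smult ac_simps)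
  finally show ?thesis .
qed

lemma fraction_eq_iff:
  assumes f: "f \<in> carrier R" and c: "m \<in> carrier M" "m' \<in> carrier M"
  shows "fraction R M f m k = fraction R M f m' k' \<longleftrightarrow>
    (\<exists>l. (f [^] (l + k')) \<odot>\<^bsub>M\<^esub> m = (f [^] (l + k)) \<odot>\<^bsub>M\<^esub> m')"
    (is "?L \<longleftrightarrow> ?R")
proof
  assume ?L
  moreover have "(m', k') \<in> fraction R M f m' k'" using f c by (simp add: mem_fraction)
  ultimately have "(m', k') \<in> fraction R M f m k" by simp
  then show ?R using f c by (simp add: mem_fraction)
next
  assume ?R
  then obtain l where l: "(f [^] (l + k')) \<odot>\<^bsub>M\<^esub> m = (f [^] (l + k)) \<odot>\<^bsub>M\<^esub> m'" by blast
  show ?L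
  proof (intro equalityI subrelI)
    fix n j
    assume "(n, j) \<in> fraction R M f m k"
    then obtain l' where n: "n \<in> carrier M"
      and l': "(f [^] (l' + j)) \<odot>\<^bsub>M\<^esub> m = (f [^] (l' + k)) \<odot>\<^bsub>M\<^esub> n"
      using f c by (auto simp: mem_fraction)
    show "(n, j) \<in> fraction R M f m' k'"
      using fraction_trans[OF f c(2,1) n l[symmetric] l'] f c n by (auto simp: mem_fraction)
  next
    fix n j
    assume "(n, j) \<in> fraction R M f m' k'"
    then obtain l' where n: "n \<in> carrier M"
      and l': "(f [^] (l' + j)) \<odot>\<^bsub>M\<^esub> m' = (f [^] (l' + k')) \<odot>\<^bsub>M\<^esub> n"
      using f c by (auto simp: mem_fraction)
    show "(n, j) \<in> fraction R M f m k"
      using fraction_trans[OF f c n l l'] f c n by (auto simp: mem_fraction)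
  qed
qed

lemma fraction_self:
  assumes "f \<in> carrier R" "m \<in> carrier M"
  shows "(m, k) \<in> fraction R M f m k"
  using assms by (simp add: mem_fraction)

lemma fraction_cancel:
  assumes "f \<in> carrier R" "m \<in> carrier M"
  shows "fraction R M f ((f [^] s) \<odot>\<^bsub>M\<^esub> m) (k + s) = fraction R M f m k"
  using assms by (subst fraction_eq_iff) (auto simp: pow_smult ac_simps)

lemma fraction_eq_same:
  assumes f: "f \<in> carrier R" and c: "m \<in> carrier M" "m' \<in> carrier M"
  shows "fraction R M f m k = fraction R M f m' k \<longleftrightarrow>
    (\<exists>s::nat. (f [^] s) \<odot>\<^bsub>M\<^esub> m = (f [^] s) \<odot>\<^bsub>M\<^esub> m')"
proof
  assume "\<exists>s::nat. (f [^] s) \<odot>\<^bsub>M\<^esub> m = (f [^] s) \<odot>\<^bsub>M\<^esub> m'"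
  then obtain s :: nat where "(f [^] s) \<odot>\<^bsub>M\<^esub> m = (f [^] s) \<odot>\<^bsub>M\<^esub> m'" by blast
  then show "fraction R M f m k = fraction R M f m' k"
    using fraction_cancel[of f m s k] fraction_cancel[of f m' s k] f c by simp
qed (use assms in \<open>auto simp: fraction_eq_iff\<close>)

lemma fraction_carrier:
  "m \<in> carrier M \<Longrightarrow> fraction R M f m k \<in> carrier (localization R M f)"
  by (auto simp: localization_def)

lemma localization_carrierE:
  assumes "U \<in> carrier (localization R M f)"
  obtains m k where "m \<in> carrier M" "U = fraction R M f m k"
  using assms by (auto simp: localization_def)

lemma fraction_zero:
  assumes f: "f \<in> carrier R"
  shows "\<zero>\<^bsub>localization R M f\<^esub> = fraction R M f \<zero>\<^bsub>M\<^esub> k"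
  using f fraction_cancel[OF f M.zero_closed, of k 0] by (simp add: localization_def)

text \<open>The operations on a localization are unions over all representatives of a fraction; this evaluates
  such a union once the summand is known not to depend on the representative.\<close>

lemma UN_constant_fraction:
  assumes "f \<in> carrier R" "m \<in> carrier M"
    "\<And>m' k'. (m', k') \<in> fraction R M f m k \<Longrightarrow> G m' k' = V"
  shows "(\<Union>(m', k')\<in>fraction R M f m k. G m' k') = V"
  using assms fraction_self[of f m k] by auto

lemma fraction_add_cross:
  assumes f: "f \<in> carrier R" and m: "m \<in> carrier M" "m' \<in> carrier M"
  shows "fraction R M f m k \<oplus>\<^bsub>localization R M f\<^esub> fraction R M f m' k' =
    fraction R M f ((f [^] k') \<odot>\<^bsub>M\<^esub> m \<oplus>\<^bsub>M\<^esub> (f [^] k) \<odot>\<^bsub>M\<^esub> m') (k + k')" (is "_ = ?V")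
proof -
  have "fraction R M f ((f [^] j') \<odot>\<^bsub>M\<^esub> n \<oplus>\<^bsub>M\<^esub> (f [^] j) \<odot>\<^bsub>M\<^esub> n') (j + j') = ?V"
    if n: "(n, j) \<in> fraction R M f m k" and n': "(n', j') \<in> fraction R M f m' k'" for n j n' j'
  proof -
    obtain a where nc: "n \<in> carrier M"
      and a: "(f [^] (a + j)) \<odot>\<^bsub>M\<^esub> m = (f [^] (a + k)) \<odot>\<^bsub>M\<^esub> n" using n f m by (auto simp: mem_fraction)
    obtain b where nc': "n' \<in> carrier M"
      and b: "(f [^] (b + j')) \<odot>\<^bsub>M\<^esub> m' = (f [^] (b + k')) \<odot>\<^bsub>M\<^esub> n'" using n' f m by (auto simp: mem_fraction)
    have 1: "(f [^] (a + b + (k + k') + j')) \<odot>\<^bsub>M\<^esub> n = (f [^] (a + b + (j + j') + k')) \<odot>\<^bsub>M\<^esub> m"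
    proof -
      have "(f [^] (a + b + (k + k') + j')) \<odot>\<^bsub>M\<^esub> n = (f [^] (b + k' + j')) \<odot>\<^bsub>M\<^esub> ((f [^] (a + k)) \<odot>\<^bsub>M\<^esub> n)"
        using f nc by (simp add: pow_smult ac_simps)
      also have "\<dots> = (f [^] (a + b + (j + j') + k')) \<odot>\<^bsub>M\<^esub> m"
        unfolding a[symmetric] using f m by (simp add: pow_smult ac_simps)
      finally show ?thesis .
    qed
    have 2: "(f [^] (a + b + (k + k') + j)) \<odot>\<^bsub>M\<^esub> n' = (f [^] (a + b + (j + j') + k)) \<odot>\<^bsub>M\<^esub> m'"
    proof -
      have "(f [^] (a + b + (k + k') + j)) \<odot>\<^bsub>M\<^esub> n' = (f [^] (a + k + j)) \<odot>\<^bsub>M\<^esub> ((f [^] (b + k')) \<odot>\<^bsub>M\<^esub> n')"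
        using f nc' by (simp add: pow_smult ac_simps)
      also have "\<dots> = (f [^] (a + b + (j + j') + k)) \<odot>\<^bsub>M\<^esub> m'"
        unfolding b[symmetric] using f m by (simp add: pow_smult ac_simps)
      finally show ?thesis .
    qed
    have "(f [^] (a + b + (k + k'))) \<odot>\<^bsub>M\<^esub> ((f [^] j') \<odot>\<^bsub>M\<^esub> n \<oplus>\<^bsub>M\<^esub> (f [^] j) \<odot>\<^bsub>M\<^esub> n') =
      (f [^] (a + b + (j + j'))) \<odot>\<^bsub>M\<^esub> ((f [^] k') \<odot>\<^bsub>M\<^esub> m \<oplus>\<^bsub>M\<^esub> (f [^] k) \<odot>\<^bsub>M\<^esub> m')"
      using f m nc nc' 1 2 by (simp add: smult_r_distr pow_smult)
    then show ?thesis using f m nc nc' by (subst fraction_eq_iff) auto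
  qed
  then have "(\<Union>(n, j)\<in>fraction R M f m k. \<Union>(n', j')\<in>fraction R M f m' k'.
      fraction R M f ((f [^] j') \<odot>\<^bsub>M\<^esub> n \<oplus>\<^bsub>M\<^esub> (f [^] j) \<odot>\<^bsub>M\<^esub> n') (j + j')) = ?V"
    using f m by (intro UN_constant_fraction)
  then show ?thesis by (simp only: localization_def ring.simps)
qed

lemma fraction_add:
  assumes f: "f \<in> carrier R" and m: "m \<in> carrier M" "m' \<in> carrier M"
  shows "fraction R M f m k \<oplus>\<^bsub>localization R M f\<^esub> fraction R M f m' k =
    fraction R M f (m \<oplus>\<^bsub>M\<^esub> m') k"
  using f m fraction_cancel[of f "m \<oplus>\<^bsub>M\<^esub> m'" k k]
  by (simp add: fraction_add_cross smult_r_distr)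

text \<open>Every family of fractions over a finite index set has a common exponent.\<close>

text \<open>The predicate \<open>P\<close> carries a property of numerators that survives multiplication by powers, such as
  being homogeneous of the degree that the exponent prescribes.\<close>

lemma common_exponent:
  assumes "finite \<I>"
    and "\<And>I. I \<in> \<I> \<Longrightarrow> f I \<in> carrier R"
    and "\<And>I. I \<in> \<I> \<Longrightarrow> \<exists>m k. P I k m \<and> m \<in> carrier M \<and> c I = fraction R M (f I) m k"
    and "\<And>I k m s. I \<in> \<I> \<Longrightarrow> P I k m \<Longrightarrow> m \<in> carrier M \<Longrightarrow> P I (k + s) ((f I [^] (s::nat)) \<odot>\<^bsub>M\<^esub> m)"
  obtains k m where "\<forall>I\<in>\<I>. P I k (m I)" "\<forall>I\<in>\<I>. m I \<in> carrier M"
    "\<forall>I\<in>\<I>. c I = fraction R M (f I) (m I) k"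
proof -
  from assms(3) obtain m k where
    mk: "\<And>I. I \<in> \<I> \<Longrightarrow> P I (k I) (m I) \<and> m I \<in> carrier M \<and> c I = fraction R M (f I) (m I) (k I)"
    by metis
  define K where "K = Max (k ` \<I>)"
  have K: "k I \<le> K" if "I \<in> \<I>" for I
    unfolding K_def using assms(1) that by simp
  show thesis
  proof (rule that[of K "\<lambda>I. (f I [^] (K - k I)) \<odot>\<^bsub>M\<^esub> m I"]; rule ballI)
    fix I assume I: "I \<in> \<I>"
    show "P I K ((f I [^] (K - k I)) \<odot>\<^bsub>M\<^esub> m I)"
      using assms(4)[OF I, of "k I" "m I" "K - k I"] mk[OF I] K[OF I] by simp
    show "(f I [^] (K - k I)) \<odot>\<^bsub>M\<^esub> m I \<in> carrier M"
      using mk[OF I] assms(2)[OF I] by simp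
    show "c I = fraction R M (f I) ((f I [^] (K - k I)) \<odot>\<^bsub>M\<^esub> m I) K"
      using fraction_cancel[OF assms(2)[OF I], of "m I" "K - k I" "k I"] mk[OF I] K[OF I] by simp
  qed
qed

lemma localization_carrier3E:
  assumes f: "f \<in> carrier R"
    and x: "x \<in> carrier (localization R M f)" and y: "y \<in> carrier (localization R M f)"
    and z: "z \<in> carrier (localization R M f)"
  obtains m1 m2 m3 k where "m1 \<in> carrier M" "m2 \<in> carrier M" "m3 \<in> carrier M"
    "x = fraction R M f m1 k" "y = fraction R M f m2 k" "z = fraction R M f m3 k"
proof -
  let ?U = "\<lambda>i::nat. if i = 0 then x else if i = 1 then y else z"
  have "\<exists>m k. True \<and> m \<in> carrier M \<and> ?U i = fraction R M f m k" for i
    using x y z localization_carrierE by metis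
  then obtain k m where m: "\<forall>i\<in>{0,1,2}. m i \<in> carrier M"
    and U: "\<forall>i\<in>{0,1,2}. ?U i = fraction R M f (m i) k"
    by (rule common_exponent[of "{0,1,2}" "\<lambda>_. f" "\<lambda>_ _ _. True" ?U, rotated 2]) (use f in auto)
  show thesis
    by (rule that[of "m 0" "m 1" "m 2" k]) (use m U in auto)
qed

text \<open>By the common exponent, the axioms for three fractions reduce to the axioms for their
  numerators.\<close>

lemma localization_group:
  assumes f: "f \<in> carrier R"
  shows "abelian_group (localization R M f)"
proof (rule abelian_groupI)
  let ?L = "localization R M f"
  show "\<zero>\<^bsub>?L\<^esub> \<in> carrier ?L" using f by (simp add: fraction_zero[of _ 0] fraction_carrier)
  fix x assume x: "x \<in> carrier ?L"
  obtain m k where m: "m \<in> carrier M" "x = fraction R M f m k"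
    using x by (rule localization_carrierE)
  show "\<zero>\<^bsub>?L\<^esub> \<oplus>\<^bsub>?L\<^esub> x = x"
    using f m by (simp add: fraction_zero[of _ k] fraction_add)
  have "fraction R M f (\<ominus>\<^bsub>M\<^esub> m) k \<oplus>\<^bsub>?L\<^esub> x = \<zero>\<^bsub>?L\<^esub>"
    using f m by (simp add: fraction_zero[of _ k] fraction_add M.l_neg)
  then show "\<exists>y\<in>carrier ?L. y \<oplus>\<^bsub>?L\<^esub> x = \<zero>\<^bsub>?L\<^esub>" using m by (meson M.a_inv_closed fraction_carrier)
  fix y assume y: "y \<in> carrier ?L"
  fix z assume z: "z \<in> carrier ?L"
  obtain m1 m2 m3 k where "m1 \<in> carrier M" "m2 \<in> carrier M" "m3 \<in> carrier M"
    and xyz: "x = fraction R M f m1 k" "y = fraction R M f m2 k" "z = fraction R M f m3 k"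
    using f x y z by (rule localization_carrier3E)
  then show "x \<oplus>\<^bsub>?L\<^esub> y \<in> carrier ?L" "x \<oplus>\<^bsub>?L\<^esub> y = y \<oplus>\<^bsub>?L\<^esub> x"
    "x \<oplus>\<^bsub>?L\<^esub> y \<oplus>\<^bsub>?L\<^esub> z = x \<oplus>\<^bsub>?L\<^esub> (y \<oplus>\<^bsub>?L\<^esub> z)"
    unfolding xyz using f by (simp_all add: fraction_add fraction_carrier M.a_ac)
qed

lemma fraction_neg:
  assumes f: "f \<in> carrier R" and m: "m \<in> carrier M"
  shows "\<ominus>\<^bsub>localization R M f\<^esub> fraction R M f m k = fraction R M f (\<ominus>\<^bsub>M\<^esub> m) k"
proof -
  interpret L: abelian_group "localization R M f" using f by (rule localization_group)
  have "fraction R M f (\<ominus>\<^bsub>M\<^esub> m) k \<oplus>\<^bsub>localization R M f\<^esub> fraction R M f m k = \<zero>\<^bsub>localization R M f\<^esub>"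
    unfolding fraction_zero[OF f, of k] using fraction_add[OF f M.a_inv_closed[OF m] m] M.l_neg[OF m] by simp
  then show ?thesis
    by (rule L.minus_equality) (use m in \<open>auto intro: fraction_carrier\<close>)
qed

lemma fraction_finsum:
  assumes f: "f \<in> carrier R" and A: "finite A" and m: "\<And>j. j \<in> A \<Longrightarrow> m j \<in> carrier M"
  shows "(\<Oplus>\<^bsub>localization R M f\<^esub>j\<in>A. fraction R M f (m j) k) = fraction R M f (\<Oplus>\<^bsub>M\<^esub>j\<in>A. m j) k"
proof -
  interpret L: abelian_group "localization R M f" using f by (rule localization_group)
  show ?thesis using A m
  proof (induction A)
    case empty
    show ?case using fraction_zero[OF f, of k] by (simp only: L.finsum_empty M.finsum_empty)
  next
    case (insert x A)
    have 1: "(\<lambda>j. fraction R M f (m j) k) \<in> A \<rightarrow> carrier (localization R M f)" "m \<in> A \<rightarrow> carrier M"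
      using insert by (auto intro: fraction_carrier)
    have 2: "m x \<in> carrier M" using insert by simp
    have IH: "(\<Oplus>\<^bsub>localization R M f\<^esub>j\<in>A. fraction R M f (m j) k) = fraction R M f (\<Oplus>\<^bsub>M\<^esub>j\<in>A. m j) k"
      using insert by simp
    show ?case
      unfolding L.finsum_insert[OF insert(1,2) 1(1) fraction_carrier[OF 2]] M.finsum_insert[OF insert(1,2) 1(2) 2] IH
      using f 1 2 by (intro fraction_add M.finsum_closed)
  qed
qed

lemma localization_map_fraction:
  assumes f: "f \<in> carrier R" and g: "g \<in> carrier R" and m: "m \<in> carrier M"
  shows "localization_map R M g (f \<otimes> g) (fraction R M f m k) =
    fraction R M (f \<otimes> g) ((g [^] k) \<odot>\<^bsub>M\<^esub> m) k"
  unfolding localization_map_def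
proof (rule UN_constant_fraction[OF f m])
  fix n j assume "(n, j) \<in> fraction R M f m k"
  then obtain l where n: "n \<in> carrier M" and l: "(f [^] (l + j)) \<odot>\<^bsub>M\<^esub> m = (f [^] (l + k)) \<odot>\<^bsub>M\<^esub> n"
    using f m by (auto simp: mem_fraction)
  have e: "((f \<otimes> g) [^] (l + i)) \<odot>\<^bsub>M\<^esub> ((g [^] i') \<odot>\<^bsub>M\<^esub> x) = (g [^] (l + i + i')) \<odot>\<^bsub>M\<^esub> ((f [^] (l + i)) \<odot>\<^bsub>M\<^esub> x)"
    if "x \<in> carrier M" for x and i i' :: nat
  proof -
    have "(f \<otimes> g) [^] (l + i) \<otimes> g [^] i' = g [^] (l + i + i') \<otimes> f [^] (l + i)"
      using f g by (simp add: nat_pow_distrib m_assoc nat_pow_mult) (simp add: m_comm)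
    then show ?thesis using that f g by (simp add: smult_assoc1[symmetric])
  qed
  have "((f \<otimes> g) [^] (l + k)) \<odot>\<^bsub>M\<^esub> ((g [^] j) \<odot>\<^bsub>M\<^esub> n) = ((f \<otimes> g) [^] (l + j)) \<odot>\<^bsub>M\<^esub> ((g [^] k) \<odot>\<^bsub>M\<^esub> m)"
    unfolding e[OF n] e[OF m] l by (simp add: add.assoc add.commute[of k j])
  then show "fraction R M (f \<otimes> g) ((g [^] j) \<odot>\<^bsub>M\<^esub> n) j = fraction R M (f \<otimes> g) ((g [^] k) \<odot>\<^bsub>M\<^esub> m) k"
    using f g m n by (subst fraction_eq_iff) auto
qed

end

section \<open>Finite sums and additive maps\<close>

lemma (in abelian_group) minus_eq_zero_iff:
  assumes "x \<in> carrier G" "y \<in> carrier G"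
  shows "x \<ominus> y = \<zero> \<longleftrightarrow> x = y"
  using assms by (metis minus_eq r_neg minus_equality minus_minus a_inv_closed)

lemma (in abelian_group) minus_add_cancel:
  assumes "x \<in> carrier G" "y \<in> carrier G"
  shows "(x \<ominus> y) \<oplus> y = x"
  using assms by (simp add: minus_eq a_assoc l_neg)

lemma (in abelian_group_hom) hom_finsum:
  assumes "m \<in> A \<rightarrow> carrier G"
  shows "h (finsum G m A) = (\<Oplus>\<^bsub>H\<^esub>a\<in>A. h (m a))"
  using assms
proof (induction A rule: infinite_finite_induct)
  case (insert a A)
  then have "m a \<in> carrier G" "m \<in> A \<rightarrow> carrier G" "(\<lambda>a. h (m a)) \<in> A \<rightarrow> carrier H" "h (m a) \<in> carrier H"
    by (auto simp: Pi_iff)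
  with insert show ?case by simp
qed simp_all

lemma abelian_group_hom_additiveI:
  assumes "abelian_group G" "abelian_group H" "\<And>x. x \<in> carrier G \<Longrightarrow> h x \<in> carrier H"
    "\<And>x y. x \<in> carrier G \<Longrightarrow> y \<in> carrier G \<Longrightarrow> h (x \<oplus>\<^bsub>G\<^esub> y) = h x \<oplus>\<^bsub>H\<^esub> h y"
  shows "abelian_group_hom G H h"
  using assms
  by (intro abelian_group_homI group_hom.intro group_hom_axioms.intro homI)
    (auto simp: abelian_group.a_group)

text \<open>The summands at \<open>(i, j)\<close> and \<open>(j, i)\<close> cancel. The induction adds a row and a column that are
  negatives of each other.\<close>

lemma (in abelian_group) finsum_antisymmetric:
  assumes "finite J" "\<And>i j. i \<in> J \<Longrightarrow> j \<in> J \<Longrightarrow> g i j \<in> carrier G"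
    and "\<And>i. i \<in> J \<Longrightarrow> g i i = \<zero>"
    and "\<And>i j. i \<in> J \<Longrightarrow> j \<in> J \<Longrightarrow> i \<noteq> j \<Longrightarrow> g i j = \<ominus> g j i"
  shows "(\<Oplus>i\<in>J. \<Oplus>j\<in>J. g i j) = \<zero>"
  using assms
proof (induction J)
  case empty
  show ?case by (rule finsum_empty)
next
  case (insert x J)
  have c: "(\<lambda>j. g x j) \<in> J \<rightarrow> carrier G" "(\<lambda>i. g i x) \<in> J \<rightarrow> carrier G" "g x x = \<zero>"
    "\<And>i. i \<in> J \<Longrightarrow> (\<lambda>j. g i j) \<in> J \<rightarrow> carrier G" "\<And>i. i \<in> J \<Longrightarrow> g i x \<in> carrier G"
    using insert.prems(1,2) by blast+
  have c2: "(\<lambda>i. \<Oplus>j\<in>J. g i j) \<in> J \<rightarrow> carrier G" using c by auto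
  have 1: "(\<Oplus>j\<in>insert x J. g i j) = g i x \<oplus> (\<Oplus>j\<in>J. g i j)" if "i \<in> J" for i
    using insert.hyps c(4,5)[OF that] by simp
  have 2: "(\<Oplus>j\<in>insert x J. g x j) = (\<Oplus>j\<in>J. g x j)"
    using insert.hyps c by simp
  have "(\<Oplus>i\<in>J. \<Oplus>j\<in>insert x J. g i j) = (\<Oplus>i\<in>J. g i x \<oplus> (\<Oplus>j\<in>J. g i j))"
    using 1 c(5) c2 by (intro finsum_cong') (auto simp: Pi_iff)
  also have "\<dots> = (\<Oplus>i\<in>J. g i x) \<oplus> (\<Oplus>i\<in>J. \<Oplus>j\<in>J. g i j)"
    by (rule finsum_addf[where f = "\<lambda>i. g i x" and g = "\<lambda>i. \<Oplus>j\<in>J. g i j", OF c(2) c2])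
  also have "(\<Oplus>i\<in>J. \<Oplus>j\<in>J. g i j) = \<zero>"
    by (intro insert.IH insert.prems) blast+
  finally have 3: "(\<Oplus>i\<in>J. \<Oplus>j\<in>insert x J. g i j) = (\<Oplus>i\<in>J. g i x)" using c by simp
  have "(\<Oplus>i\<in>insert x J. \<Oplus>j\<in>insert x J. g i j) = (\<Oplus>j\<in>J. g x j) \<oplus> (\<Oplus>i\<in>J. g i x)"
    unfolding 3[symmetric] 2[symmetric]
  proof (rule finsum_insert[OF insert.hyps])
    show "(\<lambda>i. \<Oplus>j\<in>insert x J. g i j) \<in> J \<rightarrow> carrier G" using 1 c(5) c2 by (auto simp: Pi_iff)
    show "(\<Oplus>j\<in>insert x J. g x j) \<in> carrier G" unfolding 2 using c(1) by simp
  qed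
  also have "\<dots> = (\<Oplus>i\<in>J. g x i \<oplus> g i x)"
    by (rule finsum_addf[where f = "\<lambda>j. g x j" and g = "\<lambda>i. g i x", OF c(1,2), symmetric])
  also have "\<dots> = \<zero>"
  proof (rule add.finprod_one_eqI)
    fix i assume i: "i \<in> J"
    then have "x \<noteq> i" using insert.hyps by auto
    then have "g x i = \<ominus> g i x" using i by (intro insert.prems) auto
    then show "g x i \<oplus> g i x = \<zero>" using c(5)[OF i] by (simp add: l_neg)
  qed
  finally show ?case .
qed

section \<open>Koszul differentials\<close>

definition signed :: "('m, 'x) ring_scheme \<Rightarrow> bool \<Rightarrow> 'm \<Rightarrow> 'm" where
  "signed M b x = (if b then x else \<ominus>\<^bsub>M\<^esub> x)"

text \<open>The differential of the Koszul cochain complex of the powers \<open>f\<^sub>j\<^sup>k\<close>, with the signs of the Cech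
  differential. A cochain is a function on all sets of indices, so that one formula serves all
  cohomological degrees; for \<open>J = {}\<close> the empty sum stands for the zero map into degree \<open>0\<close>.\<close>

definition koszul_diff ::
    "('r, 'g) gring \<Rightarrow> 'r list \<Rightarrow> ('r, 'm, 'g) gmodule \<Rightarrow> nat \<Rightarrow> (nat set \<Rightarrow> 'm) \<Rightarrow> nat set \<Rightarrow> 'm" where
  "koszul_diff R fs M k m J = (\<Oplus>\<^bsub>M\<^esub>j\<in>J. signed M (even (card {i \<in> J. i < j}))
     ((fs ! j [^]\<^bsub>R\<^esub> k) \<odot>\<^bsub>M\<^esub> m (J - {j})))"

text \<open>Removing \<open>j\<close> changes the sign at \<open>i\<close> exactly if \<open>j\<close> lies below \<open>i\<close>. Of two distinct indices
  exactly one lies below the other, which makes the two signs in \<open>koszul_diff_diff\<close> opposite.\<close>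

lemma even_card_below_remove:
  fixes J :: "nat set"
  assumes "finite J" "j \<in> J" "i \<noteq> j"
  shows "even (card {x \<in> J - {j}. x < i}) = (even (card {x \<in> J. x < i}) = (\<not> j < i))"
proof (cases "j < i")
  case True
  then have "{x \<in> J. x < i} = insert j {x \<in> J - {j}. x < i}" using assms by auto
  then have "card {x \<in> J. x < i} = Suc (card {x \<in> J - {j}. x < i})" using assms by simp
  then show ?thesis using True by simp
next
  case False
  then have "{x \<in> J. x < i} = {x \<in> J - {j}. x < i}" using assms by auto
  then show ?thesis using False by simp
qed

locale koszul_module = localizable_module R M
  for R :: "('r, 'g::ab_group_add) gring" (structure)
    and M :: "('r, 'm, 'g) gmodule" (structure) +
  fixes fs :: "'r list"
  assumes fs_closed: "set fs \<subseteq> carrier R"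
begin

lemma nth_fs_closed [simp]: "j < length fs \<Longrightarrow> fs ! j \<in> carrier R"
  using fs_closed by auto

lemma cech_elem_closed [simp]: "I \<subseteq> {..<length fs} \<Longrightarrow> cech_elem R fs I \<in> carrier R"
  unfolding cech_elem_def by (intro finprod_closed) auto

lemma cech_elem_remove:
  assumes "J \<subseteq> {..<length fs}" "j \<in> J"
  shows "cech_elem R fs (J - {j}) \<otimes> fs ! j = cech_elem R fs J"
proof -
  have fin: "finite (J - {j})" using assms(1) finite_subset by blast
  have "cech_elem R fs (insert j (J - {j})) = fs ! j \<otimes> cech_elem R fs (J - {j})"
    unfolding cech_elem_def using assms fin by (intro finprod_insert) auto
  moreover have "insert j (J - {j}) = J" using assms by auto
  ultimately show ?thesis using assms by (simp add: m_comm subset_iff)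
qed

lemma signed_closed [simp]: "x \<in> carrier M \<Longrightarrow> signed M b x \<in> carrier M"
  by (simp add: signed_def)

lemma signed_add:
  "x \<in> carrier M \<Longrightarrow> y \<in> carrier M \<Longrightarrow> signed M b (x \<oplus>\<^bsub>M\<^esub> y) = signed M b x \<oplus>\<^bsub>M\<^esub> signed M b y"
  by (simp add: signed_def M.minus_add)

lemma signed_smult:
  "a \<in> carrier R \<Longrightarrow> x \<in> carrier M \<Longrightarrow> signed M b (a \<odot>\<^bsub>M\<^esub> x) = a \<odot>\<^bsub>M\<^esub> signed M b x"
  by (simp add: signed_def smult_r_minus)

lemma signed_signed:
  "x \<in> carrier M \<Longrightarrow> signed M b (signed M c x) = signed M (b = c) x"
  by (simp add: signed_def)

lemma koszul_term_closed:
  assumes "m \<in> Pow {..<length fs} \<rightarrow> carrier M" "J \<subseteq> {..<length fs}" "j \<in> J"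
  shows "signed M b ((fs ! j [^] (k::nat)) \<odot>\<^bsub>M\<^esub> m (J - {j})) \<in> carrier M"
proof -
  have "J - {j} \<in> Pow {..<length fs}" using assms by auto
  then have "m (J - {j}) \<in> carrier M" using assms by blast
  then show ?thesis using assms by (simp add: subset_iff)
qed

lemma koszul_diff_closed:
  assumes "m \<in> Pow {..<length fs} \<rightarrow> carrier M" "J \<subseteq> {..<length fs}"
  shows "koszul_diff R fs M k m J \<in> carrier M"
  unfolding koszul_diff_def using koszul_term_closed[OF assms] by (intro M.finsum_closed) auto

lemma koszul_diff_cong:
  assumes "m \<in> Pow {..<length fs} \<rightarrow> carrier M" "J \<subseteq> {..<length fs}"
    "\<And>I. I \<subseteq> J \<Longrightarrow> Suc (card I) = card J \<Longrightarrow> m' I = m I"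
  shows "koszul_diff R fs M k m' J = koszul_diff R fs M k m J"
  unfolding koszul_diff_def
proof (rule M.finsum_cong')
  show "(\<lambda>j. signed M (even (card {i \<in> J. i < j})) ((fs ! j [^] k) \<odot>\<^bsub>M\<^esub> m (J - {j}))) \<in> J \<rightarrow> carrier M"
    using koszul_term_closed[OF assms(1,2)] by blast
  fix j assume j: "j \<in> J"
  have "finite J" using assms(2) finite_subset by blast
  then have "Suc (card (J - {j})) = card J" using j by (rule card_Suc_Diff1)
  then have "m' (J - {j}) = m (J - {j})" using assms(3) by blast
  then show "signed M (even (card {i \<in> J. i < j})) ((fs ! j [^] k) \<odot>\<^bsub>M\<^esub> m' (J - {j})) =
    signed M (even (card {i \<in> J. i < j})) ((fs ! j [^] k) \<odot>\<^bsub>M\<^esub> m (J - {j}))" by simp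
qed simp

text \<open>Naturality. It transports cocycles and primitives along the maps of the resolution, along the
  projection to a subquotient and to the coordinates of a direct sum.\<close>

lemma koszul_diff_hom:
  assumes N: "koszul_module R N fs"
    and h: "abelian_group_hom M N h"
    and lin: "\<And>a x. a \<in> carrier R \<Longrightarrow> x \<in> carrier M \<Longrightarrow> h (a \<odot>\<^bsub>M\<^esub> x) = a \<odot>\<^bsub>N\<^esub> h x"
    and m: "m \<in> Pow {..<length fs} \<rightarrow> carrier M" and J: "J \<subseteq> {..<length fs}"
  shows "h (koszul_diff R fs M k m J) = koszul_diff R fs N k (\<lambda>I. h (m I)) J"
proof -
  interpret N: koszul_module R N fs by fact
  interpret h: abelian_group_hom M N h by fact
  have hm: "(\<lambda>I. h (m I)) \<in> Pow {..<length fs} \<rightarrow> carrier N" using m by (auto simp: Pi_iff)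
  have "h (koszul_diff R fs M k m J) = (\<Oplus>\<^bsub>N\<^esub>j\<in>J. h (signed M (even (card {i \<in> J. i < j}))
     ((fs ! j [^] k) \<odot>\<^bsub>M\<^esub> m (J - {j}))))"
    unfolding koszul_diff_def using koszul_term_closed[OF m J] by (intro h.hom_finsum) blast
  also have "\<dots> = koszul_diff R fs N k (\<lambda>I. h (m I)) J"
    unfolding koszul_diff_def
  proof (rule N.M.finsum_cong')
    fix j assume j: "j \<in> J"
    have "m (J - {j}) \<in> carrier M" "fs ! j \<in> carrier R" using m J j by (auto simp: subset_iff)
    then show "h (signed M (even (card {i \<in> J. i < j})) ((fs ! j [^] k) \<odot>\<^bsub>M\<^esub> m (J - {j}))) =
      signed N (even (card {i \<in> J. i < j})) ((fs ! j [^] k) \<odot>\<^bsub>N\<^esub> h (m (J - {j})))"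
      by (simp add: signed_def lin)
  qed (use N.koszul_term_closed[OF hm J] in auto)
  finally show ?thesis .
qed

lemma koszul_diff_add:
  assumes m: "m \<in> Pow {..<length fs} \<rightarrow> carrier M" "m' \<in> Pow {..<length fs} \<rightarrow> carrier M"
    and J: "J \<subseteq> {..<length fs}"
  shows "koszul_diff R fs M k (\<lambda>I. m I \<oplus>\<^bsub>M\<^esub> m' I) J =
    koszul_diff R fs M k m J \<oplus>\<^bsub>M\<^esub> koszul_diff R fs M k m' J"
proof -
  have "koszul_diff R fs M k (\<lambda>I. m I \<oplus>\<^bsub>M\<^esub> m' I) J =
    (\<Oplus>\<^bsub>M\<^esub>j\<in>J. signed M (even (card {i \<in> J. i < j})) ((fs ! j [^] k) \<odot>\<^bsub>M\<^esub> m (J - {j})) \<oplus>\<^bsub>M\<^esub>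
      signed M (even (card {i \<in> J. i < j})) ((fs ! j [^] k) \<odot>\<^bsub>M\<^esub> m' (J - {j})))"
    unfolding koszul_diff_def
  proof (rule M.finsum_cong')
    fix j assume j: "j \<in> J"
    have "m (J - {j}) \<in> carrier M" "m' (J - {j}) \<in> carrier M" "fs ! j \<in> carrier R"
      using m J j by (auto simp: subset_iff)
    then show "signed M (even (card {i \<in> J. i < j})) ((fs ! j [^] k) \<odot>\<^bsub>M\<^esub> (m (J - {j}) \<oplus>\<^bsub>M\<^esub> m' (J - {j}))) =
      signed M (even (card {i \<in> J. i < j})) ((fs ! j [^] k) \<odot>\<^bsub>M\<^esub> m (J - {j})) \<oplus>\<^bsub>M\<^esub>
      signed M (even (card {i \<in> J. i < j})) ((fs ! j [^] k) \<odot>\<^bsub>M\<^esub> m' (J - {j}))"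
      by (simp add: signed_add smult_r_distr)
  qed (use koszul_term_closed[OF m(1) J] koszul_term_closed[OF m(2) J] in auto)
  also have "\<dots> = koszul_diff R fs M k m J \<oplus>\<^bsub>M\<^esub> koszul_diff R fs M k m' J"
    unfolding koszul_diff_def using koszul_term_closed[OF m(1) J] koszul_term_closed[OF m(2) J]
    by (subst M.finsum_addf[symmetric]) auto
  finally show ?thesis .
qed

lemma koszul_diff_neg:
  assumes m: "m \<in> Pow {..<length fs} \<rightarrow> carrier M" and J: "J \<subseteq> {..<length fs}"
  shows "koszul_diff R fs M k (\<lambda>I. \<ominus>\<^bsub>M\<^esub> m I) J = \<ominus>\<^bsub>M\<^esub> koszul_diff R fs M k m J"
proof -
  have "abelian_group_hom M M (a_inv M)"
    by (rule abelian_group_hom_additiveI) (auto simp: M.minus_add M.abelian_group_axioms)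
  then show ?thesis
    using koszul_diff_hom[OF koszul_module_axioms _ _ m J, of "a_inv M" k] by (simp add: smult_r_minus)
qed

lemma koszul_diff_minus:
  assumes m: "m \<in> Pow {..<length fs} \<rightarrow> carrier M" "m' \<in> Pow {..<length fs} \<rightarrow> carrier M"
    and J: "J \<subseteq> {..<length fs}"
  shows "koszul_diff R fs M k (\<lambda>I. m I \<ominus>\<^bsub>M\<^esub> m' I) J =
    koszul_diff R fs M k m J \<ominus>\<^bsub>M\<^esub> koszul_diff R fs M k m' J"
  using koszul_diff_add[of m "\<lambda>I. \<ominus>\<^bsub>M\<^esub> m' I" J k] koszul_diff_neg[OF m(2) J, of k] m J
  by (simp add: M.minus_eq Pi_iff)

text \<open>Multiplication by \<open>f\<^sub>I\<^sup>s\<close> is a map of complexes from exponent \<open>k\<close> to exponent \<open>k + s\<close>, because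
  \<open>f\<^sub>J = f\<^sub>J\<^sub>-\<^sub>{\<^sub>j\<^sub>} f\<^sub>j\<close>.\<close>

lemma koszul_diff_scale:
  assumes m: "m \<in> Pow {..<length fs} \<rightarrow> carrier M" and J: "J \<subseteq> {..<length fs}"
  shows "koszul_diff R fs M (k + s) (\<lambda>I. (cech_elem R fs I [^] s) \<odot>\<^bsub>M\<^esub> m I) J =
    (cech_elem R fs J [^] s) \<odot>\<^bsub>M\<^esub> koszul_diff R fs M k m J"
proof -
  have c: "cech_elem R fs J [^] s \<in> carrier R" using J by simp
  \<comment> \<open>multiplication by a scalar is additive and hence commutes with the defining sum\<close>
  have h: "abelian_group_hom M M (\<lambda>x. (cech_elem R fs J [^] s) \<odot>\<^bsub>M\<^esub> x)"
    using c by (intro abelian_group_hom_additiveI) (auto simp: smult_r_distr M.abelian_group_axioms)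
  have "(cech_elem R fs J [^] s) \<odot>\<^bsub>M\<^esub> koszul_diff R fs M k m J =
    (\<Oplus>\<^bsub>M\<^esub>j\<in>J. (cech_elem R fs J [^] s) \<odot>\<^bsub>M\<^esub> signed M (even (card {i \<in> J. i < j}))
      ((fs ! j [^] k) \<odot>\<^bsub>M\<^esub> m (J - {j})))"
    unfolding koszul_diff_def using koszul_term_closed[OF m J] by (intro abelian_group_hom.hom_finsum[OF h]) auto
  also have "\<dots> = koszul_diff R fs M (k + s) (\<lambda>I. (cech_elem R fs I [^] s) \<odot>\<^bsub>M\<^esub> m I) J"
    unfolding koszul_diff_def
  proof (rule M.finsum_cong')
    fix j assume j: "j \<in> J"
    have "J - {j} \<subseteq> {..<length fs}" using J by auto
    then have e: "cech_elem R fs (J - {j}) \<in> carrier R" by simp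
    have x: "m (J - {j}) \<in> carrier M" "fs ! j \<in> carrier R" using m J j by (auto simp: subset_iff)
    have "cech_elem R fs J [^] s \<otimes> fs ! j [^] k = fs ! j [^] (k + s) \<otimes> cech_elem R fs (J - {j}) [^] s"
      unfolding cech_elem_remove[OF J j, symmetric] using e x
      by (simp add: nat_pow_distrib nat_pow_mult[symmetric] m_ac)
    then have "(cech_elem R fs J [^] s) \<odot>\<^bsub>M\<^esub> ((fs ! j [^] k) \<odot>\<^bsub>M\<^esub> m (J - {j})) =
      (fs ! j [^] (k + s)) \<odot>\<^bsub>M\<^esub> ((cech_elem R fs (J - {j}) [^] s) \<odot>\<^bsub>M\<^esub> m (J - {j}))"
      using e x c by (simp add: smult_assoc1[symmetric])
    then show "(cech_elem R fs J [^] s) \<odot>\<^bsub>M\<^esub> signed M (even (card {i \<in> J. i < j}))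
        ((fs ! j [^] k) \<odot>\<^bsub>M\<^esub> m (J - {j})) = signed M (even (card {i \<in> J. i < j}))
        ((fs ! j [^] (k + s)) \<odot>\<^bsub>M\<^esub> ((cech_elem R fs (J - {j}) [^] s) \<odot>\<^bsub>M\<^esub> m (J - {j})))"
      using c x by (simp add: signed_smult[symmetric])
  next
    have "(\<lambda>I. (cech_elem R fs I [^] s) \<odot>\<^bsub>M\<^esub> m I) \<in> Pow {..<length fs} \<rightarrow> carrier M"
      using m by auto
    then show "(\<lambda>j. signed M (even (card {i \<in> J. i < j})) ((fs ! j [^] (k + s)) \<odot>\<^bsub>M\<^esub>
      ((cech_elem R fs (J - {j}) [^] s) \<odot>\<^bsub>M\<^esub> m (J - {j})))) \<in> J \<rightarrow> carrier M"
      using koszul_term_closed[OF _ J] by blast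
  qed simp
  finally show ?thesis ..
qed

lemma koszul_diff_diff:
  assumes m: "m \<in> Pow {..<length fs} \<rightarrow> carrier M" and J: "J \<subseteq> {..<length fs}"
  shows "koszul_diff R fs M k (koszul_diff R fs M k m) J = \<zero>\<^bsub>M\<^esub>"
proof -
  have fin: "finite J" using J finite_subset by blast
  define sg where "sg = (\<lambda>(J::nat set) j. even (card {i \<in> J. i < j}))"
  \<comment> \<open>the summand for removing first \<open>j\<close> and then \<open>i\<close>, extended by zero to the diagonal\<close>
  define g where "g = (\<lambda>j i. if i = j then \<zero>\<^bsub>M\<^esub> else signed M (sg J j = sg (J - {j}) i)
    ((fs ! j [^] k \<otimes> fs ! i [^] k) \<odot>\<^bsub>M\<^esub> m (J - {i, j})))"
  have f: "fs ! j \<in> carrier R" if "j \<in> J" for j using that J by (auto simp: subset_iff)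
  have mc: "m (J - K) \<in> carrier M" for K using m J by auto
  have gc: "g j i \<in> carrier M" if "j \<in> J" "i \<in> J" for i j using that f mc by (simp add: g_def)
  have inner: "signed M (sg J j) ((fs ! j [^] k) \<odot>\<^bsub>M\<^esub> koszul_diff R fs M k m (J - {j})) = (\<Oplus>\<^bsub>M\<^esub>i\<in>J. g j i)"
    if j: "j \<in> J" for j
  proof -
    have Jj: "J - {j} \<subseteq> {..<length fs}" using J by auto
    have h: "abelian_group_hom M M (\<lambda>x. signed M (sg J j) ((fs ! j [^] k) \<odot>\<^bsub>M\<^esub> x))"
      using f[OF j] by (intro abelian_group_hom_additiveI) (auto simp: smult_r_distr signed_add M.abelian_group_axioms)
    have "signed M (sg J j) ((fs ! j [^] k) \<odot>\<^bsub>M\<^esub> koszul_diff R fs M k m (J - {j})) =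
      (\<Oplus>\<^bsub>M\<^esub>i\<in>J - {j}. signed M (sg J j) ((fs ! j [^] k) \<odot>\<^bsub>M\<^esub>
        signed M (sg (J - {j}) i) ((fs ! i [^] k) \<odot>\<^bsub>M\<^esub> m (J - {j} - {i}))))"
      unfolding koszul_diff_def unfolding sg_def
      by (rule abelian_group_hom.hom_finsum[OF h[unfolded sg_def]]) (use koszul_term_closed[OF m Jj] in auto)
    also have "\<dots> = (\<Oplus>\<^bsub>M\<^esub>i\<in>J - {j}. g j i)"
    proof (rule M.finsum_cong')
      fix i assume i: "i \<in> J - {j}"
      have eq: "J - {j} - {i} = J - {i, j}" by auto
      show "signed M (sg J j) ((fs ! j [^] k) \<odot>\<^bsub>M\<^esub>
          signed M (sg (J - {j}) i) ((fs ! i [^] k) \<odot>\<^bsub>M\<^esub> m (J - {j} - {i}))) = g j i"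
        unfolding eq using i j f[of i] f[of j] mc
        by (simp add: g_def smult_assoc1 signed_smult[symmetric] signed_signed)
    qed (use gc j in auto)
    also have "\<dots> = g j j \<oplus>\<^bsub>M\<^esub> (\<Oplus>\<^bsub>M\<^esub>i\<in>J - {j}. g j i)"
    proof -
      have "(\<Oplus>\<^bsub>M\<^esub>i\<in>J - {j}. g j i) \<in> carrier M" using gc j by (intro M.finsum_closed) auto
      then show ?thesis by (simp add: g_def)
    qed
    also have "\<dots> = (\<Oplus>\<^bsub>M\<^esub>i\<in>insert j (J - {j}). g j i)"
      using gc j fin by (intro M.finsum_insert[symmetric]) auto
    also have "insert j (J - {j}) = J" using j by auto
    finally show ?thesis .
  qed
  have "koszul_diff R fs M k (koszul_diff R fs M k m) J = (\<Oplus>\<^bsub>M\<^esub>j\<in>J. \<Oplus>\<^bsub>M\<^esub>i\<in>J. g j i)"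
    unfolding koszul_diff_def[of R fs M k "koszul_diff R fs M k m" J]
  proof (rule M.finsum_cong')
    show "(\<lambda>j. \<Oplus>\<^bsub>M\<^esub>i\<in>J. g j i) \<in> J \<rightarrow> carrier M" using gc by auto
    show "signed M (even (card {i \<in> J. i < j})) ((fs ! j [^] k) \<odot>\<^bsub>M\<^esub> koszul_diff R fs M k m (J - {j})) =
      (\<Oplus>\<^bsub>M\<^esub>i\<in>J. g j i)" if "j \<in> J" for j
      by (rule inner[OF that, unfolded sg_def])
  qed (rule refl)
  also have "\<dots> = \<zero>\<^bsub>M\<^esub>"
  proof (rule M.finsum_antisymmetric[where g = g, OF fin])
    fix i j assume ij: "i \<in> J" "j \<in> J" "i \<noteq> j"
    have "sg (J - {j}) i = (sg J i = (\<not> j < i))"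
      unfolding sg_def by (rule even_card_below_remove[OF fin ij(2,3)])
    moreover have "sg (J - {i}) j = (sg J j = (\<not> i < j))"
      unfolding sg_def by (rule even_card_below_remove[OF fin ij(1) ij(3)[symmetric]])
    moreover have "(\<not> j < i) = (\<not> (\<not> i < j))" using ij(3) by linarith
    ultimately have sgn: "(sg J j = sg (J - {j}) i) = (\<not> (sg J i = sg (J - {i}) j))"
      by blast
    have c: "(fs ! j [^] k \<otimes> fs ! i [^] k) \<odot>\<^bsub>M\<^esub> m (J - {i, j}) \<in> carrier M"
      using f[OF ij(1)] f[OF ij(2)] mc by simp
    have e: "(fs ! i [^] k \<otimes> fs ! j [^] k) \<odot>\<^bsub>M\<^esub> m (J - {j, i}) =
        (fs ! j [^] k \<otimes> fs ! i [^] k) \<odot>\<^bsub>M\<^esub> m (J - {i, j})"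
      using f[OF ij(1)] f[OF ij(2)] by (simp only: m_comm[of "fs ! i [^] k"] nat_pow_closed insert_commute)
    show "g i j = \<ominus>\<^bsub>M\<^esub> g j i"
      using ij(3) c unfolding g_def e sgn signed_def by auto
  qed (use gc in \<open>auto simp: g_def\<close>)
  finally show ?thesis .
qed

lemma koszul_diff_submodule:
  assumes Z: "submodule Z R M" and m: "m \<in> Pow {..<length fs} \<rightarrow> Z" and J: "J \<subseteq> {..<length fs}"
  shows "koszul_diff R fs M k m J \<in> Z"
proof -
  interpret Z: submodule Z R M by fact
  have ZM: "Z \<subseteq> carrier M" using Z.subset by simp
  have "signed M b ((fs ! j [^] k) \<odot>\<^bsub>M\<^esub> m (J - {j})) \<in> Z" if j: "j \<in> J" for j b
  proof -
    have "m (J - {j}) \<in> Z" "fs ! j \<in> carrier R" using m J j by (auto simp: subset_iff)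
    then show ?thesis using submoduleE(4,3)[OF Z] by (simp add: signed_def)
  qed
  then have t: "(\<lambda>j. signed M (even (card {i \<in> J. i < j})) ((fs ! j [^] k) \<odot>\<^bsub>M\<^esub> m (J - {j}))) \<in> J \<rightarrow> Z"
    by blast
  have "finsum M t A \<in> Z" if "t \<in> A \<rightarrow> Z" for t and A :: "nat set"
    using that
  proof (induction A rule: infinite_finite_induct)
    case (insert a A)
    then have "t \<in> A \<rightarrow> carrier M" "t a \<in> carrier M" using ZM by auto
    then show ?case using insert submoduleE(5)[OF Z] by (simp add: Pi_iff)
  qed (use Z.one_closed in simp_all)
  then show ?thesis unfolding koszul_diff_def using t by blast
qed

end

section \<open>Homogeneous components\<close>

definition decomposes :: "('r, 'm, 'g) gmodule \<Rightarrow> 'm \<Rightarrow> ('g \<Rightarrow> 'm) \<Rightarrow> bool" where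
  "decomposes M x c \<longleftrightarrow> (\<forall>\<gamma>. c \<gamma> \<in> mpart M \<gamma>) \<and> finite {\<gamma>. c \<gamma> \<noteq> \<zero>\<^bsub>M\<^esub>} \<and>
     x = (\<Oplus>\<^bsub>M\<^esub>\<gamma>\<in>{\<gamma>. c \<gamma> \<noteq> \<zero>\<^bsub>M\<^esub>}. c \<gamma>)"

text \<open>The choice is unique only for elements of the carrier of a graded group.\<close>

definition component :: "('r, 'm, 'g) gmodule \<Rightarrow> 'g \<Rightarrow> 'm \<Rightarrow> 'm" where
  "component M \<delta> x = (THE c. decomposes M x c) \<delta>"

locale graded_abelian_group = abelian_group M for M :: "('r, 'm, 'g::ab_group_add) gmodule" (structure) +
  assumes decomposition: "direct_decomposition M (mpart M)"
begin

lemma mpart_subgroup: "additive_subgroup (mpart M \<gamma>) M"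
  using decomposition by (simp add: direct_decomposition_def)

lemma mpart_carrier: "x \<in> mpart M \<gamma> \<Longrightarrow> x \<in> carrier M"
  by (rule additive_subgroup.a_Hcarr[OF mpart_subgroup])

lemma mpart_zero [simp]: "\<zero> \<in> mpart M \<gamma>"
  by (rule additive_subgroup.zero_closed[OF mpart_subgroup])

lemma mpart_add: "x \<in> mpart M \<gamma> \<Longrightarrow> y \<in> mpart M \<gamma> \<Longrightarrow> x \<oplus> y \<in> mpart M \<gamma>"
  by (rule additive_subgroup.a_closed[OF mpart_subgroup])

lemma mpart_neg: "x \<in> mpart M \<gamma> \<Longrightarrow> \<ominus> x \<in> mpart M \<gamma>"
  by (rule additive_subgroup.a_inv_closed[OF mpart_subgroup])

lemma mpart_minus: "x \<in> mpart M \<gamma> \<Longrightarrow> y \<in> mpart M \<gamma> \<Longrightarrow> x \<ominus> y \<in> mpart M \<gamma>"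
  unfolding minus_eq by (intro mpart_add mpart_neg)

lemma ex1_decomposes: "x \<in> carrier M \<Longrightarrow> \<exists>!c. decomposes M x c"
  using decomposition unfolding direct_decomposition_def decomposes_def by blast

text \<open>Here \<open>A\<close> may be larger than the support of \<open>c\<close>, which frees later decompositions from computing
  exact supports.\<close>

lemma component_eqI:
  assumes A: "finite A" and c: "\<And>\<gamma>. c \<gamma> \<in> mpart M \<gamma>" and z: "\<And>\<gamma>. \<gamma> \<notin> A \<Longrightarrow> c \<gamma> = \<zero>"
    and x: "x = (\<Oplus>\<gamma>\<in>A. c \<gamma>)"
  shows "component M \<delta> x = c \<delta>"
proof -
  have cc: "c \<in> B \<rightarrow> carrier M" for B using c mpart_carrier by blast
  have sub: "{\<gamma>. c \<gamma> \<noteq> \<zero>} \<subseteq> A" using z by blast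
  have "(\<Oplus>\<gamma>\<in>{\<gamma>. c \<gamma> \<noteq> \<zero>}. c \<gamma>) = (\<Oplus>\<gamma>\<in>A. c \<gamma>)"
    by (rule add.finprod_mono_neutral_cong_left[OF A sub _ _ cc]) auto
  then have P: "decomposes M x c" using c x finite_subset[OF sub A] by (simp add: decomposes_def)
  have xc: "x \<in> carrier M" unfolding x using cc by (rule finsum_closed)
  have "(THE c. decomposes M x c) = c" by (rule the1_equality) (rule ex1_decomposes[OF xc], rule P)
  then show ?thesis by (simp add: component_def)
qed

lemma componentE:
  assumes x: "x \<in> carrier M"
  obtains A where "finite A" "\<forall>\<gamma>. component M \<gamma> x \<in> mpart M \<gamma>"
    "\<forall>\<gamma>. \<gamma> \<notin> A \<longrightarrow> component M \<gamma> x = \<zero>" "x = (\<Oplus>\<gamma>\<in>A. component M \<gamma> x)"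
proof -
  have "decomposes M x (THE c. decomposes M x c)" using ex1_decomposes[OF x] by (rule theI')
  moreover have "(THE c. decomposes M x c) = (\<lambda>\<gamma>. component M \<gamma> x)" by (simp add: component_def)
  ultimately have "decomposes M x (\<lambda>\<gamma>. component M \<gamma> x)" by simp
  then show thesis by (intro that[of "{\<gamma>. component M \<gamma> x \<noteq> \<zero>}"]) (auto simp: decomposes_def)
qed

lemma component_mpart: "x \<in> carrier M \<Longrightarrow> component M \<delta> x \<in> mpart M \<delta>"
  using componentE by blast

lemma component_closed [simp]: "x \<in> carrier M \<Longrightarrow> component M \<delta> x \<in> carrier M"
  using component_mpart mpart_carrier by blast

lemma component_homogeneous:
  assumes x: "x \<in> mpart M \<delta>"
  shows "component M \<delta> x = x"
proof -
  have "component M \<delta> x = (if \<delta> = \<delta> then x else \<zero>)"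
    by (rule component_eqI[of "{\<delta>}" "\<lambda>\<gamma>. if \<gamma> = \<delta> then x else \<zero>"]) (use x mpart_carrier[OF x] in auto)
  then show ?thesis by simp
qed

text \<open>An additive map that shifts degrees by \<open>\<epsilon>\<close> commutes with taking components, because it carries
  the decomposition of an element to a decomposition of its image.\<close>

lemma component_hom:
  assumes N: "graded_abelian_group N" and h: "abelian_group_hom M N h"
    and deg: "\<And>\<gamma> x. x \<in> mpart M \<gamma> \<Longrightarrow> h x \<in> mpart N (\<gamma> + \<epsilon>)"
    and x: "x \<in> carrier M"
  shows "component N (\<delta> + \<epsilon>) (h x) = h (component M \<delta> x)"
proof -
  interpret N: graded_abelian_group N by fact
  interpret h: abelian_group_hom M N h by fact
  obtain A where A: "finite A" "\<forall>\<gamma>. component M \<gamma> x \<in> mpart M \<gamma>"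
    "\<forall>\<gamma>. \<gamma> \<notin> A \<longrightarrow> component M \<gamma> x = \<zero>" "x = (\<Oplus>\<gamma>\<in>A. component M \<gamma> x)"
    using x by (rule componentE)
  \<comment> \<open>the candidate for the component of degree \<open>\<gamma>\<close> of the image\<close>
  define c where "c \<gamma> = h (component M (\<gamma> - \<epsilon>) x)" for \<gamma>
  have cm: "c \<gamma> \<in> mpart N \<gamma>" for \<gamma>
    unfolding c_def using deg[OF A(2)[rule_format, of "\<gamma> - \<epsilon>"]] by simp
  have "h x = (\<Oplus>\<^bsub>N\<^esub>\<gamma>\<in>A. h (component M \<gamma> x))"
    by (subst A(4), rule h.hom_finsum) (use x in auto)
  also have "\<dots> = (\<Oplus>\<^bsub>N\<^esub>\<gamma>\<in>A. c (\<gamma> + \<epsilon>))" by (simp add: c_def)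
  also have "\<dots> = (\<Oplus>\<^bsub>N\<^esub>\<gamma>\<in>(\<lambda>\<gamma>. \<gamma> + \<epsilon>) ` A. c \<gamma>)"
    by (rule N.add.finprod_reindex[symmetric]) (use cm N.mpart_carrier in \<open>auto simp: inj_on_def\<close>)
  finally have "h x = (\<Oplus>\<^bsub>N\<^esub>\<gamma>\<in>(\<lambda>\<gamma>. \<gamma> + \<epsilon>) ` A. c \<gamma>)" .
  moreover have "c \<gamma> = \<zero>\<^bsub>N\<^esub>" if "\<gamma> \<notin> (\<lambda>\<gamma>. \<gamma> + \<epsilon>) ` A" for \<gamma>
  proof -
    have "\<gamma> - \<epsilon> \<notin> A" using that by (metis diff_add_cancel imageI)
    then show ?thesis by (simp add: c_def A(3))
  qed
  ultimately have "component N (\<delta> + \<epsilon>) (h x) = c (\<delta> + \<epsilon>)"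
    using A(1) cm by (intro N.component_eqI) auto
  then show ?thesis by (simp add: c_def)
qed

lemma component_additive: "abelian_group_hom M M (component M \<delta>)"
proof (rule abelian_group_hom_additiveI)
  fix x y assume x: "x \<in> carrier M" and y: "y \<in> carrier M"
  obtain A where A: "finite A" "\<forall>\<gamma>. component M \<gamma> x \<in> mpart M \<gamma>"
    "\<forall>\<gamma>. \<gamma> \<notin> A \<longrightarrow> component M \<gamma> x = \<zero>" "x = (\<Oplus>\<gamma>\<in>A. component M \<gamma> x)"
    using x by (rule componentE)
  obtain B where B: "finite B" "\<forall>\<gamma>. component M \<gamma> y \<in> mpart M \<gamma>"
    "\<forall>\<gamma>. \<gamma> \<notin> B \<longrightarrow> component M \<gamma> y = \<zero>" "y = (\<Oplus>\<gamma>\<in>B. component M \<gamma> y)"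
    using y by (rule componentE)
  have cx: "(\<lambda>\<gamma>. component M \<gamma> x) \<in> C \<rightarrow> carrier M" for C using x by simp
  have cy: "(\<lambda>\<gamma>. component M \<gamma> y) \<in> C \<rightarrow> carrier M" for C using y by simp
  have "(\<Oplus>\<gamma>\<in>A. component M \<gamma> x) = (\<Oplus>\<gamma>\<in>A \<union> B. component M \<gamma> x)"
    by (rule add.finprod_mono_neutral_cong_left[OF _ _ _ _ cx]) (use A B(1) in auto)
  moreover have "(\<Oplus>\<gamma>\<in>B. component M \<gamma> y) = (\<Oplus>\<gamma>\<in>A \<union> B. component M \<gamma> y)"
    by (rule add.finprod_mono_neutral_cong_left[OF _ _ _ _ cy]) (use B A(1) in auto)
  ultimately have "x \<oplus> y = (\<Oplus>\<gamma>\<in>A \<union> B. component M \<gamma> x \<oplus> component M \<gamma> y)"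
    unfolding finsum_addf[OF cx cy] using A(4) B(4) by simp
  then show "component M \<delta> (x \<oplus> y) = component M \<delta> x \<oplus> component M \<delta> y"
    using A(1-3) B(1-3) by (intro component_eqI[of "A \<union> B"] mpart_add) simp_all
qed (simp_all add: abelian_group_axioms)

end

lemma (in graded_abelian_group) mpart_unique:
  assumes x: "x \<in> mpart M \<delta>" "x \<in> mpart M \<delta>'" "x \<noteq> \<zero>"
  shows "\<delta> = \<delta>'"
proof -
  have "component M \<delta> x = (if \<delta> = \<delta>' then x else \<zero>)"
    by (rule component_eqI[of "{\<delta>'}" "\<lambda>\<gamma>. if \<gamma> = \<delta>' then x else \<zero>"])
      (use x(2) mpart_carrier[OF x(2)] in auto)
  then show ?thesis using x(3) component_homogeneous[OF x(1)] by (auto split: if_splits)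
qed

lemma (in graded_module) graded_abelian_group_M: "graded_abelian_group M"
  using M.abelian_group_axioms module_decomposition
  by (simp add: graded_abelian_group_def graded_abelian_group_axioms_def)

section \<open>The ring as a graded module over itself\<close>

lemma (in graded_ring) rpart_carrier:
  assumes "a \<in> rpart R \<gamma>"
  shows "a \<in> carrier R"
proof -
  have "additive_subgroup (rpart R \<gamma>) R"
    using ring_decomposition by (simp add: direct_decomposition_def)
  then show ?thesis using assms by (rule additive_subgroup.a_Hcarr)
qed

lemma regular_module_simps [simp]:
  "carrier (regular_module R) = carrier R" "\<zero>\<^bsub>regular_module R\<^esub> = \<zero>\<^bsub>R\<^esub>"
  "x \<oplus>\<^bsub>regular_module R\<^esub> y = x \<oplus>\<^bsub>R\<^esub> y" "a \<odot>\<^bsub>regular_module R\<^esub> x = a \<otimes>\<^bsub>R\<^esub> x"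
  "mpart (regular_module R) = rpart R"
  by (simp_all add: regular_module_def)

context graded_ring
begin

lemma regular_module_group: "abelian_group (regular_module R)"
  by (rule abelian_groupI) (use a_assoc a_comm l_neg in \<open>auto intro: bexI[of _ "\<ominus> x" for x]\<close>)

lemma regular_module_finsum: "c \<in> A \<rightarrow> carrier R \<Longrightarrow> finsum (regular_module R) c A = finsum R c A"
proof (induction A rule: infinite_finite_induct)
  interpret reg: abelian_group "regular_module R" by (rule regular_module_group)
  case (infinite A)
  then show ?case by (simp add: reg.finsum_infinite)
next
  interpret reg: abelian_group "regular_module R" by (rule regular_module_group)
  case empty
  show ?case by (simp add: reg.finsum_empty)
next
  interpret reg: abelian_group "regular_module R" by (rule regular_module_group)
  case (insert a A)
  then show ?case by (simp add: reg.finsum_insert)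
qed

lemma regular_module_graded: "graded_module R (regular_module R)"
proof (intro graded_module.intro graded_module_axioms.intro)
  show "graded_ring R" by (rule graded_ring_axioms)
  show "module R (regular_module R)"
    by (rule moduleI) (simp_all add: regular_module_group is_cring l_distr r_distr m_assoc)
  have sub: "additive_subgroup (rpart R \<gamma>) R" for \<gamma>
    using ring_decomposition by (simp add: direct_decomposition_def)
  have "additive_subgroup (rpart R \<gamma>) (regular_module R)" for \<gamma>
  proof -
    interpret reg: abelian_group "regular_module R" by (rule regular_module_group)
    have neg: "\<ominus>\<^bsub>regular_module R\<^esub> x = \<ominus> x" if "x \<in> carrier R" for x
      using that by (intro reg.minus_equality) (simp_all add: l_neg)
    have c: "x \<in> rpart R \<gamma> \<Longrightarrow> x \<in> carrier R" for x
      by (rule additive_subgroup.a_Hcarr[OF sub])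
    show ?thesis
    proof (rule additive_subgroup.intro, rule reg.add.subgroupI)
      show "rpart R \<gamma> \<noteq> {}" using additive_subgroup.zero_closed[OF sub] by blast
      show "\<ominus>\<^bsub>regular_module R\<^esub> x \<in> rpart R \<gamma>" if "x \<in> rpart R \<gamma>" for x
        using neg[OF c[OF that]] additive_subgroup.a_inv_closed[OF sub that] by simp
    qed (use c additive_subgroup.a_closed[OF sub] in auto)
  qed
  moreover have "\<exists>!c. (\<forall>\<gamma>. c \<gamma> \<in> rpart R \<gamma>) \<and> finite {\<gamma>. c \<gamma> \<noteq> \<zero>} \<and>
      x = finsum (regular_module R) c {\<gamma>. c \<gamma> \<noteq> \<zero>}" if x: "x \<in> carrier R" for x
  proof -
    have "finsum (regular_module R) c {\<gamma>. c \<gamma> \<noteq> \<zero>} = finsum R c {\<gamma>. c \<gamma> \<noteq> \<zero>}" if "\<forall>\<gamma>. c \<gamma> \<in> rpart R \<gamma>" for c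
      by (rule regular_module_finsum) (use that additive_subgroup.a_Hcarr[OF sub] in auto)
    then have "((\<forall>\<gamma>. c \<gamma> \<in> rpart R \<gamma>) \<and> finite {\<gamma>. c \<gamma> \<noteq> \<zero>} \<and> x = finsum (regular_module R) c {\<gamma>. c \<gamma> \<noteq> \<zero>}) =
      ((\<forall>\<gamma>. c \<gamma> \<in> rpart R \<gamma>) \<and> finite {\<gamma>. c \<gamma> \<noteq> \<zero>} \<and> x = finsum R c {\<gamma>. c \<gamma> \<noteq> \<zero>})" for c by metis
    moreover have "\<exists>!c. (\<forall>\<gamma>. c \<gamma> \<in> rpart R \<gamma>) \<and> finite {\<gamma>. c \<gamma> \<noteq> \<zero>} \<and> x = finsum R c {\<gamma>. c \<gamma> \<noteq> \<zero>}"
      using ring_decomposition x by (simp add: direct_decomposition_def)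
    ultimately show ?thesis by simp
  qed
  ultimately show "direct_decomposition (regular_module R) (mpart (regular_module R))"
    by (simp add: direct_decomposition_def)
qed (simp add: rpart_mult)

text \<open>Multiplication by the component of degree \<open>0\<close> of the unit fixes every homogeneous element, hence
  also the sum of the components of the unit.\<close>

lemma one_degree: "\<one> \<in> rpart R 0"
proof -
  interpret reg: graded_module R "regular_module R" by (rule regular_module_graded)
  interpret gr: graded_abelian_group "regular_module R" by (rule reg.graded_abelian_group_M)
  let ?c = "\<lambda>\<delta>. component (regular_module R) \<delta> \<one>"
  have c0: "?c 0 \<in> carrier R" using gr.component_closed[of \<one> 0] by simp
  have id: "x \<otimes> ?c 0 = x" if x: "x \<in> rpart R \<delta>" for x \<delta>
  proof -
    have xc: "x \<in> carrier R" using x by (rule rpart_carrier)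
    have "abelian_group_hom (regular_module R) (regular_module R) (\<lambda>y. x \<otimes> y)"
      using xc by (intro abelian_group_hom_additiveI) (auto simp: r_distr regular_module_group)
    moreover have "x \<otimes> y \<in> mpart (regular_module R) (\<gamma> + \<delta>)" if "y \<in> mpart (regular_module R) \<gamma>" for \<gamma> y
      using rpart_mult[OF x, of y \<gamma>] that by (simp add: add.commute)
    ultimately have "component (regular_module R) (0 + \<delta>) (x \<otimes> \<one>) = x \<otimes> ?c 0"
      by (intro gr.component_hom[OF gr.graded_abelian_group_axioms]) simp_all
    then show ?thesis using gr.component_homogeneous[of x \<delta>] x xc by simp
  qed
  have "\<one> \<in> carrier (regular_module R)" by simp
  then obtain A where A: "finite A" "\<forall>\<gamma>. ?c \<gamma> \<in> mpart (regular_module R) \<gamma>"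
    "\<forall>\<gamma>. \<gamma> \<notin> A \<longrightarrow> ?c \<gamma> = \<zero>\<^bsub>regular_module R\<^esub>" "\<one> = (\<Oplus>\<^bsub>regular_module R\<^esub>\<gamma>\<in>A. ?c \<gamma>)"
    by (rule gr.componentE)
  have cc: "(\<lambda>\<gamma>. ?c \<gamma>) \<in> A \<rightarrow> carrier R" using gr.component_closed[of \<one>] by simp
  have one: "(\<Oplus>\<gamma>\<in>A. ?c \<gamma>) = \<one>" using A(4) regular_module_finsum[OF cc] by simp
  have "?c 0 = (\<Oplus>\<gamma>\<in>A. ?c \<gamma>) \<otimes> ?c 0" unfolding one using c0 by simp
  also have "\<dots> = (\<Oplus>\<gamma>\<in>A. ?c \<gamma> \<otimes> ?c 0)" using A(1) c0 cc by (rule finsum_ldistr)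
  also have "\<dots> = (\<Oplus>\<gamma>\<in>A. ?c \<gamma>)"
  proof (rule finsum_cong'[OF refl cc])
    show "?c \<gamma> \<otimes> ?c 0 = ?c \<gamma>" for \<gamma> using A(2) by (intro id[of _ \<gamma>]) simp
  qed
  finally show ?thesis using one A(2) by (metis regular_module_simps(5))
qed

lemma rpart_unique:
  assumes "a \<in> rpart R \<delta>" "a \<in> rpart R \<delta>'" "a \<noteq> \<zero>"
  shows "\<delta> = \<delta>'"
proof -
  interpret reg: graded_module R "regular_module R" by (rule regular_module_graded)
  show ?thesis
    using graded_abelian_group.mpart_unique[OF reg.graded_abelian_group_M, of a \<delta> \<delta>'] assms by simp
qed

end

section \<open>Graded Koszul cochains\<close>

text \<open>The degree of \<open>f\<^sub>I\<^sup>k\<close>, if \<open>f\<^sub>i\<close> has degree \<open>e i\<close>. The inner sum is the multiple \<open>k\<close> of \<open>e i\<close>.\<close>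

definition pow_degree :: "(nat \<Rightarrow> 'g::ab_group_add) \<Rightarrow> nat \<Rightarrow> nat set \<Rightarrow> 'g" where
  "pow_degree e k I = (\<Sum>i\<in>I. \<Sum>t<k. e i)"

lemma pow_degree_add: "pow_degree e (k + s) I = pow_degree e k I + pow_degree e s I"
proof -
  have "(\<Sum>t<k + s. e i) = (\<Sum>t<k. e i) + (\<Sum>t<s. e i)" for i
    by (induction s) (simp_all add: add.assoc)
  then show ?thesis by (simp add: pow_degree_def sum.distrib)
qed

lemma pow_degree_remove:
  assumes "finite J" "j \<in> J"
  shows "pow_degree e k (J - {j}) + (\<Sum>t<k. e j) = pow_degree e k J"
  using assms by (simp add: pow_degree_def sum.remove[of J j] add.commute)

locale graded_koszul = graded_module R M
  for R :: "('r, 'g::ab_group_add) gring" (structure)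
    and M :: "('r, 'm, 'g) gmodule" (structure) +
  fixes fs :: "'r list" and e :: "nat \<Rightarrow> 'g"
  assumes fs_degree: "i < length fs \<Longrightarrow> fs ! i \<in> rpart R (e i)"

sublocale graded_koszul \<subseteq> gr: graded_abelian_group M
  by (rule graded_abelian_group_M)

sublocale graded_koszul \<subseteq> koszul_module R M fs
proof unfold_locales
  show "set fs \<subseteq> carrier R"
  proof
    fix f assume "f \<in> set fs"
    then obtain i where "i < length fs" "f = fs ! i" by (metis in_set_conv_nth)
    then show "f \<in> carrier R" using rpart_carrier[OF fs_degree] by simp
  qed
qed

text \<open>The numerators over \<open>f\<^sub>I\<^sup>k\<close> of the Cech cochains of degree \<open>\<gamma>\<close>, in all cohomological degrees at
  once.\<close>

definition graded_cochains ::
    "('r, 'm, 'g::ab_group_add) gmodule \<Rightarrow> nat \<Rightarrow> (nat \<Rightarrow> 'g) \<Rightarrow> 'g \<Rightarrow> nat \<Rightarrow> 'm set \<Rightarrow> (nat set \<Rightarrow> 'm) set" where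
  "graded_cochains M n e \<gamma> k Z = (\<Pi> I\<in>Pow {..<n}. Z \<inter> mpart M (\<gamma> + pow_degree e k I))"

text \<open>Vanishing of the \<open>p\<close>-th Cech cohomology of \<open>Z / N\<close> in degree \<open>\<gamma>\<close>, expressed by representatives
  in \<open>Z\<close>: a cocycle modulo \<open>N\<close> becomes a coboundary modulo \<open>N\<close> in the direct limit over the
  exponent \<open>k\<close>.\<close>

definition koszul_acyclic ::
    "('r, 'g::ab_group_add) gring \<Rightarrow> 'r list \<Rightarrow> (nat \<Rightarrow> 'g) \<Rightarrow> ('r, 'm, 'g) gmodule \<Rightarrow>
      'm set \<Rightarrow> 'm set \<Rightarrow> nat \<Rightarrow> 'g \<Rightarrow> bool" where
  "koszul_acyclic R fs e M Z N p \<gamma> \<longleftrightarrow>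
    (\<forall>k. \<forall>m\<in>graded_cochains M (length fs) e \<gamma> k Z.
      (\<forall>J\<in>cech_index fs (Suc p). koszul_diff R fs M k m J \<in> N) \<longrightarrow>
      (\<exists>s. \<exists>m'\<in>graded_cochains M (length fs) e \<gamma> (k + s) Z. \<forall>J\<in>cech_index fs p.
        (cech_elem R fs J [^]\<^bsub>R\<^esub> s) \<odot>\<^bsub>M\<^esub> m J \<ominus>\<^bsub>M\<^esub> koszul_diff R fs M (k + s) m' J \<in> N))"

lemma koszul_acyclicE:
  assumes "koszul_acyclic R fs e M Z N p \<gamma>" "m \<in> graded_cochains M (length fs) e \<gamma> k Z"
    "\<And>J. J \<in> cech_index fs (Suc p) \<Longrightarrow> koszul_diff R fs M k m J \<in> N"
  obtains s m' where "m' \<in> graded_cochains M (length fs) e \<gamma> (k + s) Z"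
    "\<forall>J\<in>cech_index fs p.
      (cech_elem R fs J [^]\<^bsub>R\<^esub> s) \<odot>\<^bsub>M\<^esub> m J \<ominus>\<^bsub>M\<^esub> koszul_diff R fs M (k + s) m' J \<in> N"
  using assms unfolding koszul_acyclic_def by blast

context graded_koszul
begin

lemma pow_homogeneous: "a \<in> rpart R \<delta> \<Longrightarrow> a [^] (k::nat) \<in> rpart R (\<Sum>t<k. \<delta>)"
  by (induction k) (simp_all add: one_degree rpart_mult)

lemma cech_elem_degree:
  assumes "I \<subseteq> {..<length fs}"
  shows "cech_elem R fs I [^] k \<in> rpart R (pow_degree e k I)"
proof -
  have "finite I" using assms finite_subset by blast
  then show ?thesis using assms
  proof (induction I)
    case empty
    show ?case by (simp add: cech_elem_def pow_degree_def one_degree)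
  next
    case (insert i I)
    have c: "(!) fs \<in> I \<rightarrow> carrier R" "fs ! i \<in> carrier R" using insert.prems by auto
    have I: "I \<subseteq> {..<length fs}" using insert.prems by simp
    have "cech_elem R fs (insert i I) = fs ! i \<otimes> cech_elem R fs I"
      unfolding cech_elem_def using insert.hyps c by (rule finprod_insert)
    then have "cech_elem R fs (insert i I) [^] k = (fs ! i) [^] k \<otimes> cech_elem R fs I [^] k"
      using c(2) I by (simp add: nat_pow_distrib)
    moreover have "(fs ! i) [^] k \<in> rpart R (\<Sum>t<k. e i)"
      using insert.prems fs_degree by (intro pow_homogeneous) auto
    moreover have "pow_degree e k (insert i I) = (\<Sum>t<k. e i) + pow_degree e k I"
      using insert.hyps by (simp add: pow_degree_def)
    ultimately show ?case using insert.IH[OF I] by (simp only: rpart_mult)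
  qed
qed

lemma signed_mpart: "x \<in> mpart M \<delta> \<Longrightarrow> signed M b x \<in> mpart M \<delta>"
  by (simp add: signed_def gr.mpart_neg)

lemma finsum_mpart: "t \<in> A \<rightarrow> mpart M \<delta> \<Longrightarrow> finsum M t A \<in> mpart M \<delta>"
proof (induction A rule: infinite_finite_induct)
  case (insert a A)
  then have "t \<in> A \<rightarrow> carrier M" "t a \<in> carrier M" using gr.mpart_carrier by auto
  then show ?case using insert gr.mpart_add by (simp add: Pi_iff)
qed simp_all

lemma koszul_term_degree:
  assumes "J \<subseteq> {..<length fs}" "j \<in> J" "x \<in> mpart M (\<gamma> + pow_degree e k (J - {j}))"
  shows "signed M b ((fs ! j [^] k) \<odot>\<^bsub>M\<^esub> x) \<in> mpart M (\<gamma> + pow_degree e k J)"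
proof (rule signed_mpart)
  have "fs ! j [^] k \<in> rpart R (\<Sum>t<k. e j)"
    using assms fs_degree by (intro pow_homogeneous) auto
  then have "(fs ! j [^] k) \<odot>\<^bsub>M\<^esub> x \<in> mpart M ((\<Sum>t<k. e j) + (\<gamma> + pow_degree e k (J - {j})))"
    using assms(3) by (rule mpart_smult)
  moreover have "(\<Sum>t<k. e j) + (\<gamma> + pow_degree e k (J - {j})) = \<gamma> + pow_degree e k J"
    using pow_degree_remove[of J j e k] assms finite_subset[OF assms(1)] by (simp add: ac_simps)
  ultimately show "(fs ! j [^] k) \<odot>\<^bsub>M\<^esub> x \<in> mpart M (\<gamma> + pow_degree e k J)" by simp
qed

text \<open>The factor \<open>f\<^sub>j\<^sup>k\<close> shifts degrees by the difference of the degrees that are prescribed at \<open>J\<close> and at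
  \<open>J - {j}\<close>.\<close>

lemma koszul_diff_component:
  assumes m: "m \<in> Pow {..<length fs} \<rightarrow> carrier M" and J: "J \<subseteq> {..<length fs}"
  shows "component M (\<gamma> + pow_degree e k J) (koszul_diff R fs M k m J) =
    koszul_diff R fs M k (\<lambda>I. component M (\<gamma> + pow_degree e k I) (m I)) J"
proof -
  have cm: "(\<lambda>I. component M (\<gamma> + pow_degree e k I) (m I)) \<in> Pow {..<length fs} \<rightarrow> carrier M"
    using m by (auto simp: Pi_iff)
  have "component M (\<gamma> + pow_degree e k J) (koszul_diff R fs M k m J) =
    (\<Oplus>\<^bsub>M\<^esub>j\<in>J. component M (\<gamma> + pow_degree e k J) (signed M (even (card {i \<in> J. i < j}))
      ((fs ! j [^] k) \<odot>\<^bsub>M\<^esub> m (J - {j}))))"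
    unfolding koszul_diff_def using koszul_term_closed[OF m J]
    by (intro abelian_group_hom.hom_finsum[OF gr.component_additive]) blast
  also have "\<dots> = koszul_diff R fs M k (\<lambda>I. component M (\<gamma> + pow_degree e k I) (m I)) J"
    unfolding koszul_diff_def
  proof (rule M.finsum_cong')
    fix j assume j: "j \<in> J"
    let ?h = "\<lambda>x. signed M (even (card {i \<in> J. i < j})) ((fs ! j [^] k) \<odot>\<^bsub>M\<^esub> x)"
    have f: "fs ! j \<in> carrier R" using J j by auto
    have fin: "finite J" using J finite_subset by blast
    have "abelian_group_hom M M ?h"
      using f by (intro abelian_group_hom_additiveI) (auto simp: smult_r_distr signed_add M.abelian_group_axioms)
    moreover have "?h x \<in> mpart M (\<delta> + (\<Sum>t<k. e j))" if x: "x \<in> mpart M \<delta>" for \<delta> x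
    proof -
      have "?h x \<in> mpart M (\<delta> - pow_degree e k (J - {j}) + pow_degree e k J)"
        by (rule koszul_term_degree[OF J j]) (simp add: x)
      then show ?thesis unfolding pow_degree_remove[OF fin j, of e k, symmetric] by (simp add: algebra_simps)
    qed
    moreover have "m (J - {j}) \<in> carrier M" using m J by auto
    ultimately have "component M (\<gamma> + pow_degree e k (J - {j}) + (\<Sum>t<k. e j)) (?h (m (J - {j}))) =
        ?h (component M (\<gamma> + pow_degree e k (J - {j})) (m (J - {j})))"
      by (intro gr.component_hom[OF gr.graded_abelian_group_axioms])
    then show "component M (\<gamma> + pow_degree e k J) (?h (m (J - {j}))) =
        ?h (component M (\<gamma> + pow_degree e k (J - {j})) (m (J - {j})))"
      unfolding add.assoc pow_degree_remove[OF fin j] .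
  qed (use koszul_term_closed[OF cm J] in auto)
  finally show ?thesis .
qed

end

definition graded_submodule :: "('r, 'g) gring \<Rightarrow> ('r, 'm, 'g) gmodule \<Rightarrow> 'm set \<Rightarrow> bool" where
  "graded_submodule R M Z \<longleftrightarrow> submodule Z R M \<and> (\<forall>x\<in>Z. \<forall>\<delta>. component M \<delta> x \<in> Z)"

lemma cech_index_subset: "J \<in> cech_index fs p \<Longrightarrow> J \<subseteq> {..<length fs}"
  by (simp add: cech_index_def)

context graded_koszul
begin

lemma submodule_closed:
  assumes "submodule Z R M"
  shows "Z \<subseteq> carrier M" "\<zero>\<^bsub>M\<^esub> \<in> Z" "\<And>x y. x \<in> Z \<Longrightarrow> y \<in> Z \<Longrightarrow> x \<oplus>\<^bsub>M\<^esub> y \<in> Z"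
    "\<And>x y. x \<in> Z \<Longrightarrow> y \<in> Z \<Longrightarrow> x \<ominus>\<^bsub>M\<^esub> y \<in> Z" "\<And>a x. a \<in> carrier R \<Longrightarrow> x \<in> Z \<Longrightarrow> a \<odot>\<^bsub>M\<^esub> x \<in> Z"
proof -
  note E = submoduleE[OF assms]
  show "Z \<subseteq> carrier M" by (rule E(1))
  obtain z where z: "z \<in> Z" using E(2) by blast
  then have "z \<oplus>\<^bsub>M\<^esub> (\<ominus>\<^bsub>M\<^esub> z) \<in> Z" using E(3) E(5) by blast
  then show "\<zero>\<^bsub>M\<^esub> \<in> Z" using z E(1) by (simp add: M.r_neg subset_iff)
  show "\<And>x y. x \<in> Z \<Longrightarrow> y \<in> Z \<Longrightarrow> x \<ominus>\<^bsub>M\<^esub> y \<in> Z" unfolding M.minus_eq using E(3) E(5) by blast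
qed (rule submoduleE(5)[OF assms], assumption+, rule submoduleE(4)[OF assms])

lemma zero_submodule: "submodule {\<zero>\<^bsub>M\<^esub>} R M"
  by (rule submoduleI) auto

lemma graded_cochains_closed:
  assumes "m \<in> graded_cochains M (length fs) e \<gamma> k Z"
  shows "m \<in> Pow {..<length fs} \<rightarrow> carrier M" "m \<in> Pow {..<length fs} \<rightarrow> Z"
  using assms gr.mpart_carrier by (auto simp: graded_cochains_def Pi_iff)

lemma graded_cochains_scale:
  assumes Z: "submodule Z R M" and m: "m \<in> graded_cochains M (length fs) e \<gamma> k Z"
  shows "(\<lambda>I. (cech_elem R fs I [^] s) \<odot>\<^bsub>M\<^esub> m I) \<in> graded_cochains M (length fs) e \<gamma> (k + s) Z"
  unfolding graded_cochains_def
proof (intro Pi_I IntI)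
  fix I assume "I \<in> Pow {..<length fs}"
  then have I: "I \<subseteq> {..<length fs}" by simp
  have mI: "m I \<in> Z" "m I \<in> mpart M (\<gamma> + pow_degree e k I)"
    using m I by (auto simp: graded_cochains_def Pi_iff)
  show "(cech_elem R fs I [^] s) \<odot>\<^bsub>M\<^esub> m I \<in> Z"
    using submodule_closed(5)[OF Z _ mI(1)] I by simp
  have "(cech_elem R fs I [^] s) \<odot>\<^bsub>M\<^esub> m I \<in> mpart M (pow_degree e s I + (\<gamma> + pow_degree e k I))"
    using cech_elem_degree[OF I] mI(2) by (rule mpart_smult)
  then show "(cech_elem R fs I [^] s) \<odot>\<^bsub>M\<^esub> m I \<in> mpart M (\<gamma> + pow_degree e (k + s) I)"
    by (simp add: pow_degree_add ac_simps)
qed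

lemma graded_cochains_add:
  assumes Z: "submodule Z R M"
    and "m \<in> graded_cochains M (length fs) e \<gamma> k Z" "m' \<in> graded_cochains M (length fs) e \<gamma> k Z"
  shows "(\<lambda>I. m I \<oplus>\<^bsub>M\<^esub> m' I) \<in> graded_cochains M (length fs) e \<gamma> k Z"
  using assms submodule_closed(3)[OF Z] gr.mpart_add by (simp add: graded_cochains_def Pi_iff)

lemma graded_cochains_minus:
  assumes Z: "submodule Z R M"
    and "m \<in> graded_cochains M (length fs) e \<gamma> k Z" "m' \<in> graded_cochains M (length fs) e \<gamma> k Z"
  shows "(\<lambda>I. m I \<ominus>\<^bsub>M\<^esub> m' I) \<in> graded_cochains M (length fs) e \<gamma> k Z"
  using assms submodule_closed(4)[OF Z] gr.mpart_minus by (simp add: graded_cochains_def Pi_iff)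

lemma graded_cochains_diff:
  assumes Z: "submodule Z R M" and m: "m \<in> graded_cochains M (length fs) e \<gamma> k Z"
  shows "koszul_diff R fs M k m \<in> graded_cochains M (length fs) e \<gamma> k Z"
  unfolding graded_cochains_def
proof (intro Pi_I IntI)
  fix J assume "J \<in> Pow {..<length fs}"
  then have J: "J \<subseteq> {..<length fs}" by simp
  show "koszul_diff R fs M k m J \<in> Z"
    using Z graded_cochains_closed(2)[OF m] J by (rule koszul_diff_submodule)
  show "koszul_diff R fs M k m J \<in> mpart M (\<gamma> + pow_degree e k J)"
    unfolding koszul_diff_def
  proof (intro finsum_mpart Pi_I koszul_term_degree[OF J])
    fix j assume "j \<in> J"
    then have "J - {j} \<in> Pow {..<length fs}" using J by auto
    then show "m (J - {j}) \<in> mpart M (\<gamma> + pow_degree e k (J - {j}))"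
      using m by (auto simp: graded_cochains_def Pi_iff)
  qed
qed

lemma graded_cochains_restrict:
  assumes "\<zero>\<^bsub>M\<^esub> \<in> Z" "m \<in> graded_cochains M (length fs) e \<gamma> k Y" "\<And>J. J \<in> cech_index fs p \<Longrightarrow> m J \<in> Z"
  shows "(\<lambda>I. if card I = p then m I else \<zero>\<^bsub>M\<^esub>) \<in> graded_cochains M (length fs) e \<gamma> k Z"
  using assms by (auto simp: graded_cochains_def Pi_iff cech_index_def)

text \<open>The differential at \<open>J\<close> only reads the values at sets with one element less, so that a cochain can
  be replaced by zero in all other cohomological degrees.\<close>

lemma koszul_diff_restrict:
  assumes m: "m \<in> Pow {..<length fs} \<rightarrow> carrier M" and J: "J \<in> cech_index fs (Suc p)"
  shows "koszul_diff R fs M k (\<lambda>I. if card I = p then m I else \<zero>\<^bsub>M\<^esub>) J = koszul_diff R fs M k m J"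
  by (rule koszul_diff_cong[OF m cech_index_subset[OF J]]) (use J in \<open>auto simp: cech_index_def\<close>)

text \<open>A primitive of a homogeneous cocycle can be made homogeneous by taking components. This is needed
  because the coboundaries in the definition of Cech cohomology are images of arbitrary cochains.\<close>

lemma koszul_acyclic_inhomogeneousI:
  assumes Z: "graded_submodule R M Z" and N: "graded_submodule R M N"
    and ex: "\<And>k m. m \<in> graded_cochains M (length fs) e \<gamma> k Z \<Longrightarrow>
      \<forall>J\<in>cech_index fs (Suc p). koszul_diff R fs M k m J \<in> N \<Longrightarrow>
      \<exists>s. \<exists>m'\<in>Pow {..<length fs} \<rightarrow> Z. \<forall>J\<in>cech_index fs p.
        (cech_elem R fs J [^] s) \<odot>\<^bsub>M\<^esub> m J \<ominus>\<^bsub>M\<^esub> koszul_diff R fs M (k + s) m' J \<in> N"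
  shows "koszul_acyclic R fs e M Z N p \<gamma>"
  unfolding koszul_acyclic_def
proof (intro allI ballI impI)
  have Zs: "submodule Z R M" using Z by (simp add: graded_submodule_def)
  note ZM = submodule_closed(1)[OF Zs]
  fix k m assume m: "m \<in> graded_cochains M (length fs) e \<gamma> k Z"
    and cyc: "\<forall>J\<in>cech_index fs (Suc p). koszul_diff R fs M k m J \<in> N"
  obtain s m' where m': "m' \<in> Pow {..<length fs} \<rightarrow> Z"
    and eq: "\<forall>J\<in>cech_index fs p.
        (cech_elem R fs J [^] s) \<odot>\<^bsub>M\<^esub> m J \<ominus>\<^bsub>M\<^esub> koszul_diff R fs M (k + s) m' J \<in> N"
    using ex[OF m cyc] by blast
  define m'' where "m'' I = component M (\<gamma> + pow_degree e (k + s) I) (m' I)" for I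
  have m'M: "m' \<in> Pow {..<length fs} \<rightarrow> carrier M" using m' ZM by blast
  have m'': "m'' \<in> graded_cochains M (length fs) e \<gamma> (k + s) Z"
    unfolding graded_cochains_def m''_def using m' ZM Z gr.component_mpart
    by (auto simp: Pi_iff graded_submodule_def)
  have "(cech_elem R fs J [^] s) \<odot>\<^bsub>M\<^esub> m J \<ominus>\<^bsub>M\<^esub> koszul_diff R fs M (k + s) m'' J \<in> N"
    if J: "J \<in> cech_index fs p" for J
  proof -
    note JP = cech_index_subset[OF J]
    let ?x = "(cech_elem R fs J [^] s) \<odot>\<^bsub>M\<^esub> m J" and ?y = "koszul_diff R fs M (k + s) m' J"
    let ?\<delta> = "\<gamma> + pow_degree e (k + s) J"
    interpret c: abelian_group_hom M M "component M ?\<delta>" by (rule gr.component_additive)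
    have x: "?x \<in> mpart M ?\<delta>"
      using graded_cochains_scale[OF Zs m, of s] JP by (auto simp: graded_cochains_def Pi_iff)
    have y: "?y \<in> carrier M" using m'M JP by (rule koszul_diff_closed)
    have "component M ?\<delta> (?x \<ominus>\<^bsub>M\<^esub> ?y) = component M ?\<delta> ?x \<ominus>\<^bsub>M\<^esub> component M ?\<delta> ?y"
      using y gr.mpart_carrier[OF x] by (simp add: M.minus_eq)
    also have "\<dots> = ?x \<ominus>\<^bsub>M\<^esub> koszul_diff R fs M (k + s) m'' J"
      unfolding koszul_diff_component[OF m'M JP] gr.component_homogeneous[OF x] m''_def ..
    finally show ?thesis using N eq J unfolding graded_submodule_def by metis
  qed
  then show "\<exists>s. \<exists>m'\<in>graded_cochains M (length fs) e \<gamma> (k + s) Z. \<forall>J\<in>cech_index fs p.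
        (cech_elem R fs J [^] s) \<odot>\<^bsub>M\<^esub> m J \<ominus>\<^bsub>M\<^esub> koszul_diff R fs M (k + s) m' J \<in> N"
    using m'' by blast
qed

section \<open>Exact sequences\<close>

text \<open>The sequence \<open>0 \<rightarrow> B \<rightarrow> Z \<rightarrow> Z / B \<rightarrow> 0\<close>: a cocycle of \<open>Z\<close> minus a coboundary lies in \<open>B\<close>, where it is a
  cocycle and therefore a coboundary, always after raising the exponent.\<close>

lemma koszul_acyclic_extension:
  assumes Z: "submodule Z R M" and B: "submodule B R M" and BZ: "B \<subseteq> Z"
    and aB: "koszul_acyclic R fs e M B {\<zero>\<^bsub>M\<^esub>} p \<gamma>" and aZB: "koszul_acyclic R fs e M Z B p \<gamma>"
  shows "koszul_acyclic R fs e M Z {\<zero>\<^bsub>M\<^esub>} p \<gamma>"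
  unfolding koszul_acyclic_def
proof (intro allI ballI impI)
  fix k m assume m: "m \<in> graded_cochains M (length fs) e \<gamma> k Z"
    and cyc: "\<forall>J\<in>cech_index fs (Suc p). koszul_diff R fs M k m J \<in> {\<zero>\<^bsub>M\<^esub>}"
  note B0 = submodule_closed(2)[OF B] and mc = graded_cochains_closed[OF m]
  obtain s m' where m': "m' \<in> graded_cochains M (length fs) e \<gamma> (k + s) Z"
    and eq: "\<forall>J\<in>cech_index fs p.
        (cech_elem R fs J [^] s) \<odot>\<^bsub>M\<^esub> m J \<ominus>\<^bsub>M\<^esub> koszul_diff R fs M (k + s) m' J \<in> B"
    by (rule koszul_acyclicE[OF aZB m]) (use cyc B0 in auto)
  note m'c = graded_cochains_closed[OF m']
  let ?t = "\<lambda>I. (cech_elem R fs I [^] s) \<odot>\<^bsub>M\<^esub> m I"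
  have t: "?t \<in> graded_cochains M (length fs) e \<gamma> (k + s) Z" using Z m by (rule graded_cochains_scale)
  define b where "b = (\<lambda>I. ?t I \<ominus>\<^bsub>M\<^esub> koszul_diff R fs M (k + s) m' I)"
  \<comment> \<open>only in cohomological degree \<open>p\<close> does \<open>b\<close> have values in \<open>B\<close>\<close>
  define b0 where "b0 = (\<lambda>I. if card I = p then b I else \<zero>\<^bsub>M\<^esub>)"
  have b: "b \<in> graded_cochains M (length fs) e \<gamma> (k + s) Z"
    unfolding b_def using Z t m' by (intro graded_cochains_minus graded_cochains_diff)
  have b0: "b0 \<in> graded_cochains M (length fs) e \<gamma> (k + s) B"
    unfolding b0_def using B0 b by (rule graded_cochains_restrict) (use eq in \<open>simp add: b_def\<close>)
  have cyc_b: "koszul_diff R fs M (k + s) b0 J \<in> {\<zero>\<^bsub>M\<^esub>}" if J: "J \<in> cech_index fs (Suc p)" for J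
  proof -
    note JP = cech_index_subset[OF J]
    have "koszul_diff R fs M (k + s) b0 J = koszul_diff R fs M (k + s) b J"
      unfolding b0_def using graded_cochains_closed(1)[OF b] J by (rule koszul_diff_restrict)
    also have "\<dots> = koszul_diff R fs M (k + s) ?t J \<ominus>\<^bsub>M\<^esub> koszul_diff R fs M (k + s) (koszul_diff R fs M (k + s) m') J"
      unfolding b_def
      using graded_cochains_closed(1)[OF t] graded_cochains_closed(1)[OF graded_cochains_diff[OF Z m']] JP
      by (rule koszul_diff_minus)
    also have "koszul_diff R fs M (k + s) ?t J = \<zero>\<^bsub>M\<^esub>"
      using koszul_diff_scale[OF mc(1) JP, of k s] cyc J JP by simp
    also have "koszul_diff R fs M (k + s) (koszul_diff R fs M (k + s) m') J = \<zero>\<^bsub>M\<^esub>"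
      using m'c(1) JP by (rule koszul_diff_diff)
    finally show ?thesis by (simp add: M.minus_eq)
  qed
  obtain s' b' where b': "b' \<in> graded_cochains M (length fs) e \<gamma> (k + s + s') B"
    and eq': "\<forall>J\<in>cech_index fs p.
        (cech_elem R fs J [^] s') \<odot>\<^bsub>M\<^esub> b0 J \<ominus>\<^bsub>M\<^esub> koszul_diff R fs M (k + s + s') b' J \<in> {\<zero>\<^bsub>M\<^esub>}"
    by (rule koszul_acyclicE[OF aB b0]) (use cyc_b in auto)
  let ?t' = "\<lambda>I. (cech_elem R fs I [^] s') \<odot>\<^bsub>M\<^esub> m' I"
  have t': "?t' \<in> graded_cochains M (length fs) e \<gamma> (k + s + s') Z" using Z m' by (rule graded_cochains_scale)
  have b'Z: "b' \<in> graded_cochains M (length fs) e \<gamma> (k + s + s') Z"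
    using b' BZ by (auto simp: graded_cochains_def Pi_iff)
  have "(cech_elem R fs J [^] (s + s')) \<odot>\<^bsub>M\<^esub> m J \<ominus>\<^bsub>M\<^esub>
      koszul_diff R fs M (k + (s + s')) (\<lambda>I. b' I \<oplus>\<^bsub>M\<^esub> ?t' I) J \<in> {\<zero>\<^bsub>M\<^esub>}" if J: "J \<in> cech_index fs p" for J
  proof -
    note JP = cech_index_subset[OF J]
    have f: "cech_elem R fs J \<in> carrier R" using JP by simp
    have c: "m J \<in> carrier M" "b J \<in> carrier M" "koszul_diff R fs M (k + s) m' J \<in> carrier M"
      using mc(1) graded_cochains_closed(1)[OF b] JP koszul_diff_closed[OF m'c(1) JP] by auto
    have bb: "b J = b0 J" using J by (simp add: b0_def cech_index_def)
    have "(cech_elem R fs J [^] s') \<odot>\<^bsub>M\<^esub> b J \<ominus>\<^bsub>M\<^esub> koszul_diff R fs M (k + s + s') b' J = \<zero>\<^bsub>M\<^esub>"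
      using eq' J unfolding bb by simp
    then have fb: "(cech_elem R fs J [^] s') \<odot>\<^bsub>M\<^esub> b J = koszul_diff R fs M (k + s + s') b' J"
      using f c koszul_diff_closed[OF graded_cochains_closed(1)[OF b'] JP] by (subst (asm) M.minus_eq_zero_iff) auto
    have "?t J = b J \<oplus>\<^bsub>M\<^esub> koszul_diff R fs M (k + s) m' J"
      unfolding b_def using f c by (simp add: M.minus_add_cancel)
    then have "(cech_elem R fs J [^] s') \<odot>\<^bsub>M\<^esub> ?t J =
      (cech_elem R fs J [^] s') \<odot>\<^bsub>M\<^esub> b J \<oplus>\<^bsub>M\<^esub> (cech_elem R fs J [^] s') \<odot>\<^bsub>M\<^esub> koszul_diff R fs M (k + s) m' J"
      using f c by (simp add: smult_r_distr)
    also have "\<dots> = koszul_diff R fs M (k + s + s') b' J \<oplus>\<^bsub>M\<^esub> koszul_diff R fs M (k + s + s') ?t' J"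
      unfolding fb koszul_diff_scale[OF m'c(1) JP] ..
    also have "\<dots> = koszul_diff R fs M (k + s + s') (\<lambda>I. b' I \<oplus>\<^bsub>M\<^esub> ?t' I) J"
      using graded_cochains_closed(1)[OF b'] graded_cochains_closed(1)[OF t'] JP
      by (rule koszul_diff_add[symmetric])
    finally have "(cech_elem R fs J [^] (s + s')) \<odot>\<^bsub>M\<^esub> m J =
        koszul_diff R fs M (k + (s + s')) (\<lambda>I. b' I \<oplus>\<^bsub>M\<^esub> ?t' I) J"
      using f c by (simp add: pow_smult ac_simps)
    moreover have "(cech_elem R fs J [^] (s + s')) \<odot>\<^bsub>M\<^esub> m J \<in> carrier M" using f c by simp
    ultimately show ?thesis using M.minus_eq_zero_iff by simp
  qed
  moreover have "(\<lambda>I. b' I \<oplus>\<^bsub>M\<^esub> ?t' I) \<in> graded_cochains M (length fs) e \<gamma> (k + (s + s')) Z"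
    using graded_cochains_add[OF Z b'Z t'] by (simp add: add.assoc)
  ultimately show "\<exists>s. \<exists>m'\<in>graded_cochains M (length fs) e \<gamma> (k + s) Z. \<forall>J\<in>cech_index fs p.
        (cech_elem R fs J [^] s) \<odot>\<^bsub>M\<^esub> m J \<ominus>\<^bsub>M\<^esub> koszul_diff R fs M (k + s) m' J \<in> {\<zero>\<^bsub>M\<^esub>}"
    by blast
qed

end

lemma graded_hom_linear:
  assumes "graded_koszul R M fs e" "graded_koszul R N fs e" "h \<in> graded_hom R M N"
  shows "abelian_group_hom M N h"
    "\<And>a x. a \<in> carrier R \<Longrightarrow> x \<in> carrier M \<Longrightarrow> h (a \<odot>\<^bsub>M\<^esub> x) = a \<odot>\<^bsub>N\<^esub> h x"
    "\<And>x \<delta>. x \<in> mpart M \<delta> \<Longrightarrow> h x \<in> mpart N \<delta>"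
    "\<And>x \<delta>. x \<in> carrier M \<Longrightarrow> component N \<delta> (h x) = h (component M \<delta> x)"
proof -
  interpret M: graded_koszul R M fs e by fact
  interpret N: graded_koszul R N fs e by fact
  show h: "abelian_group_hom M N h"
    using assms(3) unfolding graded_hom_def
    by (intro abelian_group_hom_additiveI) (auto simp: M.M.abelian_group_axioms N.M.abelian_group_axioms)
  show deg: "\<And>x \<delta>. x \<in> mpart M \<delta> \<Longrightarrow> h x \<in> mpart N \<delta>"
    using assms(3) unfolding graded_hom_def by blast
  show "component N \<delta> (h x) = h (component M \<delta> x)" if "x \<in> carrier M" for x \<delta>
    using M.gr.component_hom[OF N.gr.graded_abelian_group_axioms h, of 0 x \<delta>] deg that by simp
qed (use assms(3) in \<open>simp add: graded_hom_def\<close>)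

text \<open>The sequence \<open>0 \<rightarrow> Ker h \<rightarrow> M \<rightarrow> h(M) \<rightarrow> 0\<close>: the differential of a lift of a cocycle lies in the
  kernel, where it has a primitive. Subtracting this primitive turns the lift into a cocycle, and
  \<open>h\<close> maps a primitive of the corrected lift to the desired one.\<close>

lemma koszul_acyclic_image:
  assumes M: "graded_koszul R M fs e" and N: "graded_koszul R N fs e" and h: "h \<in> graded_hom R M N"
    and aM: "koszul_acyclic R fs e M (carrier M) {\<zero>\<^bsub>M\<^esub>} p \<gamma>"
    and aK: "koszul_acyclic R fs e M {x \<in> carrier M. h x = \<zero>\<^bsub>N\<^esub>} {\<zero>\<^bsub>M\<^esub>} (Suc p) \<gamma>"
    and K: "submodule {x \<in> carrier M. h x = \<zero>\<^bsub>N\<^esub>} R M"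
  shows "koszul_acyclic R fs e N (h ` carrier M) {\<zero>\<^bsub>N\<^esub>} p \<gamma>"
  unfolding koszul_acyclic_def
proof (intro allI ballI impI)
  interpret M: graded_koszul R M fs e by fact
  interpret N: graded_koszul R N fs e by fact
  note hl = graded_hom_linear[OF M N h]
  interpret h: abelian_group_hom M N h by (rule hl(1))
  let ?K = "{x \<in> carrier M. h x = \<zero>\<^bsub>N\<^esub>}"
  note CM = M.carrier_is_submodule
  have hd: "h (koszul_diff R fs M k m J) = koszul_diff R fs N k (\<lambda>I. h (m I)) J"
    if "m \<in> Pow {..<length fs} \<rightarrow> carrier M" "J \<subseteq> {..<length fs}" for k m J
    using N.koszul_module_axioms hl(1) _ that by (rule M.koszul_diff_hom) (rule hl(2))
  fix k m assume m: "m \<in> graded_cochains N (length fs) e \<gamma> k (h ` carrier M)"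
    and cyc: "\<forall>J\<in>cech_index fs (Suc p). koszul_diff R fs N k m J \<in> {\<zero>\<^bsub>N\<^esub>}"
  have "\<exists>x. x \<in> mpart M (\<gamma> + pow_degree e k I) \<and> h x = m I" if I: "I \<in> Pow {..<length fs}" for I
  proof -
    have mI: "m I \<in> h ` carrier M" "m I \<in> mpart N (\<gamma> + pow_degree e k I)"
      using m I by (auto simp: graded_cochains_def Pi_iff)
    then obtain x where x: "x \<in> carrier M" "m I = h x" by blast
    have "h (component M (\<gamma> + pow_degree e k I) x) = m I"
      using hl(4)[OF x(1)] N.gr.component_homogeneous[OF mI(2)] x(2) by simp
    then show ?thesis using M.gr.component_mpart[OF x(1)] by blast
  qed
  \<comment> \<open>a homogeneous lift, obtained as a component of an arbitrary one\<close>
  then obtain x where x1: "\<And>I. I \<in> Pow {..<length fs} \<Longrightarrow> x I \<in> mpart M (\<gamma> + pow_degree e k I)"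
    and hx: "\<And>I. I \<in> Pow {..<length fs} \<Longrightarrow> h (x I) = m I" by metis
  have x: "x \<in> graded_cochains M (length fs) e \<gamma> k (carrier M)"
    using x1 M.gr.mpart_carrier by (auto simp: graded_cochains_def)
  note xc = M.graded_cochains_closed(1)[OF x] and mc = N.graded_cochains_closed(1)[OF m]
  have hdx: "h (koszul_diff R fs M k x J) = koszul_diff R fs N k m J" if J: "J \<subseteq> {..<length fs}" for J
  proof -
    have "h (koszul_diff R fs M k x J) = koszul_diff R fs N k (\<lambda>I. h (x I)) J" using hd[OF xc J] .
    also have "\<dots> = koszul_diff R fs N k m J"
      using mc J by (rule N.koszul_diff_cong) (use hx J in auto)
    finally show ?thesis .
  qed
  define y where "y = koszul_diff R fs M k x"
  \<comment> \<open>only in cohomological degree \<open>p + 1\<close> does \<open>y\<close> have values in the kernel\<close>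
  define y0 where "y0 = (\<lambda>I. if card I = Suc p then y I else \<zero>\<^bsub>M\<^esub>)"
  have y: "y \<in> graded_cochains M (length fs) e \<gamma> k (carrier M)"
    unfolding y_def using CM x by (rule M.graded_cochains_diff)
  have y0: "y0 \<in> graded_cochains M (length fs) e \<gamma> k ?K"
    unfolding y0_def using M.submodule_closed(2)[OF K] y
  proof (rule M.graded_cochains_restrict)
    fix J assume J: "J \<in> cech_index fs (Suc p)"
    note JP = cech_index_subset[OF J]
    show "y J \<in> ?K" using hdx[OF JP] cyc J M.koszul_diff_closed[OF xc JP] by (simp add: y_def)
  qed
  have "koszul_diff R fs M k y0 J \<in> {\<zero>\<^bsub>M\<^esub>}" if J: "J \<in> cech_index fs (Suc (Suc p))" for J
    unfolding y0_def M.koszul_diff_restrict[OF M.graded_cochains_closed(1)[OF y] J]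
    using M.koszul_diff_diff[OF xc cech_index_subset[OF J]] by (simp add: y_def)
  then obtain s z where z: "z \<in> graded_cochains M (length fs) e \<gamma> (k + s) ?K"
    and eq: "\<forall>J\<in>cech_index fs (Suc p). (cech_elem R fs J [^]\<^bsub>R\<^esub> s) \<odot>\<^bsub>M\<^esub> y0 J \<ominus>\<^bsub>M\<^esub>
      koszul_diff R fs M (k + s) z J \<in> {\<zero>\<^bsub>M\<^esub>}"
    by (rule koszul_acyclicE[OF aK y0])
  note zc = M.graded_cochains_closed[OF z]
  have zM: "z \<in> graded_cochains M (length fs) e \<gamma> (k + s) (carrier M)"
    using z by (auto simp: graded_cochains_def Pi_iff)
  let ?t = "\<lambda>I. (cech_elem R fs I [^]\<^bsub>R\<^esub> s) \<odot>\<^bsub>M\<^esub> x I"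
  define u where "u = (\<lambda>I. ?t I \<ominus>\<^bsub>M\<^esub> z I)"
  have t: "?t \<in> graded_cochains M (length fs) e \<gamma> (k + s) (carrier M)"
    using CM x by (rule M.graded_cochains_scale)
  have u: "u \<in> graded_cochains M (length fs) e \<gamma> (k + s) (carrier M)"
    unfolding u_def using CM t zM by (rule M.graded_cochains_minus)
  have "koszul_diff R fs M (k + s) u J \<in> {\<zero>\<^bsub>M\<^esub>}" if J: "J \<in> cech_index fs (Suc p)" for J
  proof -
    note JP = cech_index_subset[OF J]
    have "koszul_diff R fs M (k + s) u J =
      (cech_elem R fs J [^]\<^bsub>R\<^esub> s) \<odot>\<^bsub>M\<^esub> y J \<ominus>\<^bsub>M\<^esub> koszul_diff R fs M (k + s) z J"
      unfolding u_def y_def M.koszul_diff_scale[OF xc JP, symmetric]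
      using M.graded_cochains_closed(1)[OF t] zc(1) JP by (rule M.koszul_diff_minus)
    moreover have "y J = y0 J" using J by (simp add: y0_def cech_index_def)
    ultimately show ?thesis using eq J by simp
  qed
  then obtain s' w where w: "w \<in> graded_cochains M (length fs) e \<gamma> (k + s + s') (carrier M)"
    and eq': "\<forall>J\<in>cech_index fs p. (cech_elem R fs J [^]\<^bsub>R\<^esub> s') \<odot>\<^bsub>M\<^esub> u J \<ominus>\<^bsub>M\<^esub>
      koszul_diff R fs M (k + s + s') w J \<in> {\<zero>\<^bsub>M\<^esub>}"
    by (rule koszul_acyclicE[OF aM u])
  note wc = M.graded_cochains_closed(1)[OF w]
  have "(\<lambda>I. h (w I)) \<in> graded_cochains N (length fs) e \<gamma> (k + (s + s')) (h ` carrier M)"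
    using w hl(3) by (auto simp: graded_cochains_def Pi_iff add.assoc)
  moreover have "(cech_elem R fs J [^]\<^bsub>R\<^esub> (s + s')) \<odot>\<^bsub>N\<^esub> m J \<ominus>\<^bsub>N\<^esub>
      koszul_diff R fs N (k + (s + s')) (\<lambda>I. h (w I)) J \<in> {\<zero>\<^bsub>N\<^esub>}" if J: "J \<in> cech_index fs p" for J
  proof -
    note JP = cech_index_subset[OF J]
    have f: "cech_elem R fs J \<in> carrier R" using JP by simp
    have c: "x J \<in> carrier M" "z J \<in> carrier M" "m J \<in> carrier N" "h (z J) = \<zero>\<^bsub>N\<^esub>" "h (x J) = m J" "u J \<in> carrier M"
      using xc mc zc JP hx[of J] M.graded_cochains_closed(1)[OF u] by (auto simp: Pi_iff)
    have "h (u J) = (cech_elem R fs J [^]\<^bsub>R\<^esub> s) \<odot>\<^bsub>N\<^esub> m J"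
      unfolding u_def using f c by (simp add: M.M.minus_eq hl(2))
    then have 1: "h ((cech_elem R fs J [^]\<^bsub>R\<^esub> s') \<odot>\<^bsub>M\<^esub> u J) = (cech_elem R fs J [^]\<^bsub>R\<^esub> (s + s')) \<odot>\<^bsub>N\<^esub> m J"
      using f c by (simp add: hl(2) N.pow_smult add.commute)
    have "(cech_elem R fs J [^]\<^bsub>R\<^esub> s') \<odot>\<^bsub>M\<^esub> u J \<ominus>\<^bsub>M\<^esub> koszul_diff R fs M (k + s + s') w J = \<zero>\<^bsub>M\<^esub>"
      using eq' J by simp
    then have "(cech_elem R fs J [^]\<^bsub>R\<^esub> s') \<odot>\<^bsub>M\<^esub> u J = koszul_diff R fs M (k + s + s') w J"
      using f c M.koszul_diff_closed[OF wc JP] by (subst (asm) M.M.minus_eq_zero_iff) auto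
    then have "(cech_elem R fs J [^]\<^bsub>R\<^esub> (s + s')) \<odot>\<^bsub>N\<^esub> m J =
        koszul_diff R fs N (k + (s + s')) (\<lambda>I. h (w I)) J"
      using hd[OF wc JP, of "k + s + s'"] unfolding 1[symmetric] by (simp add: add.assoc)
    moreover have "(cech_elem R fs J [^]\<^bsub>R\<^esub> (s + s')) \<odot>\<^bsub>N\<^esub> m J \<in> carrier N" using f c by simp
    ultimately show ?thesis using N.M.minus_eq_zero_iff by simp
  qed
  ultimately show "\<exists>s. \<exists>m'\<in>graded_cochains N (length fs) e \<gamma> (k + s) (h ` carrier M). \<forall>J\<in>cech_index fs p.
        (cech_elem R fs J [^]\<^bsub>R\<^esub> s) \<odot>\<^bsub>N\<^esub> m J \<ominus>\<^bsub>N\<^esub> koszul_diff R fs N (k + s) m' J \<in> {\<zero>\<^bsub>N\<^esub>}"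
    by blast
qed

section \<open>Cech cochains with a common denominator\<close>

definition fraction_cochain ::
    "('r, 'g) gring \<Rightarrow> 'r list \<Rightarrow> ('r, 'm, 'g) gmodule \<Rightarrow> nat \<Rightarrow> nat \<Rightarrow> (nat set \<Rightarrow> 'm) \<Rightarrow>
      nat set \<Rightarrow> ('m \<times> nat) set" where
  "fraction_cochain R fs M p k m = (\<lambda>I\<in>cech_index fs p. fraction R M (cech_elem R fs I) (m I) k)"

text \<open>The class of \<open>m\<close> vanishes in the direct limit of the Koszul cohomologies of degree \<open>p\<close>. Since the
  differential at \<open>{}\<close> is an empty sum, for \<open>p = 0\<close> this means that \<open>m {}\<close> is zero, as the
  coboundaries in degree \<open>0\<close> require.\<close>

definition koszul_exact ::
    "('r, 'g) gring \<Rightarrow> 'r list \<Rightarrow> ('r, 'm, 'g) gmodule \<Rightarrow> nat \<Rightarrow> nat \<Rightarrow> (nat set \<Rightarrow> 'm) \<Rightarrow> bool" where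
  "koszul_exact R fs M p k m \<longleftrightarrow> (\<exists>s. \<exists>m'\<in>Pow {..<length fs} \<rightarrow> carrier M. \<forall>J\<in>cech_index fs p.
     (cech_elem R fs J [^]\<^bsub>R\<^esub> s) \<odot>\<^bsub>M\<^esub> m J = koszul_diff R fs M (k + s) m' J)"

lemma finite_cech_index: "finite (cech_index fs p)"
  by (rule finite_subset[of _ "Pow {..<length fs}"]) (auto simp: cech_index_def)

lemma cech_index_remove:
  "J \<in> cech_index fs (Suc p) \<Longrightarrow> j \<in> J \<Longrightarrow> J - {j} \<in> cech_index fs p"
  by (auto simp: cech_index_def)

context koszul_module
begin

abbreviation (input) "cochains \<equiv> Pow {..<length fs} \<rightarrow> carrier M"

lemma koszul_diff_zero:
  assumes "J \<subseteq> {..<length fs}"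
  shows "koszul_diff R fs M k (\<lambda>_. \<zero>\<^bsub>M\<^esub>) J = \<zero>\<^bsub>M\<^esub>"
proof -
  have z: "(\<lambda>_. \<zero>\<^bsub>M\<^esub>) \<in> cochains" by simp
  show ?thesis
    using koszul_diff_minus[OF z z assms, of k] koszul_diff_closed[OF z assms, of k]
    by (simp add: M.minus_eq M.r_neg)
qed

lemma scale_cochain:
  "m \<in> cochains \<Longrightarrow> (\<lambda>I. (cech_elem R fs I [^] (s::nat)) \<odot>\<^bsub>M\<^esub> m I) \<in> cochains"
  by (auto simp: Pi_iff)

lemma cochain_at:
  assumes "m \<in> cochains" "J \<in> cech_index fs p"
  shows "m J \<in> carrier M" "cech_elem R fs J \<in> carrier R"
  using assms cech_index_subset[of J fs p] by auto

lemma fraction_cochain_eqI: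
  assumes "\<And>I. I \<in> cech_index fs p \<Longrightarrow>
    fraction R M (cech_elem R fs I) (m I) k = fraction R M (cech_elem R fs I) (m' I) k'"
  shows "fraction_cochain R fs M p k m = fraction_cochain R fs M p k' m'"
  unfolding fraction_cochain_def using assms by (rule restrict_ext)

text \<open>A single exponent \<open>s\<close> can serve all entries, because there are finitely many.\<close>

lemma fraction_cochain_eq_iff:
  assumes m: "m \<in> cochains" "m' \<in> cochains"
  shows "fraction_cochain R fs M p k m = fraction_cochain R fs M p k m' \<longleftrightarrow>
    (\<exists>s::nat. \<forall>J\<in>cech_index fs p. (cech_elem R fs J [^] s) \<odot>\<^bsub>M\<^esub> m J = (cech_elem R fs J [^] s) \<odot>\<^bsub>M\<^esub> m' J)"
    (is "?L \<longleftrightarrow> ?R")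
proof
  assume L: ?L
  have "\<exists>s::nat. (cech_elem R fs J [^] s) \<odot>\<^bsub>M\<^esub> m J = (cech_elem R fs J [^] s) \<odot>\<^bsub>M\<^esub> m' J"
    if J: "J \<in> cech_index fs p" for J
  proof -
    have "fraction R M (cech_elem R fs J) (m J) k = fraction R M (cech_elem R fs J) (m' J) k"
      using fun_cong[OF L, of J] J by (simp add: fraction_cochain_def)
    then show ?thesis using fraction_eq_same cochain_at[OF m(1) J] cochain_at[OF m(2) J] by simp
  qed
  then obtain s :: "nat set \<Rightarrow> nat" where s: "\<And>J. J \<in> cech_index fs p \<Longrightarrow>
      (cech_elem R fs J [^] s J) \<odot>\<^bsub>M\<^esub> m J = (cech_elem R fs J [^] s J) \<odot>\<^bsub>M\<^esub> m' J" by metis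
  define K where "K = Max (s ` cech_index fs p)"
  have "(cech_elem R fs J [^] K) \<odot>\<^bsub>M\<^esub> m J = (cech_elem R fs J [^] K) \<odot>\<^bsub>M\<^esub> m' J"
    if J: "J \<in> cech_index fs p" for J
  proof -
    have "s J \<le> K" unfolding K_def using J finite_cech_index[of fs p] by (intro Max_ge) auto
    then have K: "K = (K - s J) + s J" by simp
    show ?thesis
      using s[OF J] pow_smult[OF cochain_at(2,1)[OF m(1) J], of "K - s J" "s J"]
        pow_smult[OF cochain_at(2,1)[OF m(2) J], of "K - s J" "s J"] K by metis
  qed
  then show ?R by blast
next
  assume ?R
  then obtain s :: nat where s: "\<forall>J\<in>cech_index fs p.
    (cech_elem R fs J [^] s) \<odot>\<^bsub>M\<^esub> m J = (cech_elem R fs J [^] s) \<odot>\<^bsub>M\<^esub> m' J" by blast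
  show ?L
  proof (rule fraction_cochain_eqI)
    fix J assume J: "J \<in> cech_index fs p"
    show "fraction R M (cech_elem R fs J) (m J) k = fraction R M (cech_elem R fs J) (m' J) k"
      using s J fraction_eq_same[OF cochain_at(2)[OF m(1) J] cochain_at(1)[OF m(1) J] cochain_at(1)[OF m(2) J], of k]
      by blast
  qed
qed

lemma fraction_cochain_scale:
  assumes m: "m \<in> cochains"
  shows "fraction_cochain R fs M p (k + s) (\<lambda>I. (cech_elem R fs I [^] s) \<odot>\<^bsub>M\<^esub> m I) =
    fraction_cochain R fs M p k m"
proof (rule fraction_cochain_eqI)
  fix J assume J: "J \<in> cech_index fs p"
  show "fraction R M (cech_elem R fs J) ((cech_elem R fs J [^] s) \<odot>\<^bsub>M\<^esub> m J) (k + s) =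
      fraction R M (cech_elem R fs J) (m J) k"
    using cochain_at(2,1)[OF m J] by (rule fraction_cancel)
qed

lemma fraction_cochain_carrier:
  assumes m: "m \<in> cochains"
  shows "fraction_cochain R fs M p k m \<in> carrier (cech_cochains R fs M p)"
  using cochain_at(1)[OF m] finite_cech_index[of fs p]
  by (auto simp: cech_cochains_def direct_sum_def fraction_cochain_def intro!: fraction_carrier)

lemma cech_cochains_zero:
  "\<zero>\<^bsub>cech_cochains R fs M p\<^esub> = fraction_cochain R fs M p k (\<lambda>_. \<zero>\<^bsub>M\<^esub>)"
proof -
  have "\<zero>\<^bsub>localization R M (cech_elem R fs I)\<^esub> = fraction R M (cech_elem R fs I) \<zero>\<^bsub>M\<^esub> k"
    if "I \<in> cech_index fs p" for I
    using cech_index_subset[OF that] by (intro fraction_zero) simp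
  then show ?thesis
    by (simp add: cech_cochains_def direct_sum_def fraction_cochain_def cong: restrict_cong)
qed

lemma cech_cochains_add:
  assumes m: "m \<in> cochains" and m': "m' \<in> cochains"
  shows "fraction_cochain R fs M p k m \<oplus>\<^bsub>cech_cochains R fs M p\<^esub> fraction_cochain R fs M p k m' =
    fraction_cochain R fs M p k (\<lambda>I. m I \<oplus>\<^bsub>M\<^esub> m' I)"
proof -
  have "fraction R M (cech_elem R fs I) (m I) k \<oplus>\<^bsub>localization R M (cech_elem R fs I)\<^esub>
      fraction R M (cech_elem R fs I) (m' I) k = fraction R M (cech_elem R fs I) (m I \<oplus>\<^bsub>M\<^esub> m' I) k"
    if I: "I \<in> cech_index fs p" for I
    using cochain_at[OF m I] cochain_at[OF m' I] by (intro fraction_add)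
  then show ?thesis
    by (simp add: cech_cochains_def direct_sum_def fraction_cochain_def cong: restrict_cong)
qed

lemma cech_cochainE:
  assumes c: "c \<in> carrier (cech_cochains R fs M p)"
  obtains k m where "m \<in> cochains" "c = fraction_cochain R fs M p k m"
proof -
  have cE: "c \<in> (\<Pi>\<^sub>E I\<in>cech_index fs p. carrier (localization R M (cech_elem R fs I)))"
    using c by (simp add: cech_cochains_def direct_sum_def)
  have "\<exists>m k. True \<and> m \<in> carrier M \<and> c I = fraction R M (cech_elem R fs I) m k"
    if "I \<in> cech_index fs p" for I
    using PiE_mem[OF cE that] localization_carrierE by metis
  then obtain k m where m: "\<forall>I\<in>cech_index fs p. m I \<in> carrier M"
    and cm: "\<forall>I\<in>cech_index fs p. c I = fraction R M (cech_elem R fs I) (m I) k"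
    by (rule common_exponent[of "cech_index fs p" "cech_elem R fs" "\<lambda>_ _ _. True" c, rotated 2])
      (auto simp: finite_cech_index cech_index_subset)
  let ?m = "\<lambda>I. if I \<in> cech_index fs p then m I else \<zero>\<^bsub>M\<^esub>"
  show thesis
  proof (rule that[of ?m k])
    show "?m \<in> cochains" using m by auto
    show "c = fraction_cochain R fs M p k ?m"
      using cm PiE_arb[OF cE] by (auto simp: fraction_cochain_def fun_eq_iff)
  qed
qed

text \<open>The map from the localization at \<open>f\<^sub>J\<^sub>-\<^sub>{\<^sub>j\<^sub>}\<close> to the one at \<open>f\<^sub>J\<close> multiplies the numerator by \<open>f\<^sub>j\<^sup>k\<close>, and
  the sum of fractions with the same denominator is formed on the numerators.\<close>

lemma cech_diff_fraction_cochain: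
  assumes m: "m \<in> cochains"
  shows "cech_diff R fs M p (fraction_cochain R fs M p k m) =
    fraction_cochain R fs M (Suc p) k (koszul_diff R fs M k m)"
proof (rule ext)
  fix J
  show "cech_diff R fs M p (fraction_cochain R fs M p k m) J =
    fraction_cochain R fs M (Suc p) k (koszul_diff R fs M k m) J"
  proof (cases "J \<in> cech_index fs (Suc p)")
    case J: True
    note JP = cech_index_subset[OF J]
    let ?f = "cech_elem R fs J"
    let ?L = "localization R M ?f"
    have f: "?f \<in> carrier R" using JP by simp
    interpret L: abelian_group ?L using f by (rule localization_group)
    let ?r = "\<lambda>j. localization_map R M (fs ! j) ?f (fraction_cochain R fs M p k m (J - {j}))"
    have r: "(if even (card {i \<in> J. i < j}) then ?r j else \<ominus>\<^bsub>?L\<^esub> ?r j) =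
      fraction R M ?f (signed M (even (card {i \<in> J. i < j})) ((fs ! j [^] k) \<odot>\<^bsub>M\<^esub> m (J - {j}))) k"
      if j: "j \<in> J" for j
    proof -
      have I: "J - {j} \<in> cech_index fs p" using J j by (rule cech_index_remove)
      note c = cochain_at[OF m I]
      have fj: "fs ! j \<in> carrier R" using JP j by auto
      have "?r j = localization_map R M (fs ! j) (cech_elem R fs (J - {j}) \<otimes> fs ! j)
          (fraction R M (cech_elem R fs (J - {j})) (m (J - {j})) k)"
        using I by (simp add: fraction_cochain_def cech_elem_remove[OF JP j])
      also have "\<dots> = fraction R M ?f ((fs ! j [^] k) \<odot>\<^bsub>M\<^esub> m (J - {j})) k"
        using localization_map_fraction[OF c(2) fj c(1), of k] by (simp only: cech_elem_remove[OF JP j])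
      finally have "?r j = fraction R M ?f ((fs ! j [^] k) \<odot>\<^bsub>M\<^esub> m (J - {j})) k" .
      then show ?thesis using c fj f by (simp add: signed_def fraction_neg)
    qed
    have "cech_diff R fs M p (fraction_cochain R fs M p k m) J =
        (\<Oplus>\<^bsub>?L\<^esub>j\<in>J. if even (card {i \<in> J. i < j}) then ?r j else \<ominus>\<^bsub>?L\<^esub> ?r j)"
      using J by (simp add: cech_diff_def Let_def)
    also have "\<dots> = (\<Oplus>\<^bsub>?L\<^esub>j\<in>J. fraction R M ?f
        (signed M (even (card {i \<in> J. i < j})) ((fs ! j [^] k) \<odot>\<^bsub>M\<^esub> m (J - {j}))) k)"
      by (rule L.finsum_cong') (use r koszul_term_closed[OF m JP] in \<open>auto intro: fraction_carrier\<close>)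
    also have "\<dots> = fraction R M ?f (koszul_diff R fs M k m J) k"
      unfolding koszul_diff_def using f finite_subset[OF JP] koszul_term_closed[OF m JP]
      by (intro fraction_finsum) auto
    finally show ?thesis using J by (simp add: fraction_cochain_def)
  qed (simp add: cech_diff_def fraction_cochain_def)
qed

lemma koszul_diff_cochain: "m \<in> cochains \<Longrightarrow> koszul_diff R fs M k m \<in> cochains"
  using koszul_diff_closed by auto

lemma fraction_cochain_cocycle:
  assumes m: "m \<in> cochains"
  shows "fraction_cochain R fs M p k m \<in> cech_cocycles R fs M p \<longleftrightarrow>
    (\<exists>s::nat. \<forall>J\<in>cech_index fs (Suc p). (cech_elem R fs J [^] s) \<odot>\<^bsub>M\<^esub> koszul_diff R fs M k m J = \<zero>\<^bsub>M\<^esub>)"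
proof -
  have z: "(\<lambda>_. \<zero>\<^bsub>M\<^esub>) \<in> cochains" by simp
  have e: "(cech_elem R fs J [^] s) \<odot>\<^bsub>M\<^esub> \<zero>\<^bsub>M\<^esub> = \<zero>\<^bsub>M\<^esub>" if "J \<in> cech_index fs (Suc p)" for J and s :: nat
    using cech_index_subset[OF that] by simp
  have "(\<forall>J\<in>cech_index fs (Suc p). (cech_elem R fs J [^] s) \<odot>\<^bsub>M\<^esub> koszul_diff R fs M k m J =
      (cech_elem R fs J [^] s) \<odot>\<^bsub>M\<^esub> \<zero>\<^bsub>M\<^esub>) \<longleftrightarrow>
    (\<forall>J\<in>cech_index fs (Suc p). (cech_elem R fs J [^] s) \<odot>\<^bsub>M\<^esub> koszul_diff R fs M k m J = \<zero>\<^bsub>M\<^esub>)" for s :: nat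
    by (rule ball_cong) (simp_all add: e)
  then show ?thesis
    unfolding cech_cocycles_def cech_cochains_zero[of _ k]
    using fraction_cochain_carrier[OF m, of p k] cech_diff_fraction_cochain[OF m, of p k]
      fraction_cochain_eq_iff[OF koszul_diff_cochain[OF m, of k] z, of "Suc p" k] by simp
qed

text \<open>A primitive has its own exponent \<open>k'\<close>. Both cochains are brought to the exponent \<open>k + k'\<close>, and
  the equality of fractions then costs a further power \<open>s\<close>.\<close>

lemma fraction_cochain_coboundary:
  assumes m: "m \<in> cochains"
  shows "fraction_cochain R fs M p k m \<in> cech_coboundaries R fs M p \<longleftrightarrow> koszul_exact R fs M p k m"
proof (cases p)
  case 0
  have z: "(\<lambda>_. \<zero>\<^bsub>M\<^esub>) \<in> cochains" by simp
  have i0: "cech_index fs 0 = {{}}"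
    using finite_subset[of _ "{..<length fs}"] by (auto simp: cech_index_def)
  have k0: "koszul_diff R fs M k' m' {} = \<zero>\<^bsub>M\<^esub>" for k' m' by (simp add: koszul_diff_def)
  have "fraction_cochain R fs M 0 k m \<in> cech_coboundaries R fs M 0 \<longleftrightarrow>
    (\<exists>s::nat. (cech_elem R fs {} [^] s) \<odot>\<^bsub>M\<^esub> m {} = \<zero>\<^bsub>M\<^esub>)"
    unfolding cech_coboundaries_def cech_cochains_zero[of _ k]
    using fraction_cochain_eq_iff[OF m z, of 0 k] by (simp add: i0)
  also have "\<dots> \<longleftrightarrow> koszul_exact R fs M 0 k m"
    unfolding koszul_exact_def i0 using z by (auto simp: k0)
  finally show ?thesis using 0 by simp
next
  case (Suc q)
  show ?thesis
  proof
    assume "fraction_cochain R fs M p k m \<in> cech_coboundaries R fs M p"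
    then obtain c where c: "c \<in> carrier (cech_cochains R fs M q)"
      and mc: "fraction_cochain R fs M p k m = cech_diff R fs M q c"
      unfolding cech_coboundaries_def Suc by auto
    obtain k' m' where m': "m' \<in> cochains" and cm: "c = fraction_cochain R fs M q k' m'"
      using c by (rule cech_cochainE)
    let ?t = "\<lambda>I. (cech_elem R fs I [^] k) \<odot>\<^bsub>M\<^esub> m' I"
    let ?u = "\<lambda>I. (cech_elem R fs I [^] k') \<odot>\<^bsub>M\<^esub> m I"
    have t: "?t \<in> cochains" and u: "?u \<in> cochains" using m m' by (auto intro: scale_cochain)
    have "fraction_cochain R fs M p (k + k') ?u =
        fraction_cochain R fs M p (k + k') (koszul_diff R fs M (k + k') ?t)"
      using mc unfolding cm fraction_cochain_scale[OF m] Suc cech_diff_fraction_cochain[OF t, symmetric]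
      using fraction_cochain_scale[OF m', of q k' k] by (simp add: add.commute[of k])
    then obtain s :: nat where s: "\<forall>J\<in>cech_index fs p. (cech_elem R fs J [^] s) \<odot>\<^bsub>M\<^esub> ?u J =
        (cech_elem R fs J [^] s) \<odot>\<^bsub>M\<^esub> koszul_diff R fs M (k + k') ?t J"
      using fraction_cochain_eq_iff[OF u koszul_diff_cochain[OF t]] by blast
    have "(cech_elem R fs J [^] (s + k')) \<odot>\<^bsub>M\<^esub> m J =
        koszul_diff R fs M (k + (s + k')) (\<lambda>I. (cech_elem R fs I [^] s) \<odot>\<^bsub>M\<^esub> ?t I) J"
      if J: "J \<in> cech_index fs p" for J
    proof -
      have "(cech_elem R fs J [^] (s + k')) \<odot>\<^bsub>M\<^esub> m J = (cech_elem R fs J [^] s) \<odot>\<^bsub>M\<^esub> ?u J"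
        using cochain_at[OF m J] by (simp add: pow_smult)
      also have "\<dots> = koszul_diff R fs M (k + k' + s) (\<lambda>I. (cech_elem R fs I [^] s) \<odot>\<^bsub>M\<^esub> ?t I) J"
        using s J koszul_diff_scale[OF t cech_index_subset[OF J]] by simp
      finally show ?thesis by (simp add: ac_simps)
    qed
    moreover have "(\<lambda>I. (cech_elem R fs I [^] s) \<odot>\<^bsub>M\<^esub> ?t I) \<in> cochains" using t by (rule scale_cochain)
    ultimately show "koszul_exact R fs M p k m" unfolding koszul_exact_def by blast
  next
    assume "koszul_exact R fs M p k m"
    then obtain s m' where m': "m' \<in> cochains" and eq: "\<forall>J\<in>cech_index fs p.
        (cech_elem R fs J [^] s) \<odot>\<^bsub>M\<^esub> m J = koszul_diff R fs M (k + s) m' J"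
      unfolding koszul_exact_def by blast
    have "fraction_cochain R fs M p k m =
        fraction_cochain R fs M p (k + s) (\<lambda>I. (cech_elem R fs I [^] s) \<odot>\<^bsub>M\<^esub> m I)"
      using fraction_cochain_scale[OF m] by simp
    also have "\<dots> = fraction_cochain R fs M p (k + s) (koszul_diff R fs M (k + s) m')"
      by (rule fraction_cochain_eqI) (use eq in simp)
    also have "\<dots> = cech_diff R fs M q (fraction_cochain R fs M q (k + s) m')"
      unfolding Suc cech_diff_fraction_cochain[OF m'] ..
    finally show "fraction_cochain R fs M p k m \<in> cech_coboundaries R fs M p"
      unfolding cech_coboundaries_def Suc using fraction_cochain_carrier[OF m', of q "k + s"] by simp
  qed
qed

lemma koszul_exact_add:
  assumes m: "m1 \<in> cochains" "m2 \<in> cochains"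
    and ex: "koszul_exact R fs M p k m1" "koszul_exact R fs M p k m2"
  shows "koszul_exact R fs M p k (\<lambda>I. m1 I \<oplus>\<^bsub>M\<^esub> m2 I)"
proof -
  obtain s1 m1' where m1': "m1' \<in> cochains" and eq1: "\<forall>J\<in>cech_index fs p.
        (cech_elem R fs J [^] s1) \<odot>\<^bsub>M\<^esub> m1 J = koszul_diff R fs M (k + s1) m1' J"
    using ex(1) unfolding koszul_exact_def by blast
  obtain s2 m2' where m2': "m2' \<in> cochains" and eq2: "\<forall>J\<in>cech_index fs p.
        (cech_elem R fs J [^] s2) \<odot>\<^bsub>M\<^esub> m2 J = koszul_diff R fs M (k + s2) m2' J"
    using ex(2) unfolding koszul_exact_def by blast
  let ?t1 = "\<lambda>I. (cech_elem R fs I [^] s2) \<odot>\<^bsub>M\<^esub> m1' I"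
  let ?t2 = "\<lambda>I. (cech_elem R fs I [^] s1) \<odot>\<^bsub>M\<^esub> m2' I"
  have t: "?t1 \<in> cochains" "?t2 \<in> cochains" using m1' m2' by (auto intro: scale_cochain)
  have "(cech_elem R fs J [^] (s1 + s2)) \<odot>\<^bsub>M\<^esub> (m1 J \<oplus>\<^bsub>M\<^esub> m2 J) =
      koszul_diff R fs M (k + (s1 + s2)) (\<lambda>I. ?t1 I \<oplus>\<^bsub>M\<^esub> ?t2 I) J" if J: "J \<in> cech_index fs p" for J
  proof -
    note JP = cech_index_subset[OF J]
    note c = cochain_at[OF m(1) J] cochain_at[OF m(2) J]
    have "(cech_elem R fs J [^] (s1 + s2)) \<odot>\<^bsub>M\<^esub> (m1 J \<oplus>\<^bsub>M\<^esub> m2 J) =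
      (cech_elem R fs J [^] s2) \<odot>\<^bsub>M\<^esub> ((cech_elem R fs J [^] s1) \<odot>\<^bsub>M\<^esub> m1 J) \<oplus>\<^bsub>M\<^esub>
      (cech_elem R fs J [^] s1) \<odot>\<^bsub>M\<^esub> ((cech_elem R fs J [^] s2) \<odot>\<^bsub>M\<^esub> m2 J)"
      using c by (simp add: pow_smult smult_r_distr add.commute)
    also have "\<dots> = koszul_diff R fs M (k + s1 + s2) ?t1 J \<oplus>\<^bsub>M\<^esub> koszul_diff R fs M (k + s2 + s1) ?t2 J"
      unfolding koszul_diff_scale[OF m1' JP] koszul_diff_scale[OF m2' JP] using eq1 eq2 J by simp
    also have "\<dots> = koszul_diff R fs M (k + (s1 + s2)) (\<lambda>I. ?t1 I \<oplus>\<^bsub>M\<^esub> ?t2 I) J"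
      unfolding koszul_diff_add[OF t JP] by (simp add: ac_simps)
    finally show ?thesis .
  qed
  moreover have "(\<lambda>I. ?t1 I \<oplus>\<^bsub>M\<^esub> ?t2 I) \<in> cochains" using t by (auto simp: Pi_iff)
  ultimately show ?thesis unfolding koszul_exact_def by blast
qed

lemma koszul_exact_neg:
  assumes m: "m \<in> cochains" and ex: "koszul_exact R fs M p k m"
  shows "koszul_exact R fs M p k (\<lambda>I. \<ominus>\<^bsub>M\<^esub> m I)"
proof -
  obtain s m' where m': "m' \<in> cochains" and eq: "\<forall>J\<in>cech_index fs p.
        (cech_elem R fs J [^] s) \<odot>\<^bsub>M\<^esub> m J = koszul_diff R fs M (k + s) m' J"
    using ex unfolding koszul_exact_def by blast
  have "(cech_elem R fs J [^] s) \<odot>\<^bsub>M\<^esub> (\<ominus>\<^bsub>M\<^esub> m J) = koszul_diff R fs M (k + s) (\<lambda>I. \<ominus>\<^bsub>M\<^esub> m' I) J"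
    if J: "J \<in> cech_index fs p" for J
    using eq J cochain_at[OF m J] koszul_diff_neg[OF m' cech_index_subset[OF J], of "k + s"]
    by (simp add: smult_r_minus)
  moreover have "(\<lambda>I. \<ominus>\<^bsub>M\<^esub> m' I) \<in> cochains" using m' by (auto simp: Pi_iff)
  ultimately show ?thesis unfolding koszul_exact_def by blast
qed

lemma cech_coboundary_carrier:
  "c \<in> cech_coboundaries R fs M p \<Longrightarrow> c \<in> carrier (cech_cochains R fs M p)"
proof (cases p)
  case 0
  have "(\<lambda>_. \<zero>\<^bsub>M\<^esub>) \<in> cochains" by simp
  moreover assume "c \<in> cech_coboundaries R fs M p"
  ultimately show ?thesis
    using fraction_cochain_carrier[of "\<lambda>_. \<zero>\<^bsub>M\<^esub>" 0 0] 0 by (simp add: cech_coboundaries_def cech_cochains_zero[of _ 0])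
next
  case (Suc q)
  assume "c \<in> cech_coboundaries R fs M p"
  then obtain b where b: "b \<in> carrier (cech_cochains R fs M q)" "c = cech_diff R fs M q b"
    by (auto simp: cech_coboundaries_def Suc)
  obtain k m where m: "m \<in> cochains" "b = fraction_cochain R fs M q k m"
    using b(1) by (rule cech_cochainE)
  show ?thesis
    unfolding b(2) m(2) cech_diff_fraction_cochain[OF m(1)] Suc
    by (rule fraction_cochain_carrier[OF koszul_diff_cochain[OF m(1)]])
qed

lemma cech_cochain2E:
  assumes "c \<in> carrier (cech_cochains R fs M p)" "c' \<in> carrier (cech_cochains R fs M p)"
  obtains k m m' where "m \<in> cochains" "m' \<in> cochains"
    "c = fraction_cochain R fs M p k m" "c' = fraction_cochain R fs M p k m'"
proof -
  obtain k m where m: "m \<in> cochains" "c = fraction_cochain R fs M p k m"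
    using assms(1) by (rule cech_cochainE)
  obtain k' m' where m': "m' \<in> cochains" "c' = fraction_cochain R fs M p k' m'"
    using assms(2) by (rule cech_cochainE)
  show thesis
    by (rule that[OF scale_cochain[OF m(1), of k'] scale_cochain[OF m'(1), of k], of "k + k'"])
      (use m m' fraction_cochain_scale[OF m(1), of p k k'] fraction_cochain_scale[OF m'(1), of p k' k] in
        \<open>simp_all add: add.commute\<close>)
qed

text \<open>A coset of the coboundaries is zero exactly if its representative is a coboundary.\<close>

text \<open>This turns the vanishing of a cohomology class into membership in the coboundaries. The coset is
  computed on numerators over a common denominator.\<close>

lemma coboundaries_coset_eq_iff:
  assumes c: "c \<in> carrier (cech_cochains R fs M p)"
  shows "cech_coboundaries R fs M p +>\<^bsub>cech_cochains R fs M p\<^esub> c = cech_coboundaries R fs M p \<longleftrightarrow>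
    c \<in> cech_coboundaries R fs M p" (is "?B +>\<^bsub>?C\<^esub> c = ?B \<longleftrightarrow> _")
proof
  have z: "(\<lambda>_. \<zero>\<^bsub>M\<^esub>) \<in> cochains" by simp
  have "koszul_exact R fs M p k (\<lambda>_. \<zero>\<^bsub>M\<^esub>)" for k
    unfolding koszul_exact_def
    by (intro exI[of _ 0] bexI[of _ "\<lambda>_. \<zero>\<^bsub>M\<^esub>"]) (simp_all add: koszul_diff_zero cech_index_subset)
  then have zB: "fraction_cochain R fs M p k (\<lambda>_. \<zero>\<^bsub>M\<^esub>) \<in> ?B" for k
    using fraction_cochain_coboundary[OF z] by blast
  assume eq: "?B +>\<^bsub>?C\<^esub> c = ?B"
  obtain k m where m: "m \<in> cochains" "c = fraction_cochain R fs M p k m"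
    using c by (rule cech_cochainE)
  have "fraction_cochain R fs M p k (\<lambda>_. \<zero>\<^bsub>M\<^esub>) \<oplus>\<^bsub>?C\<^esub> c = fraction_cochain R fs M p k (\<lambda>I. \<zero>\<^bsub>M\<^esub> \<oplus>\<^bsub>M\<^esub> m I)"
    unfolding m(2) using z m(1) by (rule cech_cochains_add)
  also have "\<dots> = c"
    unfolding m(2) by (rule fraction_cochain_eqI) (use cochain_at[OF m(1)] in simp)
  finally have "c \<in> ?B +>\<^bsub>?C\<^esub> c" using zB[of k] unfolding a_r_coset_def' by blast
  then show "c \<in> ?B" using eq by simp
next
  assume cB: "c \<in> ?B"
  show "?B +>\<^bsub>?C\<^esub> c = ?B"
  proof (intro equalityI subsetI)
    fix x assume "x \<in> ?B +>\<^bsub>?C\<^esub> c"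
    then obtain b where b: "b \<in> ?B" "x = b \<oplus>\<^bsub>?C\<^esub> c" unfolding a_r_coset_def' by blast
    obtain k m1 m2 where m: "m1 \<in> cochains" "m2 \<in> cochains"
      "b = fraction_cochain R fs M p k m1" "c = fraction_cochain R fs M p k m2"
      using cech_coboundary_carrier[OF b(1)] c by (rule cech_cochain2E)
    have "koszul_exact R fs M p k (\<lambda>I. m1 I \<oplus>\<^bsub>M\<^esub> m2 I)"
      using m(1,2) b(1) cB unfolding m(3,4)
      by (simp add: fraction_cochain_coboundary koszul_exact_add)
    moreover have "(\<lambda>I. m1 I \<oplus>\<^bsub>M\<^esub> m2 I) \<in> cochains" using m by (auto simp: Pi_iff)
    ultimately show "x \<in> ?B"
      unfolding b(2) m(3,4) cech_cochains_add[OF m(1,2)] using fraction_cochain_coboundary by blast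
  next
    fix x assume x: "x \<in> ?B"
    obtain k m1 m2 where m: "m1 \<in> cochains" "m2 \<in> cochains"
      "x = fraction_cochain R fs M p k m1" "c = fraction_cochain R fs M p k m2"
      using cech_coboundary_carrier[OF x] c by (rule cech_cochain2E)
    let ?n = "\<lambda>I. \<ominus>\<^bsub>M\<^esub> m2 I"
    have n: "?n \<in> cochains" using m by (auto simp: Pi_iff)
    have "koszul_exact R fs M p k (\<lambda>I. m1 I \<oplus>\<^bsub>M\<^esub> ?n I)"
      using m(1,2) n x cB unfolding m(3,4)
      by (simp add: fraction_cochain_coboundary koszul_exact_add koszul_exact_neg)
    moreover have d: "(\<lambda>I. m1 I \<oplus>\<^bsub>M\<^esub> ?n I) \<in> cochains" using m by (auto simp: Pi_iff)
    ultimately have "fraction_cochain R fs M p k (\<lambda>I. m1 I \<oplus>\<^bsub>M\<^esub> ?n I) \<in> ?B"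
      using fraction_cochain_coboundary by blast
    moreover have "fraction_cochain R fs M p k (\<lambda>I. m1 I \<oplus>\<^bsub>M\<^esub> ?n I) \<oplus>\<^bsub>?C\<^esub> c = x"
      unfolding m(3,4) cech_cochains_add[OF d m(2)]
    proof (rule fraction_cochain_eqI)
      fix I assume I: "I \<in> cech_index fs p"
      show "fraction R M (cech_elem R fs I) (m1 I \<oplus>\<^bsub>M\<^esub> ?n I \<oplus>\<^bsub>M\<^esub> m2 I) k = fraction R M (cech_elem R fs I) (m1 I) k"
        using cochain_at[OF m(1) I] cochain_at[OF m(2) I] by (simp add: M.a_assoc M.l_neg)
    qed
    ultimately show "x \<in> ?B +>\<^bsub>?C\<^esub> c" unfolding a_r_coset_def' by blast
  qed
qed

lemma koszul_cocycle_exact_if_cohomology_zero: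
  assumes H: "carrier (cech_cohomology R fs M p) = {\<zero>\<^bsub>cech_cohomology R fs M p\<^esub>}"
    and m: "m \<in> cochains" and cyc: "\<forall>J\<in>cech_index fs (Suc p). koszul_diff R fs M k m J = \<zero>\<^bsub>M\<^esub>"
  shows "koszul_exact R fs M p k m"
proof -
  let ?c = "fraction_cochain R fs M p k m"
  have "?c \<in> cech_cocycles R fs M p"
    unfolding fraction_cochain_cocycle[OF m] using cyc cech_index_subset by (intro exI[of _ 0]) auto
  then have "cech_coboundaries R fs M p +>\<^bsub>cech_cochains R fs M p\<^esub> ?c = cech_coboundaries R fs M p"
    using H by (auto simp: cech_cohomology_def subquotient_def)
  then show ?thesis
    using coboundaries_coset_eq_iff[OF fraction_cochain_carrier[OF m]] fraction_cochain_coboundary[OF m] by blast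
qed

end

context graded_koszul
begin

lemma fraction_cochain_degree:
  assumes m: "m \<in> graded_cochains M (length fs) e \<gamma> k Z"
  shows "fraction_cochain R fs M p k m \<in> mpart (cech_cochains R fs M p) \<gamma>"
proof -
  have "fraction R M (cech_elem R fs I) (m I) k \<in> mpart (localization R M (cech_elem R fs I)) \<gamma>"
    if "I \<in> cech_index fs p" for I
    using m cech_elem_degree[OF cech_index_subset[OF that], of k] cech_index_subset[OF that]
    by (auto simp: localization_def graded_cochains_def Pi_iff)
  then show ?thesis using finite_cech_index[of fs p]
    by (auto simp: cech_cochains_def direct_sum_def fraction_cochain_def)
qed

lemma zero_pow_fraction:
  assumes "f \<in> carrier R" "m \<in> carrier M" "f [^] k = \<zero>"
  shows "fraction R M f m k = fraction R M f \<zero>\<^bsub>M\<^esub> k"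
  using assms by (subst fraction_eq_same) (auto intro!: exI[of _ k])

text \<open>A homogeneous fraction \<open>m / f\<^sup>k\<close> has a numerator of the expected degree unless \<open>f\<^sup>k = 0\<close>. In that case
  \<open>f\<^sup>k\<close> has every degree, but the fraction is zero and has the numerator \<open>0\<close>.\<close>

lemma cech_cochain_degreeE:
  assumes c: "c \<in> mpart (cech_cochains R fs M p) \<gamma>"
  obtains k m where "m \<in> graded_cochains M (length fs) e \<gamma> k (carrier M)" "c = fraction_cochain R fs M p k m"
proof -
  let ?P = "\<lambda>I k m. m \<in> mpart M (\<gamma> + pow_degree e k I)"
  have cE: "c \<in> (\<Pi>\<^sub>E I\<in>cech_index fs p. mpart (localization R M (cech_elem R fs I)) \<gamma>)"
    using c by (simp add: cech_cochains_def direct_sum_def)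
  have "\<exists>m k. ?P I k m \<and> m \<in> carrier M \<and> c I = fraction R M (cech_elem R fs I) m k"
    if I: "I \<in> cech_index fs p" for I
  proof -
    have f: "cech_elem R fs I \<in> carrier R" using cech_index_subset[OF I] by simp
    have "c I \<in> mpart (localization R M (cech_elem R fs I)) \<gamma>" using cE I by (rule PiE_mem)
    then obtain m k \<delta> where cI: "c I = fraction R M (cech_elem R fs I) m k"
      and \<delta>: "cech_elem R fs I [^] k \<in> rpart R \<delta>" and m: "m \<in> mpart M (\<gamma> + \<delta>)"
      by (auto simp: localization_def)
    show ?thesis
    proof (cases "cech_elem R fs I [^] k = \<zero>")
      case True
      then show ?thesis
        using cI zero_pow_fraction[OF f gr.mpart_carrier[OF m] True]
        by (intro exI[of _ "\<zero>\<^bsub>M\<^esub>"] exI[of _ k]) simp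
    next
      case False
      have "\<delta> = pow_degree e k I"
        using \<delta> cech_elem_degree[OF cech_index_subset[OF I]] False by (rule rpart_unique)
      then show ?thesis using cI m gr.mpart_carrier[OF m] by blast
    qed
  qed
  then obtain k m where m: "\<forall>I\<in>cech_index fs p. ?P I k (m I)" "\<forall>I\<in>cech_index fs p. m I \<in> carrier M"
    and cm: "\<forall>I\<in>cech_index fs p. c I = fraction R M (cech_elem R fs I) (m I) k"
  proof (rule common_exponent[of "cech_index fs p" "cech_elem R fs" ?P c, rotated 2])
    fix I k x and s :: nat assume I: "I \<in> cech_index fs p" and x: "x \<in> mpart M (\<gamma> + pow_degree e k I)"
    have "(cech_elem R fs I [^] s) \<odot>\<^bsub>M\<^esub> x \<in> mpart M (pow_degree e s I + (\<gamma> + pow_degree e k I))"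
      using cech_elem_degree[OF cech_index_subset[OF I]] x by (rule mpart_smult)
    then show "(cech_elem R fs I [^] s) \<odot>\<^bsub>M\<^esub> x \<in> mpart M (\<gamma> + pow_degree e (k + s) I)"
      by (simp add: pow_degree_add ac_simps)
  qed (auto simp: finite_cech_index cech_index_subset)
  let ?m = "\<lambda>I. if I \<in> cech_index fs p then m I else \<zero>\<^bsub>M\<^esub>"
  show thesis
  proof (rule that[of ?m k])
    show "?m \<in> graded_cochains M (length fs) e \<gamma> k (carrier M)"
      using m by (auto simp: graded_cochains_def)
    show "c = fraction_cochain R fs M p k ?m"
      using cm PiE_arb[OF cE] by (auto simp: fraction_cochain_def fun_eq_iff)
  qed
qed

lemma koszul_cocycle_exact_if_not_Supp:
  assumes H: "\<gamma> \<notin> Supp (cech_cohomology R fs M p)"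
    and m: "m \<in> graded_cochains M (length fs) e \<gamma> k (carrier M)"
    and cyc: "\<forall>J\<in>cech_index fs (Suc p). koszul_diff R fs M k m J = \<zero>\<^bsub>M\<^esub>"
  shows "koszul_exact R fs M p k m"
proof -
  note mc = graded_cochains_closed(1)[OF m]
  let ?c = "fraction_cochain R fs M p k m"
  have "?c \<in> cech_cocycles R fs M p"
    unfolding fraction_cochain_cocycle[OF mc] using cyc cech_index_subset by (intro exI[of _ 0]) auto
  moreover have "?c \<in> mpart (cech_cochains R fs M p) \<gamma>" using m by (rule fraction_cochain_degree)
  ultimately have "cech_coboundaries R fs M p +>\<^bsub>cech_cochains R fs M p\<^esub> ?c = cech_coboundaries R fs M p"
    using H by (auto simp: cech_cohomology_def subquotient_def Supp_def)
  then show ?thesis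
    using coboundaries_coset_eq_iff[OF fraction_cochain_carrier[OF mc]] fraction_cochain_coboundary[OF mc] by blast
qed

lemma not_Supp_if_koszul_acyclic:
  assumes ac: "koszul_acyclic R fs e M (carrier M) {\<zero>\<^bsub>M\<^esub>} p \<gamma>"
  shows "\<gamma> \<notin> Supp (cech_cohomology R fs M p)"
proof -
  let ?B = "cech_coboundaries R fs M p" and ?C = "cech_cochains R fs M p"
  note CM = carrier_is_submodule
  have B: "?B +>\<^bsub>?C\<^esub> c = ?B" if c: "c \<in> cech_cocycles R fs M p" "c \<in> mpart ?C \<gamma>" for c
  proof -
    obtain k m where m: "m \<in> graded_cochains M (length fs) e \<gamma> k (carrier M)"
      and cm: "c = fraction_cochain R fs M p k m"
      using c(2) by (rule cech_cochain_degreeE)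
    note mc = graded_cochains_closed(1)[OF m]
    obtain s :: nat where s: "\<forall>J\<in>cech_index fs (Suc p).
        (cech_elem R fs J [^] s) \<odot>\<^bsub>M\<^esub> koszul_diff R fs M k m J = \<zero>\<^bsub>M\<^esub>"
      using c(1) unfolding cm fraction_cochain_cocycle[OF mc] by blast
    let ?t = "\<lambda>I. (cech_elem R fs I [^] s) \<odot>\<^bsub>M\<^esub> m I"
    have t: "?t \<in> graded_cochains M (length fs) e \<gamma> (k + s) (carrier M)"
      using CM m by (rule graded_cochains_scale)
    note tc = graded_cochains_closed(1)[OF t]
    have "koszul_diff R fs M (k + s) ?t J \<in> {\<zero>\<^bsub>M\<^esub>}" if J: "J \<in> cech_index fs (Suc p)" for J
      using koszul_diff_scale[OF mc cech_index_subset[OF J], of k s] s J by simp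
    then obtain s' m' where m': "m' \<in> graded_cochains M (length fs) e \<gamma> (k + s + s') (carrier M)"
      and eq: "\<forall>J\<in>cech_index fs p. (cech_elem R fs J [^] s') \<odot>\<^bsub>M\<^esub> ?t J \<ominus>\<^bsub>M\<^esub>
        koszul_diff R fs M (k + s + s') m' J \<in> {\<zero>\<^bsub>M\<^esub>}"
      by (rule koszul_acyclicE[OF ac t])
    note m'c = graded_cochains_closed(1)[OF m']
    have "(cech_elem R fs J [^] s') \<odot>\<^bsub>M\<^esub> ?t J = koszul_diff R fs M (k + s + s') m' J"
      if J: "J \<in> cech_index fs p" for J
    proof -
      have "(cech_elem R fs J [^] s') \<odot>\<^bsub>M\<^esub> ?t J \<in> carrier M"
        using cochain_at[OF mc J] by simp
      then show ?thesis
        using eq J M.minus_eq_zero_iff[OF _ koszul_diff_closed[OF m'c cech_index_subset[OF J], of "k + s + s'"]]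
        by blast
    qed
    then have "koszul_exact R fs M p (k + s) ?t" unfolding koszul_exact_def using m'c by blast
    then have "c \<in> ?B"
      using fraction_cochain_coboundary[OF tc, of p "k + s"] unfolding cm fraction_cochain_scale[OF mc, of p k s] by blast
    then show ?thesis using coboundaries_coset_eq_iff cech_coboundary_carrier by blast
  qed
  let ?z = "fraction_cochain R fs M p 0 (\<lambda>_. \<zero>\<^bsub>M\<^esub>)"
  have z: "(\<lambda>_. \<zero>\<^bsub>M\<^esub>) \<in> graded_cochains M (length fs) e \<gamma> 0 (carrier M)" by (simp add: graded_cochains_def)
  note zc = graded_cochains_closed(1)[OF z]
  have "koszul_diff R fs M 0 (\<lambda>_. \<zero>\<^bsub>M\<^esub>) J = \<zero>\<^bsub>M\<^esub>" if "J \<in> cech_index fs (Suc p)" for J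
    using cech_index_subset[OF that] by (rule koszul_diff_zero)
  then have "?z \<in> cech_cocycles R fs M p \<inter> mpart ?C \<gamma>"
    using fraction_cochain_degree[OF z] fraction_cochain_cocycle[OF zc]
    by (auto intro!: exI[of _ 0])
  then have "(\<lambda>c. ?B +>\<^bsub>?C\<^esub> c) ` (cech_cocycles R fs M p \<inter> mpart ?C \<gamma>) = {?B}"
    using B by blast
  then show ?thesis by (simp add: Supp_def cech_cohomology_def subquotient_def)
qed

end

section \<open>Kernels, images and subquotients\<close>

lemma kernel_graded_submodule:
  assumes M: "graded_koszul R M fs e" and N: "graded_koszul R N fs e" and h: "h \<in> graded_hom R M N"
  shows "graded_submodule R M {x \<in> carrier M. h x = \<zero>\<^bsub>N\<^esub>}"
proof -
  interpret M: graded_koszul R M fs e by fact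
  interpret N: graded_koszul R N fs e by fact
  note hl = graded_hom_linear[OF M N h]
  interpret h: abelian_group_hom M N h by (rule hl(1))
  have "submodule {x \<in> carrier M. h x = \<zero>\<^bsub>N\<^esub>} R M"
    by (rule M.submoduleI) (auto simp: hl(2))
  moreover have "h (component M \<delta> x) = \<zero>\<^bsub>N\<^esub>" if "x \<in> carrier M" "h x = \<zero>\<^bsub>N\<^esub>" for x \<delta>
    using hl(4)[OF that(1), of \<delta>] that(2) N.gr.component_homogeneous[OF N.gr.mpart_zero] by simp
  ultimately show ?thesis by (simp add: graded_submodule_def)
qed

lemma image_graded_submodule:
  assumes M: "graded_koszul R M fs e" and N: "graded_koszul R N fs e" and h: "h \<in> graded_hom R M N"
  shows "graded_submodule R N (h ` carrier M)"
proof -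
  interpret M: graded_koszul R M fs e by fact
  interpret N: graded_koszul R N fs e by fact
  note hl = graded_hom_linear[OF M N h]
  interpret h: abelian_group_hom M N h by (rule hl(1))
  have "submodule (h ` carrier M) R N"
  proof (rule N.submoduleI)
    show "\<zero>\<^bsub>N\<^esub> \<in> h ` carrier M" by (rule image_eqI[of _ _ "\<zero>\<^bsub>M\<^esub>"]) simp_all
    show "h ` carrier M \<subseteq> carrier N" by auto
  next
    fix a assume "a \<in> h ` carrier M"
    then obtain x where "x \<in> carrier M" "a = h x" by blast
    then show "\<ominus>\<^bsub>N\<^esub> a \<in> h ` carrier M" by (intro image_eqI[of _ _ "\<ominus>\<^bsub>M\<^esub> x"]) simp_all
  next
    fix a b assume "a \<in> h ` carrier M" "b \<in> h ` carrier M"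
    then obtain x y where "x \<in> carrier M" "a = h x" "y \<in> carrier M" "b = h y" by blast
    then show "a \<oplus>\<^bsub>N\<^esub> b \<in> h ` carrier M" by (intro image_eqI[of _ _ "x \<oplus>\<^bsub>M\<^esub> y"]) simp_all
  next
    fix a b assume "a \<in> carrier R" "b \<in> h ` carrier M"
    then obtain x where "a \<in> carrier R" "x \<in> carrier M" "b = h x" by blast
    then show "a \<odot>\<^bsub>N\<^esub> b \<in> h ` carrier M" by (intro image_eqI[of _ _ "a \<odot>\<^bsub>M\<^esub> x"]) (simp_all add: hl(2))
  qed
  moreover have "component N \<delta> (h x) \<in> h ` carrier M" if "x \<in> carrier M" for x \<delta>
    unfolding hl(4)[OF that] using M.gr.component_closed[OF that] by blast
  ultimately show ?thesis by (auto simp: graded_submodule_def)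
qed

lemma (in graded_koszul) carrier_graded_submodule: "graded_submodule R M (carrier M)"
  by (simp add: graded_submodule_def carrier_is_submodule)

lemma (in graded_koszul) zero_graded_submodule: "graded_submodule R M {\<zero>\<^bsub>M\<^esub>}"
  by (simp add: graded_submodule_def zero_submodule gr.component_homogeneous)

context localizable_module
begin

context
  fixes Z B
  assumes Z: "submodule Z R M" and B: "submodule B R M" and BZ: "B \<subseteq> Z"
begin

interpretation B: abelian_subgroup B M
  by (intro abelian_subgroupI3 additive_subgroup.intro M.abelian_group_axioms)
    (use B in \<open>simp add: submodule_def\<close>)

lemma submodule_mem_carrier: "z \<in> Z \<Longrightarrow> z \<in> carrier M"
  using submoduleE(1)[OF Z] by blast

lemma coset_eq_iff:
  assumes "x \<in> Z" "y \<in> Z"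
  shows "B +>\<^bsub>M\<^esub> x = B +>\<^bsub>M\<^esub> y \<longleftrightarrow> x \<ominus>\<^bsub>M\<^esub> y \<in> B"
proof -
  note c = submodule_mem_carrier[OF assms(1)] submodule_mem_carrier[OF assms(2)]
  have mem: "x \<in> B +>\<^bsub>M\<^esub> y \<longleftrightarrow> x \<ominus>\<^bsub>M\<^esub> y \<in> B"
    unfolding M.minus_eq using c(2,1) by (rule B.a_rcos_module)
  have "B +>\<^bsub>M\<^esub> x = B +>\<^bsub>M\<^esub> y" if "x \<in> B +>\<^bsub>M\<^esub> y"
    using B.a_repr_independence'[OF that c(2)] by simp
  moreover have "x \<in> B +>\<^bsub>M\<^esub> x" using c(1) by (rule B.a_rcos_self)
  ultimately show ?thesis unfolding mem[symmetric] by auto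
qed

lemma subquotient_smult:
  assumes a: "a \<in> carrier R" and z: "z \<in> Z"
  shows "a \<odot>\<^bsub>subquotient M Z B\<^esub> (B +>\<^bsub>M\<^esub> z) = B +>\<^bsub>M\<^esub> (a \<odot>\<^bsub>M\<^esub> z)"
proof -
  have "B +>\<^bsub>M\<^esub> (a \<odot>\<^bsub>M\<^esub> u) = B +>\<^bsub>M\<^esub> (a \<odot>\<^bsub>M\<^esub> z)" if u: "u \<in> B +>\<^bsub>M\<^esub> z" for u
  proof -
    obtain b where b: "b \<in> B" "u = b \<oplus>\<^bsub>M\<^esub> z" using u unfolding a_r_coset_def' by blast
    have c: "b \<in> carrier M" "z \<in> carrier M" using submodule_mem_carrier b(1) BZ z by auto
    have "a \<odot>\<^bsub>M\<^esub> u = a \<odot>\<^bsub>M\<^esub> b \<oplus>\<^bsub>M\<^esub> a \<odot>\<^bsub>M\<^esub> z" unfolding b(2) using a c by (rule smult_r_distr)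
    moreover have "a \<odot>\<^bsub>M\<^esub> b \<in> B" using submoduleE(4)[OF B a b(1)] .
    ultimately have "a \<odot>\<^bsub>M\<^esub> u \<in> B +>\<^bsub>M\<^esub> (a \<odot>\<^bsub>M\<^esub> z)" unfolding a_r_coset_def' by blast
    then show ?thesis
      using B.a_repr_independence'[of "a \<odot>\<^bsub>M\<^esub> u" "a \<odot>\<^bsub>M\<^esub> z"] a c by simp
  qed
  moreover have "z \<in> B +>\<^bsub>M\<^esub> z" using B.a_rcos_self[OF submodule_mem_carrier[OF z]] .
  ultimately have "(\<Union>u\<in>B +>\<^bsub>M\<^esub> z. B +>\<^bsub>M\<^esub> (a \<odot>\<^bsub>M\<^esub> u)) = B +>\<^bsub>M\<^esub> (a \<odot>\<^bsub>M\<^esub> z)" by blast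
  then show ?thesis by (simp add: subquotient_def)
qed

lemma subquotient_add:
  assumes "x \<in> Z" "y \<in> Z"
  shows "(B +>\<^bsub>M\<^esub> x) \<oplus>\<^bsub>subquotient M Z B\<^esub> (B +>\<^bsub>M\<^esub> y) = B +>\<^bsub>M\<^esub> (x \<oplus>\<^bsub>M\<^esub> y)"
  using B.a_rcos_sum[OF submodule_mem_carrier[OF assms(1)] submodule_mem_carrier[OF assms(2)]] by (simp add: subquotient_def)

lemma subquotient_zero: "\<zero>\<^bsub>subquotient M Z B\<^esub> = B +>\<^bsub>M\<^esub> \<zero>\<^bsub>M\<^esub>"
  using M.a_coset_add_zero[OF B.a_subset] by (simp add: subquotient_def)

lemma subquotient_carrier: "carrier (subquotient M Z B) = (\<lambda>z. B +>\<^bsub>M\<^esub> z) ` Z"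
  by (simp add: subquotient_def)

text \<open>The projection \<open>z \<mapsto> B + z\<close> is onto and respects all operations, so that the axioms pass from \<open>Z\<close> to
  the subquotient.\<close>

lemma subquotient_module: "module R (subquotient M Z B)"
proof -
  let ?Q = "subquotient M Z B"
  note ZE = submoduleE[OF Z]
  have Z0: "\<zero>\<^bsub>M\<^esub> \<in> Z" using BZ B.zero_closed by blast
  note Q = subquotient_add subquotient_smult subquotient_zero subquotient_carrier submodule_mem_carrier
  show ?thesis
  proof (rule moduleI)
    show "cring R" by (rule is_cring)
    show "abelian_group ?Q"
    proof (rule abelian_groupI)
      show "\<zero>\<^bsub>?Q\<^esub> \<in> carrier ?Q" using Z0 by (simp add: Q)
      show "x \<oplus>\<^bsub>?Q\<^esub> y \<in> carrier ?Q" if "x \<in> carrier ?Q" "y \<in> carrier ?Q" for x y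
        using that ZE(5) by (auto simp: Q)
      show "x \<oplus>\<^bsub>?Q\<^esub> y \<oplus>\<^bsub>?Q\<^esub> z = x \<oplus>\<^bsub>?Q\<^esub> (y \<oplus>\<^bsub>?Q\<^esub> z)"
        if "x \<in> carrier ?Q" "y \<in> carrier ?Q" "z \<in> carrier ?Q" for x y z
        using that ZE(5) by (auto simp: Q M.a_assoc)
      show "x \<oplus>\<^bsub>?Q\<^esub> y = y \<oplus>\<^bsub>?Q\<^esub> x" if "x \<in> carrier ?Q" "y \<in> carrier ?Q" for x y
        using that by (auto simp: Q M.a_comm)
      show "\<zero>\<^bsub>?Q\<^esub> \<oplus>\<^bsub>?Q\<^esub> x = x" if "x \<in> carrier ?Q" for x
        using that Z0 by (auto simp: Q)
      show "\<exists>y\<in>carrier ?Q. y \<oplus>\<^bsub>?Q\<^esub> x = \<zero>\<^bsub>?Q\<^esub>" if x: "x \<in> carrier ?Q" for x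
      proof -
        obtain z where z: "z \<in> Z" "x = B +>\<^bsub>M\<^esub> z" using x by (auto simp: Q)
        then have "(B +>\<^bsub>M\<^esub> (\<ominus>\<^bsub>M\<^esub> z)) \<oplus>\<^bsub>?Q\<^esub> x = \<zero>\<^bsub>?Q\<^esub>"
          using ZE(3)[OF z(1)] by (simp add: Q M.l_neg)
        moreover have "B +>\<^bsub>M\<^esub> (\<ominus>\<^bsub>M\<^esub> z) \<in> carrier ?Q" using ZE(3)[OF z(1)] by (simp add: Q)
        ultimately show ?thesis by blast
      qed
    qed
  next
    fix a x assume a: "a \<in> carrier R" and x: "x \<in> carrier ?Q"
    show "a \<odot>\<^bsub>?Q\<^esub> x \<in> carrier ?Q" using x a ZE(4) by (auto simp: Q)
  next
    fix a b x assume "a \<in> carrier R" "b \<in> carrier R" "x \<in> carrier ?Q"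
    then show "(a \<oplus> b) \<odot>\<^bsub>?Q\<^esub> x = a \<odot>\<^bsub>?Q\<^esub> x \<oplus>\<^bsub>?Q\<^esub> b \<odot>\<^bsub>?Q\<^esub> x"
      and "(a \<otimes> b) \<odot>\<^bsub>?Q\<^esub> x = a \<odot>\<^bsub>?Q\<^esub> (b \<odot>\<^bsub>?Q\<^esub> x)"
      using ZE(4) by (auto simp: Q smult_l_distr smult_assoc1)
  next
    fix a x y assume "a \<in> carrier R" "x \<in> carrier ?Q" "y \<in> carrier ?Q"
    then show "a \<odot>\<^bsub>?Q\<^esub> (x \<oplus>\<^bsub>?Q\<^esub> y) = a \<odot>\<^bsub>?Q\<^esub> x \<oplus>\<^bsub>?Q\<^esub> a \<odot>\<^bsub>?Q\<^esub> y"
      using ZE(4,5) by (auto simp: Q smult_r_distr)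
  next
    fix x assume "x \<in> carrier ?Q"
    then show "\<one> \<odot>\<^bsub>?Q\<^esub> x = x" by (auto simp: Q)
  qed
qed

end
end

context koszul_module
begin

lemma subquotient_koszul_module:
  assumes "submodule Z R M" "submodule B R M" "B \<subseteq> Z"
  shows "koszul_module R (subquotient M Z B) fs"
  using subquotient_module[OF assms] fs_closed
  by (intro koszul_module.intro localizable_module.intro koszul_module_axioms.intro)

text \<open>The projection is defined on \<open>Z\<close> only. Naturality is therefore applied twice to \<open>Z\<close> as a module of
  its own: for the inclusion into \<open>M\<close> and for the projection.\<close>

lemma koszul_diff_subquotient:
  assumes Z: "submodule Z R M" and B: "submodule B R M" and BZ: "B \<subseteq> Z"
    and m: "m \<in> Pow {..<length fs} \<rightarrow> Z" and J: "J \<subseteq> {..<length fs}"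
  shows "koszul_diff R fs (subquotient M Z B) k (\<lambda>I. B +>\<^bsub>M\<^esub> m I) J = B +>\<^bsub>M\<^esub> koszul_diff R fs M k m J"
proof -
  let ?Q = "subquotient M Z B" and ?Z = "M\<lparr>carrier := Z\<rparr>"
  have "module R ?Z" by (rule submodule.submodule_is_module[OF Z module_axioms])
  then have KZ: "koszul_module R ?Z fs"
    using fs_closed by (intro koszul_module.intro localizable_module.intro koszul_module_axioms.intro)
  interpret Z: koszul_module R ?Z fs by (rule KZ)
  have KQ: "koszul_module R ?Q fs" using Z B BZ by (rule subquotient_koszul_module)
  interpret Q: koszul_module R ?Q fs by (rule KQ)
  have mZ: "m \<in> Pow {..<length fs} \<rightarrow> carrier ?Z" using m by simp
  have ZM: "Z \<subseteq> carrier M" using submoduleE(1)[OF Z] .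
  have id: "abelian_group_hom ?Z M (\<lambda>x. x)"
    by (rule abelian_group_hom_additiveI) (use ZM in \<open>auto simp: M.abelian_group_axioms Z.M.abelian_group_axioms\<close>)
  have 1: "koszul_diff R fs ?Z k m J = koszul_diff R fs M k m J"
    using Z.koszul_diff_hom[OF koszul_module_axioms id _ mZ J, of k] by simp
  have \<pi>: "abelian_group_hom ?Z ?Q (\<lambda>x. B +>\<^bsub>M\<^esub> x)"
    by (rule abelian_group_hom_additiveI)
      (simp_all add: Z.M.abelian_group_axioms Q.M.abelian_group_axioms subquotient_add[OF Z B BZ]
        subquotient_carrier[OF Z B BZ])
  show ?thesis
    using Z.koszul_diff_hom[OF KQ \<pi> _ mZ J, of k] unfolding 1 by (simp add: subquotient_smult[OF Z B BZ])
qed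

lemma cech_cohomology_zeroI:
  assumes "\<And>k m. m \<in> Pow {..<length fs} \<rightarrow> carrier M \<Longrightarrow> koszul_exact R fs M p k m"
  shows "carrier (cech_cohomology R fs M p) = {\<zero>\<^bsub>cech_cohomology R fs M p\<^esub>}"
proof -
  let ?B = "cech_coboundaries R fs M p" and ?C = "cech_cochains R fs M p"
  have B: "?B +>\<^bsub>?C\<^esub> c = ?B" if "c \<in> cech_cocycles R fs M p" for c
  proof -
    have c: "c \<in> carrier ?C" using that by (simp add: cech_cocycles_def)
    obtain k m where m: "m \<in> Pow {..<length fs} \<rightarrow> carrier M" "c = fraction_cochain R fs M p k m"
      using c by (rule cech_cochainE)
    have "c \<in> ?B" unfolding m(2) fraction_cochain_coboundary[OF m(1)] by (rule assms[OF m(1)])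
    then show ?thesis using coboundaries_coset_eq_iff[OF c] by blast
  qed
  have z: "(\<lambda>_. \<zero>\<^bsub>M\<^esub>) \<in> Pow {..<length fs} \<rightarrow> carrier M" by simp
  have "koszul_diff R fs M 0 (\<lambda>_. \<zero>\<^bsub>M\<^esub>) J = \<zero>\<^bsub>M\<^esub>" if "J \<in> cech_index fs (Suc p)" for J
    using cech_index_subset[OF that] by (rule koszul_diff_zero)
  then have "fraction_cochain R fs M p 0 (\<lambda>_. \<zero>\<^bsub>M\<^esub>) \<in> cech_cocycles R fs M p"
    unfolding fraction_cochain_cocycle[OF z] by (intro exI[of _ 0]) simp
  then have "(\<lambda>c. ?B +>\<^bsub>?C\<^esub> c) ` cech_cocycles R fs M p = {?B}" using B by blast
  then show ?thesis by (simp add: cech_cohomology_def subquotient_def)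
qed

lemma cech_index_empty:
  assumes "length fs < p"
  shows "cech_index fs p = {}"
proof -
  have "card I \<le> length fs" if "I \<subseteq> {..<length fs}" for I
    using card_mono[OF finite_lessThan that] by simp
  then have "card I \<noteq> p" if "I \<subseteq> {..<length fs}" for I
    using that assms leD by blast
  then show ?thesis unfolding cech_index_def by blast
qed

text \<open>The infimum that defines the cohomological dimension is attained, since all cohomology above the
  number of generators vanishes.\<close>

lemma cohomology_zero_above_cd:
  assumes "cohomological_dim R fs M < p"
  shows "carrier (cech_cohomology R fs M p) = {\<zero>\<^bsub>cech_cohomology R fs M p\<^esub>}"
proof -
  let ?S = "{i. \<forall>j>i. carrier (cech_cohomology R fs M j) = {\<zero>\<^bsub>cech_cohomology R fs M j\<^esub>}}"
  have "carrier (cech_cohomology R fs M j) = {\<zero>\<^bsub>cech_cohomology R fs M j\<^esub>}" if j: "length fs < j" for j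
  proof (rule cech_cohomology_zeroI)
    show "koszul_exact R fs M j k m" for k m
      unfolding koszul_exact_def cech_index_empty[OF j]
      by (intro exI[of _ 0] bexI[of _ "\<lambda>_. \<zero>\<^bsub>M\<^esub>"]) simp_all
  qed
  then have "length fs \<in> ?S" by blast
  then have "Inf ?S \<in> ?S" by (intro Inf_nat_def1) blast
  then have "\<forall>j>Inf ?S. carrier (cech_cohomology R fs M j) = {\<zero>\<^bsub>cech_cohomology R fs M j\<^esub>}" by (rule CollectD)
  then show ?thesis using assms unfolding cohomological_dim_def by simp
qed

end

text \<open>A cocycle modulo \<open>B\<close> is a cocycle of the quotient; a primitive there is lifted to \<open>Z\<close> entry by
  entry.\<close>

lemma (in graded_koszul) koszul_acyclic_subquotient:
  assumes Z: "graded_submodule R M Z" and B: "graded_submodule R M B" and BZ: "B \<subseteq> Z"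
    and H: "carrier (cech_cohomology R fs (subquotient M Z B) p) =
      {\<zero>\<^bsub>cech_cohomology R fs (subquotient M Z B) p\<^esub>}"
  shows "koszul_acyclic R fs e M Z B p \<gamma>"
proof (rule koszul_acyclic_inhomogeneousI[OF Z B])
  let ?Q = "subquotient M Z B"
  have Zs: "submodule Z R M" and Bs: "submodule B R M" using Z B by (auto simp: graded_submodule_def)
  interpret Q: koszul_module R ?Q fs using Zs Bs BZ by (rule subquotient_koszul_module)
  note kd = koszul_diff_subquotient[OF Zs Bs BZ]
  note [simp] = subquotient_carrier[OF Zs Bs BZ]
  fix k m assume m: "m \<in> graded_cochains M (length fs) e \<gamma> k Z"
    and cyc: "\<forall>J\<in>cech_index fs (Suc p). koszul_diff R fs M k m J \<in> B"
  note mZ = graded_cochains_closed(2)[OF m]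
  have "\<forall>J\<in>cech_index fs (Suc p). koszul_diff R fs ?Q k (\<lambda>I. B +>\<^bsub>M\<^esub> m I) J = \<zero>\<^bsub>?Q\<^esub>"
  proof
    fix J assume J: "J \<in> cech_index fs (Suc p)"
    let ?y = "koszul_diff R fs M k m J"
    have y: "?y \<in> B" using cyc J by blast
    have "B +>\<^bsub>M\<^esub> ?y = B +>\<^bsub>M\<^esub> \<zero>\<^bsub>M\<^esub>"
      using y submodule_closed(2,4)[OF Bs] BZ by (subst coset_eq_iff[OF Zs Bs BZ]) auto
    then show "koszul_diff R fs ?Q k (\<lambda>I. B +>\<^bsub>M\<^esub> m I) J = \<zero>\<^bsub>?Q\<^esub>"
      unfolding kd[OF mZ cech_index_subset[OF J]] subquotient_zero[OF Zs Bs BZ] .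
  qed
  moreover have "(\<lambda>I. B +>\<^bsub>M\<^esub> m I) \<in> Pow {..<length fs} \<rightarrow> carrier ?Q" using mZ by auto
  ultimately have "koszul_exact R fs ?Q p k (\<lambda>I. B +>\<^bsub>M\<^esub> m I)"
    using Q.koszul_cocycle_exact_if_cohomology_zero[OF H] by blast
  then obtain s q where q: "q \<in> Pow {..<length fs} \<rightarrow> carrier ?Q" and eq: "\<forall>J\<in>cech_index fs p.
      (cech_elem R fs J [^] s) \<odot>\<^bsub>?Q\<^esub> (B +>\<^bsub>M\<^esub> m J) = koszul_diff R fs ?Q (k + s) q J"
    unfolding koszul_exact_def by blast
  have "\<exists>z. z \<in> Z \<and> q I = B +>\<^bsub>M\<^esub> z" if "I \<in> Pow {..<length fs}" for I
  proof -
    have "q I \<in> (\<lambda>z. B +>\<^bsub>M\<^esub> z) ` Z" using funcset_mem[OF q that] by simp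
    then show ?thesis by blast
  qed
  then obtain m' where m'Z: "\<And>I. I \<in> Pow {..<length fs} \<Longrightarrow> m' I \<in> Z"
    and qm': "\<And>I. I \<in> Pow {..<length fs} \<Longrightarrow> q I = B +>\<^bsub>M\<^esub> m' I" by metis
  have m': "m' \<in> Pow {..<length fs} \<rightarrow> Z" using m'Z by blast
  have "(cech_elem R fs J [^] s) \<odot>\<^bsub>M\<^esub> m J \<ominus>\<^bsub>M\<^esub> koszul_diff R fs M (k + s) m' J \<in> B"
    if J: "J \<in> cech_index fs p" for J
  proof -
    note JP = cech_index_subset[OF J]
    have f: "cech_elem R fs J [^] s \<in> carrier R" using JP by simp
    have mJ: "m J \<in> Z" using mZ JP by blast
    have "B +>\<^bsub>M\<^esub> ((cech_elem R fs J [^] s) \<odot>\<^bsub>M\<^esub> m J) = koszul_diff R fs ?Q (k + s) q J"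
      using eq J subquotient_smult[OF Zs Bs BZ f mJ] by simp
    also have "\<dots> = koszul_diff R fs ?Q (k + s) (\<lambda>I. B +>\<^bsub>M\<^esub> m' I) J"
      using q JP by (intro Q.koszul_diff_cong[symmetric]) (auto simp: qm')
    also have "\<dots> = B +>\<^bsub>M\<^esub> koszul_diff R fs M (k + s) m' J" using m' JP by (rule kd)
    finally show ?thesis
      using coset_eq_iff[OF Zs Bs BZ submodule_closed(5)[OF Zs f mJ] koszul_diff_submodule[OF Zs m' JP]]
      by blast
  qed
  then show "\<exists>s. \<exists>m'\<in>Pow {..<length fs} \<rightarrow> Z. \<forall>J\<in>cech_index fs p.
      (cech_elem R fs J [^] s) \<odot>\<^bsub>M\<^esub> m J \<ominus>\<^bsub>M\<^esub> koszul_diff R fs M (k + s) m' J \<in> B"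
    using m' by blast
qed

section \<open>Resolutions\<close>

text \<open>Descending induction on \<open>i\<close>, measured by the distance \<open>t\<close> from \<open>l + i + 1\<close> to the number of
  generators. The cycles in position \<open>i + 1\<close> are an extension of the homology by the boundaries, and
  the boundaries in position \<open>i\<close> are the image of the differential with these cycles as kernel.\<close>

lemma koszul_acyclic_boundaries:
  fixes F :: "nat \<Rightarrow> ('r, 'b, 'g::ab_group_add) gmodule" and l :: nat
  assumes F: "\<And>i. graded_koszul R (F i) fs e"
    and D: "\<And>i. D i \<in> graded_hom R (F (Suc i)) (F i)"
    and DD: "\<And>i x. x \<in> carrier (F (Suc (Suc i))) \<Longrightarrow> D i (D (Suc i) x) = \<zero>\<^bsub>F i\<^esub>"
    and free: "\<And>i. koszul_acyclic R fs e (F i) (carrier (F i)) {\<zero>\<^bsub>F i\<^esub>} (l + i) \<gamma>"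
    and hom: "\<And>i. koszul_acyclic R fs e (F (Suc i)) {x \<in> carrier (F (Suc i)). D i x = \<zero>\<^bsub>F i\<^esub>}
      (D (Suc i) ` carrier (F (Suc (Suc i)))) (Suc (l + Suc i)) \<gamma>"
  shows "koszul_acyclic R fs e (F i) (D i ` carrier (F (Suc i))) {\<zero>\<^bsub>F i\<^esub>} (Suc (l + i)) \<gamma>"
proof -
  have "koszul_acyclic R fs e (F i) (D i ` carrier (F (Suc i))) {\<zero>\<^bsub>F i\<^esub>} (Suc (l + i)) \<gamma>"
    if "length fs < Suc (l + i) + t" for t i
    using that
  proof (induction t arbitrary: i)
    case 0
    interpret F: graded_koszul R "F i" fs e by (rule F)
    have "cech_index fs (Suc (l + i)) = {}" using 0 by (intro F.cech_index_empty) simp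
    moreover have "(\<lambda>_. \<zero>\<^bsub>F i\<^esub>) \<in> graded_cochains (F i) (length fs) e \<gamma> k (D i ` carrier (F (Suc i)))" for k
    proof -
      have "submodule (D i ` carrier (F (Suc i))) R (F i)"
        using image_graded_submodule[OF F F D] by (simp add: graded_submodule_def)
      then show ?thesis using F.submodule_closed(2) by (auto simp: graded_cochains_def)
    qed
    ultimately show ?case unfolding koszul_acyclic_def by blast
  next
    case (Suc t)
    interpret F1: graded_koszul R "F (Suc i)" fs e by (rule F)
    let ?Z = "{x \<in> carrier (F (Suc i)). D i x = \<zero>\<^bsub>F i\<^esub>}"
    let ?B = "D (Suc i) ` carrier (F (Suc (Suc i)))"
    have Z: "submodule ?Z R (F (Suc i))"
      using kernel_graded_submodule[OF F F D] by (simp add: graded_submodule_def)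
    have B: "submodule ?B R (F (Suc i))"
      using image_graded_submodule[OF F F D] by (simp add: graded_submodule_def)
    have BZ: "?B \<subseteq> ?Z" using DD F1.submoduleE(1)[OF B] by auto
    have "koszul_acyclic R fs e (F (Suc i)) ?B {\<zero>\<^bsub>F (Suc i)\<^esub>} (Suc (l + Suc i)) \<gamma>"
      using Suc.prems by (intro Suc.IH) simp
    then have "koszul_acyclic R fs e (F (Suc i)) ?Z {\<zero>\<^bsub>F (Suc i)\<^esub>} (Suc (l + Suc i)) \<gamma>"
      using Z B BZ hom by (intro F1.koszul_acyclic_extension[of ?Z ?B])
    then show ?case
      using koszul_acyclic_image[OF F[of "Suc i"] F[of i] D[of i], where p = "Suc (l + i)" and \<gamma> = \<gamma>]
        free[of "Suc i"] Z by simp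
  qed
  from this[where t = "length fs"] show ?thesis by simp
qed

section \<open>Direct sums of shifted copies of the ring\<close>

lemma (in graded_koszul) regular_graded_koszul: "graded_koszul R (regular_module R) fs e"
  using regular_module_graded fs_degree
  by (intro graded_koszul.intro graded_koszul_axioms.intro)

lemma (in graded_koszul) koszul_acyclic_if_not_Supp:
  assumes "\<gamma> \<notin> Supp (cech_cohomology R fs M p)"
  shows "koszul_acyclic R fs e M (carrier M) {\<zero>\<^bsub>M\<^esub>} p \<gamma>"
proof (rule koszul_acyclic_inhomogeneousI[OF carrier_graded_submodule zero_graded_submodule])
  fix k m assume m: "m \<in> graded_cochains M (length fs) e \<gamma> k (carrier M)"
    and "\<forall>J\<in>cech_index fs (Suc p). koszul_diff R fs M k m J \<in> {\<zero>\<^bsub>M\<^esub>}"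
  then have "koszul_exact R fs M p k m"
    by (intro koszul_cocycle_exact_if_not_Supp[OF assms m]) simp
  then obtain s m' where m': "m' \<in> Pow {..<length fs} \<rightarrow> carrier M" and eq: "\<forall>J\<in>cech_index fs p.
      (cech_elem R fs J [^] s) \<odot>\<^bsub>M\<^esub> m J = koszul_diff R fs M (k + s) m' J"
    unfolding koszul_exact_def by blast
  have "(cech_elem R fs J [^] s) \<odot>\<^bsub>M\<^esub> m J \<ominus>\<^bsub>M\<^esub> koszul_diff R fs M (k + s) m' J \<in> {\<zero>\<^bsub>M\<^esub>}"
    if J: "J \<in> cech_index fs p" for J
    using eq J koszul_diff_closed[OF m' cech_index_subset[OF J]] by (simp add: M.minus_eq M.r_neg)
  with m' show "\<exists>s. \<exists>m'\<in>Pow {..<length fs} \<rightarrow> carrier M. \<forall>J\<in>cech_index fs p.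
      (cech_elem R fs J [^] s) \<odot>\<^bsub>M\<^esub> m J \<ominus>\<^bsub>M\<^esub> koszul_diff R fs M (k + s) m' J \<in> {\<zero>\<^bsub>M\<^esub>}" by blast
qed

lemma shift_simps [simp]:
  "carrier (shift M \<delta>) = carrier M" "\<zero>\<^bsub>shift M \<delta>\<^esub> = \<zero>\<^bsub>M\<^esub>"
  "x \<oplus>\<^bsub>shift M \<delta>\<^esub> y = x \<oplus>\<^bsub>M\<^esub> y" "a \<odot>\<^bsub>shift M \<delta>\<^esub> x = a \<odot>\<^bsub>M\<^esub> x"
  "mpart (shift M \<delta>) \<gamma> = mpart M (\<delta> + \<gamma>)"
  by (simp_all add: shift_def)

text \<open>Coordinate by coordinate, a cocycle of the direct sum is a cocycle of the ring in the shifted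
  degree \<open>\<delta> - \<gamma> j\<close>. It involves only finitely many coordinates, even if \<open>E\<close> is infinite, so that one
  exponent can be chosen for all of them.\<close>

lemma koszul_acyclic_free:
  fixes F :: "('r, 'b, 'g::ab_group_add) gmodule" and E :: "'e set"
  assumes F: "graded_koszul R F fs e"
    and iso: "graded_iso R F (direct_sum E (\<lambda>j. shift (regular_module R) (- \<gamma> j)))"
    and supp: "\<And>j. j \<in> E \<Longrightarrow> \<delta> - \<gamma> j \<notin> Supp (cech_cohomology R fs (regular_module R) p)"
  shows "koszul_acyclic R fs e F (carrier F) {\<zero>\<^bsub>F\<^esub>} p \<delta>"
  unfolding koszul_acyclic_def
proof (intro allI ballI impI)
  interpret F: graded_koszul R F fs e by fact
  let ?R = "regular_module R"
  let ?S = "direct_sum E (\<lambda>j. shift ?R (- \<gamma> j))"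
  have R: "graded_koszul R ?R fs e" by (rule F.regular_graded_koszul)
  interpret R: graded_koszul R ?R fs e by (rule R)
  obtain h where h: "h \<in> graded_hom R F ?S" and bij: "bij_betw h (carrier F) (carrier ?S)"
    and hm: "\<And>\<gamma>. h ` mpart F \<gamma> = mpart ?S \<gamma>"
    using iso unfolding graded_iso_def by blast
  have hadd: "h (x \<oplus>\<^bsub>F\<^esub> y) = h x \<oplus>\<^bsub>?S\<^esub> h y" if "x \<in> carrier F" "y \<in> carrier F" for x y
    using h that unfolding graded_hom_def by blast
  have hsm: "h (a \<odot>\<^bsub>F\<^esub> x) = a \<odot>\<^bsub>?S\<^esub> h x" if "a \<in> carrier R" "x \<in> carrier F" for a x
    using h that unfolding graded_hom_def by blast
  have hS: "h x \<in> carrier ?S" if "x \<in> carrier F" for x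
    using h that unfolding graded_hom_def by blast
  have hc: "h x j \<in> carrier R" if "x \<in> carrier F" "j \<in> E" for x j
    using hS[OF that(1)] that(2) by (auto simp: direct_sum_def)
  have hom: "abelian_group_hom F ?R (\<lambda>x. h x j)" if "j \<in> E" for j
    by (rule abelian_group_hom_additiveI)
      (use that in \<open>auto simp: hc hadd F.M.abelian_group_axioms R.M.abelian_group_axioms direct_sum_def\<close>)
  have lin: "h (a \<odot>\<^bsub>F\<^esub> x) j = a \<odot>\<^bsub>?R\<^esub> h x j" if "a \<in> carrier R" "x \<in> carrier F" "j \<in> E" for a x j
    using that by (simp add: hsm direct_sum_def)
  have kd: "h (koszul_diff R fs F k m J) j = koszul_diff R fs ?R k (\<lambda>I. h (m I) j) J"
    if "j \<in> E" "m \<in> Pow {..<length fs} \<rightarrow> carrier F" "J \<subseteq> {..<length fs}" for j k m J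
    by (rule F.koszul_diff_hom[OF R.koszul_module_axioms hom[OF that(1)] _ that(2,3)])
      (simp add: lin that(1) del: regular_module_simps)
  fix k m assume m: "m \<in> graded_cochains F (length fs) e \<delta> k (carrier F)"
    and cyc: "\<forall>J\<in>cech_index fs (Suc p). koszul_diff R fs F k m J \<in> {\<zero>\<^bsub>F\<^esub>}"
  note mc = F.graded_cochains_closed(1)[OF m]
  have mj: "(\<lambda>I. h (m I) j) \<in> graded_cochains ?R (length fs) e (\<delta> - \<gamma> j) k (carrier ?R)" if j: "j \<in> E" for j
    unfolding graded_cochains_def
  proof (intro Pi_I IntI)
    fix I assume I: "I \<in> Pow {..<length fs}"
    have mI: "m I \<in> mpart F (\<delta> + pow_degree e k I)" using m I by (auto simp: graded_cochains_def)
    then have "h (m I) \<in> mpart ?S (\<delta> + pow_degree e k I)" using hm by blast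
    then have "h (m I) j \<in> rpart R (- \<gamma> j + (\<delta> + pow_degree e k I))"
      using j by (auto simp: direct_sum_def)
    then show "h (m I) j \<in> mpart ?R (\<delta> - \<gamma> j + pow_degree e k I)" by (simp add: algebra_simps)
    show "h (m I) j \<in> carrier ?R" using hc[OF F.gr.mpart_carrier[OF mI] j] by simp
  qed
  have "\<exists>s m'. m' \<in> graded_cochains ?R (length fs) e (\<delta> - \<gamma> j) (k + s) (carrier ?R) \<and>
      (\<forall>J\<in>cech_index fs p. (cech_elem R fs J [^]\<^bsub>R\<^esub> s) \<odot>\<^bsub>?R\<^esub> h (m J) j =
        koszul_diff R fs ?R (k + s) m' J)" if j: "j \<in> E" for j
  proof -
    have ac: "koszul_acyclic R fs e ?R (carrier ?R) {\<zero>\<^bsub>?R\<^esub>} p (\<delta> - \<gamma> j)"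
      by (rule R.koszul_acyclic_if_not_Supp[OF supp[OF j]])
    have "koszul_diff R fs ?R k (\<lambda>I. h (m I) j) J \<in> {\<zero>\<^bsub>?R\<^esub>}" if J: "J \<in> cech_index fs (Suc p)" for J
    proof -
      have "koszul_diff R fs ?R k (\<lambda>I. h (m I) j) J = h \<zero>\<^bsub>F\<^esub> j"
        using kd[OF j mc cech_index_subset[OF J], of k] cyc J by simp
      then show ?thesis using abelian_group_hom.hom_zero[OF hom[OF j]] by simp
    qed
    then obtain s m' where m': "m' \<in> graded_cochains ?R (length fs) e (\<delta> - \<gamma> j) (k + s) (carrier ?R)"
      and eq: "\<forall>J\<in>cech_index fs p. (cech_elem R fs J [^]\<^bsub>R\<^esub> s) \<odot>\<^bsub>?R\<^esub> h (m J) j \<ominus>\<^bsub>?R\<^esub>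
        koszul_diff R fs ?R (k + s) m' J \<in> {\<zero>\<^bsub>?R\<^esub>}"
      by (rule koszul_acyclicE[OF ac mj[OF j]])
    have "(cech_elem R fs J [^]\<^bsub>R\<^esub> s) \<odot>\<^bsub>?R\<^esub> h (m J) j = koszul_diff R fs ?R (k + s) m' J"
      if J: "J \<in> cech_index fs p" for J
    proof -
      note c = R.cochain_at[OF R.graded_cochains_closed(1)[OF mj[OF j]] J]
      have "(cech_elem R fs J [^]\<^bsub>R\<^esub> s) \<odot>\<^bsub>?R\<^esub> h (m J) j \<in> carrier ?R" using c by simp
      moreover have "koszul_diff R fs ?R (k + s) m' J \<in> carrier ?R"
        using R.graded_cochains_closed(1)[OF m'] cech_index_subset[OF J] by (rule R.koszul_diff_closed)
      ultimately show ?thesis using eq J R.M.minus_eq_zero_iff by blast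
    qed
    with m' show ?thesis by blast
  qed
  then obtain s n where n: "\<And>j. j \<in> E \<Longrightarrow> n j \<in> graded_cochains ?R (length fs) e (\<delta> - \<gamma> j) (k + s j) (carrier ?R)"
    and eqn: "\<And>j J. j \<in> E \<Longrightarrow> J \<in> cech_index fs p \<Longrightarrow>
      (cech_elem R fs J [^]\<^bsub>R\<^esub> s j) \<odot>\<^bsub>?R\<^esub> h (m J) j = koszul_diff R fs ?R (k + s j) (n j) J"
    by metis
  \<comment> \<open>the coordinates that occur in some entry of \<open>m\<close>\<close>
  define A where "A = (\<Union>I\<in>Pow {..<length fs}. {j \<in> E. h (m I) j \<noteq> \<zero>\<^bsub>R\<^esub>})"
  have finA: "finite A"
    unfolding A_def
  proof (intro finite_UN_I)
    fix I assume "I \<in> Pow {..<length fs}"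
    then have "h (m I) \<in> carrier ?S" using hS mc by blast
    then show "finite {j \<in> E. h (m I) j \<noteq> \<zero>\<^bsub>R\<^esub>}" by (simp add: direct_sum_def)
  qed simp
  define K where "K = Max (s ` A)"
  have K: "s j \<le> K" if "j \<in> A" for j unfolding K_def using that finA by (intro Max_ge) auto
  \<comment> \<open>the primitives of the coordinates, raised from their exponents \<open>s j\<close> to the common exponent \<open>K\<close>\<close>
  define x where "x I = (\<lambda>j\<in>E. if j \<in> A then (cech_elem R fs I [^]\<^bsub>R\<^esub> (K - s j)) \<odot>\<^bsub>?R\<^esub> n j I else \<zero>\<^bsub>R\<^esub>)" for I
  have xm: "x I \<in> mpart ?S (\<delta> + pow_degree e (k + K) I)" if I: "I \<in> Pow {..<length fs}" for I
  proof -
    have "x I j \<in> rpart R (- \<gamma> j + (\<delta> + pow_degree e (k + K) I))" if j: "j \<in> E" for j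
    proof (cases "j \<in> A")
      case True
      have "(\<lambda>I. (cech_elem R fs I [^]\<^bsub>R\<^esub> (K - s j)) \<odot>\<^bsub>?R\<^esub> n j I) \<in>
          graded_cochains ?R (length fs) e (\<delta> - \<gamma> j) (k + s j + (K - s j)) (carrier ?R)"
        using R.carrier_is_submodule n[OF j] by (rule R.graded_cochains_scale)
      then have "(cech_elem R fs I [^]\<^bsub>R\<^esub> (K - s j)) \<odot>\<^bsub>?R\<^esub> n j I \<in> mpart ?R (\<delta> - \<gamma> j + pow_degree e (k + K) I)"
        using I K[OF True] by (auto simp: graded_cochains_def Pi_iff)
      then show ?thesis using True j by (simp add: x_def algebra_simps)
    next
      case False
      then show ?thesis using R.gr.mpart_zero j by (simp add: x_def)
    qed
    moreover have "finite {j \<in> E. x I j \<noteq> \<zero>\<^bsub>R\<^esub>}"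
      by (rule finite_subset[OF _ finA]) (auto simp: x_def)
    ultimately show ?thesis by (auto simp: direct_sum_def x_def)
  qed
  have "\<exists>y. y \<in> mpart F (\<delta> + pow_degree e (k + K) I) \<and> h y = x I" if "I \<in> Pow {..<length fs}" for I
  proof -
    have "x I \<in> h ` mpart F (\<delta> + pow_degree e (k + K) I)" unfolding hm by (rule xm[OF that])
    then obtain y where "x I = h y" "y \<in> mpart F (\<delta> + pow_degree e (k + K) I)" by (rule imageE)
    then show ?thesis by (intro exI[of _ y] conjI) simp_all
  qed
  then obtain m' where m'1: "\<And>I. I \<in> Pow {..<length fs} \<Longrightarrow> m' I \<in> mpart F (\<delta> + pow_degree e (k + K) I)"
    and hm': "\<And>I. I \<in> Pow {..<length fs} \<Longrightarrow> h (m' I) = x I" by metis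
  have m': "m' \<in> graded_cochains F (length fs) e \<delta> (k + K) (carrier F)"
    using m'1 F.gr.mpart_carrier by (auto simp: graded_cochains_def)
  note m'c = F.graded_cochains_closed(1)[OF m']
  have "(cech_elem R fs J [^]\<^bsub>R\<^esub> K) \<odot>\<^bsub>F\<^esub> m J \<ominus>\<^bsub>F\<^esub> koszul_diff R fs F (k + K) m' J \<in> {\<zero>\<^bsub>F\<^esub>}"
    if J: "J \<in> cech_index fs p" for J
  proof -
    note JP = cech_index_subset[OF J]
    let ?u = "(cech_elem R fs J [^]\<^bsub>R\<^esub> K) \<odot>\<^bsub>F\<^esub> m J" and ?v = "koszul_diff R fs F (k + K) m' J"
    have f: "cech_elem R fs J \<in> carrier R" and mJ: "m J \<in> carrier F" using F.cochain_at[OF mc J] by auto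
    have u: "?u \<in> carrier F" using f mJ by simp
    have v: "?v \<in> carrier F" using m'c JP by (rule F.koszul_diff_closed)
    have "h ?u j = h ?v j" if j: "j \<in> E" for j
    proof -
      note mjc = R.graded_cochains_closed(1)[OF mj[OF j]] and nc = R.graded_cochains_closed(1)[OF n[OF j]]
      have xc: "(\<lambda>I. x I j) \<in> Pow {..<length fs} \<rightarrow> carrier ?R"
      proof
        fix I assume I: "I \<in> Pow {..<length fs}"
        show "x I j \<in> carrier ?R"
          using hc[OF F.gr.mpart_carrier[OF m'1[OF I]] j] hm'[OF I] by simp
      qed
      have "h ?v j = koszul_diff R fs ?R (k + K) (\<lambda>I. h (m' I) j) J" by (rule kd[OF j m'c JP])
      also have "\<dots> = koszul_diff R fs ?R (k + K) (\<lambda>I. x I j) J"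
        using xc JP by (rule R.koszul_diff_cong) (use hm' JP in auto)
      finally have hv: "h ?v j = koszul_diff R fs ?R (k + K) (\<lambda>I. x I j) J" .
      have hu: "h ?u j = (cech_elem R fs J [^]\<^bsub>R\<^esub> K) \<odot>\<^bsub>?R\<^esub> h (m J) j"
        using lin[OF _ mJ j] f by simp
      show ?thesis
      proof (cases "j \<in> A")
        case True
        let ?t = "\<lambda>I. (cech_elem R fs I [^]\<^bsub>R\<^esub> (K - s j)) \<odot>\<^bsub>?R\<^esub> n j I"
        have sK: "k + s j + (K - s j) = k + K" "K - s j + s j = K" using K[OF True] by simp_all
        have "koszul_diff R fs ?R (k + K) (\<lambda>I. x I j) J = koszul_diff R fs ?R (k + K) ?t J"
          using True j by (simp add: x_def)
        also have "\<dots> = (cech_elem R fs J [^]\<^bsub>R\<^esub> (K - s j)) \<odot>\<^bsub>?R\<^esub> koszul_diff R fs ?R (k + s j) (n j) J"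
          using R.koszul_diff_scale[OF nc JP, of "k + s j" "K - s j"] unfolding sK .
        also have "\<dots> = (cech_elem R fs J [^]\<^bsub>R\<^esub> (K - s j)) \<odot>\<^bsub>?R\<^esub> ((cech_elem R fs J [^]\<^bsub>R\<^esub> s j) \<odot>\<^bsub>?R\<^esub> h (m J) j)"
          unfolding eqn[OF j J] ..
        also have "\<dots> = (cech_elem R fs J [^]\<^bsub>R\<^esub> K) \<odot>\<^bsub>?R\<^esub> h (m J) j"
          using R.pow_smult[OF f R.cochain_at(1)[OF mjc J], of "K - s j" "s j"] unfolding sK .
        finally show ?thesis unfolding hu hv ..
      next
        case False
        have "h (m J) j = \<zero>\<^bsub>R\<^esub>" using False j JP unfolding A_def by blast
        moreover have "koszul_diff R fs ?R (k + K) (\<lambda>I. x I j) J = \<zero>\<^bsub>?R\<^esub>"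
          using False j R.koszul_diff_zero[OF JP, of "k + K"] by (simp add: x_def)
        ultimately show ?thesis unfolding hu hv using f by simp
      qed
    qed
    moreover have "h ?u \<in> extensional E" "h ?v \<in> extensional E"
      using hS[OF u] hS[OF v] by (auto simp: direct_sum_def PiE_def)
    ultimately have "h ?u = h ?v" by (intro extensionalityI[of _ E]) auto
    then have "?u = ?v" using bij u v by (auto simp: bij_betw_def inj_on_def)
    then show ?thesis using F.M.minus_eq_zero_iff[OF u v] by simp
  qed
  with m' show "\<exists>s. \<exists>m'\<in>graded_cochains F (length fs) e \<delta> (k + s) (carrier F). \<forall>J\<in>cech_index fs p.
      (cech_elem R fs J [^]\<^bsub>R\<^esub> s) \<odot>\<^bsub>F\<^esub> m J \<ominus>\<^bsub>F\<^esub> koszul_diff R fs F (k + s) m' J \<in> {\<zero>\<^bsub>F\<^esub>}"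
    by blast
qed

section \<open>The bound on the support\<close>

text \<open>If \<open>\<delta>\<close> is outside the union, then the free modules and, by dimension shifting, the boundaries
  are acyclic in degree \<open>\<delta>\<close>, in the required cohomological degrees. The augmentation \<open>F\<^sub>0 \<rightarrow> M\<close>, whose
  kernel is the module of boundaries in position \<open>0\<close>, carries this over to \<open>M\<close>.\<close>

theorem Supp_cech_cohomology_subset:
  fixes R :: "('r, 'g::ab_group_add) gring"
    and M :: "('r, 'm, 'g) gmodule"
    and F :: "int \<Rightarrow> ('r, 'b, 'g) gmodule"
    and E :: "nat \<Rightarrow> 'e set"
  assumes R: "graded_ring R" and hom: "\<forall>f\<in>set fs. homogeneous R f"
    and M: "graded_module R M" and F: "graded_complex R F d"
    and neg: "carrier (F (- 1)) = {\<zero>\<^bsub>F (- 1)\<^esub>}"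
    and iso: "graded_iso R (homology F d 0) M"
    and free: "\<And>i. graded_iso R (F (int i))
           (direct_sum (E i) (\<lambda>j. shift (regular_module R) (- \<gamma> i j)))"
    and cd: "\<And>j. j \<ge> 1 \<Longrightarrow> cohomological_dim R fs (homology F d (int j)) \<le> l + j"
  shows "Supp (cech_cohomology R fs M l) \<subseteq>
    (\<Union>i. Supp (cech_cohomology R fs (regular_module R) (l + i)) + \<gamma> i ` E i)"
proof (rule subsetI, rule ccontr)
  fix \<delta> assume "\<delta> \<in> Supp (cech_cohomology R fs M l)"
    and notin: "\<delta> \<notin> (\<Union>i. Supp (cech_cohomology R fs (regular_module R) (l + i)) + \<gamma> i ` E i)"
  have "\<exists>\<epsilon>. i < length fs \<longrightarrow> fs ! i \<in> rpart R \<epsilon>" for i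
    using hom nth_mem[of i fs] unfolding homogeneous_def by blast
  then obtain e where e: "\<And>i. i < length fs \<Longrightarrow> fs ! i \<in> rpart R (e i)" by metis
  have K: "graded_koszul R N fs e" if "graded_module R N" for N :: "('r, 'n, 'g) gmodule"
    using that e by (intro graded_koszul.intro graded_koszul_axioms.intro)
  define C where "C i = F (int i)" for i
  define D where "D i = d (int (Suc i))" for i
  have C: "graded_koszul R (C i) fs e" for i
    unfolding C_def using F by (intro K) (simp add: graded_complex_def)
  have D: "D i \<in> graded_hom R (C (Suc i)) (C i)" for i
  proof -
    have "d (int (Suc i)) \<in> graded_hom R (F (int (Suc i))) (F (int (Suc i) - 1))"
      using F unfolding graded_complex_def by blast
    then show ?thesis by (simp add: C_def D_def)
  qed
  have DD: "D i (D (Suc i) x) = \<zero>\<^bsub>C i\<^esub>" if "x \<in> carrier (C (Suc (Suc i)))" for i x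
  proof -
    have "d (int (Suc (Suc i)) - 1) (d (int (Suc (Suc i))) x) = \<zero>\<^bsub>F (int (Suc (Suc i)) - 1 - 1)\<^esub>"
      using F that unfolding graded_complex_def C_def by blast
    then show ?thesis by (simp add: C_def D_def)
  qed
  \<comment> \<open>this is where it matters that \<open>\<delta>\<close> is not in the union\<close>
  have acyclic: "koszul_acyclic R fs e (C i) (carrier (C i)) {\<zero>\<^bsub>C i\<^esub>} (l + i) \<delta>" for i
  proof (rule koszul_acyclic_free[OF C])
    show "graded_iso R (C i) (direct_sum (E i) (\<lambda>j. shift (regular_module R) (- \<gamma> i j)))"
      unfolding C_def by (rule free)
    fix j assume "j \<in> E i"
    show "\<delta> - \<gamma> i j \<notin> Supp (cech_cohomology R fs (regular_module R) (l + i))"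
    proof
      assume "\<delta> - \<gamma> i j \<in> Supp (cech_cohomology R fs (regular_module R) (l + i))"
      then have "(\<delta> - \<gamma> i j) + \<gamma> i j \<in> Supp (cech_cohomology R fs (regular_module R) (l + i)) + \<gamma> i ` E i"
        using \<open>j \<in> E i\<close> by (intro set_plus_intro) auto
      then show False using notin by auto
    qed
  qed
  \<comment> \<open>this is where the bound on the cohomological dimensions enters\<close>
  have hom_acyclic: "koszul_acyclic R fs e (C (Suc i)) {x \<in> carrier (C (Suc i)). D i x = \<zero>\<^bsub>C i\<^esub>}
      (D (Suc i) ` carrier (C (Suc (Suc i)))) (Suc (l + Suc i)) \<delta>" for i
  proof -
    let ?Z = "{x \<in> carrier (C (Suc i)). D i x = \<zero>\<^bsub>C i\<^esub>}" and ?B = "D (Suc i) ` carrier (C (Suc (Suc i)))"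
    interpret C1: graded_koszul R "C (Suc i)" fs e by (rule C)
    have Z: "graded_submodule R (C (Suc i)) ?Z" by (rule kernel_graded_submodule[OF C C D])
    have B: "graded_submodule R (C (Suc i)) ?B" by (rule image_graded_submodule[OF C C D])
    have Zs: "submodule ?Z R (C (Suc i))" and Bs: "submodule ?B R (C (Suc i))"
      using Z B by (simp_all add: graded_submodule_def)
    have BZ: "?B \<subseteq> ?Z" using DD C1.submoduleE(1)[OF Bs] by auto
    have H: "homology F d (int (Suc i)) = subquotient (C (Suc i)) ?Z ?B"
      unfolding homology_def C_def D_def by (simp add: add.commute)
    interpret Q: koszul_module R "subquotient (C (Suc i)) ?Z ?B" fs
      by (rule C1.subquotient_koszul_module[OF Zs Bs BZ])
    have "cohomological_dim R fs (subquotient (C (Suc i)) ?Z ?B) < Suc (l + Suc i)"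
      using cd[of "Suc i"] unfolding H by simp
    then show ?thesis using Z B BZ by (intro C1.koszul_acyclic_subquotient Q.cohomology_zero_above_cd)
  qed
  have boundaries: "koszul_acyclic R fs e (C 0) (D 0 ` carrier (C (Suc 0))) {\<zero>\<^bsub>C 0\<^esub>} (Suc l) \<delta>"
    using koszul_acyclic_boundaries[OF C D DD acyclic hom_acyclic, of 0] by simp

  interpret C0: graded_koszul R "C 0" fs e by (rule C)
  interpret M: graded_koszul R M fs e by (rule K[OF M])
  let ?B = "D 0 ` carrier (C (Suc 0))"
  have B: "graded_submodule R (C 0) ?B" by (rule image_graded_submodule[OF C C D])
  then have Bs: "submodule ?B R (C 0)" by (simp add: graded_submodule_def)
  have BC: "?B \<subseteq> carrier (C 0)" by (rule C0.submoduleE(1)[OF Bs])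
  \<comment> \<open>every element of \<open>F 0\<close> is a cycle, so that \<open>H\<^sub>0\<close> is the cokernel of \<open>D 0\<close>\<close>
  have "{x \<in> carrier (F 0). d 0 x = \<zero>\<^bsub>F (0 - 1)\<^esub>} = carrier (F 0)"
  proof -
    have "d 0 \<in> graded_hom R (F 0) (F (0 - 1))" using F unfolding graded_complex_def by blast
    then have "d 0 x \<in> carrier (F (- 1))" if "x \<in> carrier (F 0)" for x
      using that by (auto simp: graded_hom_def)
    then show ?thesis using neg by auto
  qed
  then have H0: "homology F d 0 = subquotient (C 0) (carrier (C 0)) ?B"
    unfolding homology_def C_def D_def by simp
  obtain g where g: "g \<in> graded_hom R (subquotient (C 0) (carrier (C 0)) ?B) M"
    and bij: "bij_betw g (carrier (subquotient (C 0) (carrier (C 0)) ?B)) (carrier M)"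
    using iso unfolding graded_iso_def H0 by blast
  note Q = C0.subquotient_add[OF C0.carrier_is_submodule Bs BC] C0.subquotient_smult[OF C0.carrier_is_submodule Bs BC]
    C0.subquotient_zero[OF C0.carrier_is_submodule Bs BC] C0.subquotient_carrier[OF C0.carrier_is_submodule Bs BC]
  \<comment> \<open>the augmentation \<open>F\<^sub>0 \<rightarrow> M\<close>\<close>
  define \<phi> where "\<phi> x = g (?B +>\<^bsub>C 0\<^esub> x)" for x
  have \<phi>: "\<phi> \<in> graded_hom R (C 0) M"
    unfolding graded_hom_def
  proof (intro CollectI conjI Pi_I ballI allI subsetI)
    fix x assume x: "x \<in> carrier (C 0)"
    then have qx: "?B +>\<^bsub>C 0\<^esub> x \<in> carrier (subquotient (C 0) (carrier (C 0)) ?B)" by (simp add: Q)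
    show "\<phi> x \<in> carrier M" unfolding \<phi>_def using g qx by (auto simp: graded_hom_def)
    show "\<phi> (x \<oplus>\<^bsub>C 0\<^esub> y) = \<phi> x \<oplus>\<^bsub>M\<^esub> \<phi> y" if y: "y \<in> carrier (C 0)" for y
    proof -
      have "?B +>\<^bsub>C 0\<^esub> y \<in> carrier (subquotient (C 0) (carrier (C 0)) ?B)" using y by (simp add: Q)
      then show ?thesis unfolding \<phi>_def Q(1)[OF x y, symmetric] using g qx by (simp add: graded_hom_def)
    qed
    show "\<phi> (a \<odot>\<^bsub>C 0\<^esub> x) = a \<odot>\<^bsub>M\<^esub> \<phi> x" if a: "a \<in> carrier R" for a
      unfolding \<phi>_def Q(2)[OF a x, symmetric] using g qx a by (simp add: graded_hom_def)
  next
    fix \<gamma> y assume "y \<in> \<phi> ` mpart (C 0) \<gamma>"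
    then obtain x where x: "x \<in> mpart (C 0) \<gamma>" "y = \<phi> x" by blast
    have "?B +>\<^bsub>C 0\<^esub> x \<in> mpart (subquotient (C 0) (carrier (C 0)) ?B) \<gamma>"
      using x(1) C0.gr.mpart_carrier[OF x(1)] by (auto simp: subquotient_def)
    then show "y \<in> mpart M \<gamma>" unfolding x(2) \<phi>_def using g unfolding graded_hom_def by blast
  qed
  have surj: "\<phi> ` carrier (C 0) = carrier M"
    using bij_betw_imp_surj_on[OF bij] unfolding Q(4) \<phi>_def by (simp add: image_image)
  have ker: "{x \<in> carrier (C 0). \<phi> x = \<zero>\<^bsub>M\<^esub>} = ?B"
  proof -
    interpret \<phi>: abelian_group_hom "C 0" M \<phi>
      by (rule graded_hom_linear(1)[OF C M.graded_koszul_axioms \<phi>])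
    have "\<phi> x = \<zero>\<^bsub>M\<^esub> \<longleftrightarrow> x \<in> ?B" if x: "x \<in> carrier (C 0)" for x
    proof -
      have "\<phi> x = \<zero>\<^bsub>M\<^esub> \<longleftrightarrow> \<phi> x = \<phi> \<zero>\<^bsub>C 0\<^esub>" by simp
      also have "\<dots> \<longleftrightarrow> ?B +>\<^bsub>C 0\<^esub> x = ?B +>\<^bsub>C 0\<^esub> \<zero>\<^bsub>C 0\<^esub>"
        unfolding \<phi>_def using x by (intro inj_on_eq_iff[OF bij_betw_imp_inj_on[OF bij]]) (auto simp: Q(4))
      also have "\<dots> \<longleftrightarrow> x \<in> ?B"
        using x C0.coset_eq_iff[OF C0.carrier_is_submodule Bs BC x C0.M.zero_closed]
          C0.M.minus_equality[of "\<zero>\<^bsub>C 0\<^esub>" "\<zero>\<^bsub>C 0\<^esub>"] by (simp add: C0.M.minus_eq)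
      finally show ?thesis .
    qed
    then show ?thesis using BC by auto
  qed
  have "koszul_acyclic R fs e M (\<phi> ` carrier (C 0)) {\<zero>\<^bsub>M\<^esub>} l \<delta>"
    using acyclic[of 0] boundaries Bs
    by (intro koszul_acyclic_image[OF C M.graded_koszul_axioms \<phi>]) (simp_all add: ker)
  then have "\<delta> \<notin> Supp (cech_cohomology R fs M l)"
    unfolding surj by (rule M.not_Supp_if_koszul_acyclic)
  then show False using \<open>\<delta> \<in> _\<close> by blast
qed

theorem theorem3p11:
  fixes S :: "('a, 'x) ring_scheme"
    and n :: nat
    and dg :: "nat \<Rightarrow> 'g::ab_group_add"
    and R :: "(nat multiset \<Rightarrow> 'a, 'g) gring"
    and B :: "(nat multiset \<Rightarrow> 'a) set"
    and fs :: "(nat multiset \<Rightarrow> 'a) list"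
    and M :: "(nat multiset \<Rightarrow> 'a, 'm, 'g) gmodule"
    and F :: "int \<Rightarrow> (nat multiset \<Rightarrow> 'a, 'b, 'g) gmodule"
    and d :: "int \<Rightarrow> 'b \<Rightarrow> 'b"
    and E :: "nat \<Rightarrow> 'e set"
    and \<gamma> :: "nat \<Rightarrow> 'e \<Rightarrow> 'g"
    and T :: "nat \<Rightarrow> 'g set"
    and l :: nat
  assumes "finitely_generated_group TYPE('g)"
    and "cring S"
    and "R = poly_gring S n dg"
    and "graded_ideal R B"
    and "B \<subseteq> Idl\<^bsub>R\<^esub> (ring.indexed_var S ` {1..n})"
    and "\<forall>f\<in>set fs. homogeneous R f"
    and "B = Idl\<^bsub>R\<^esub> (set fs)"
    and "graded_module R M"
    and "graded_complex R F d"
    and "\<forall>i<0. carrier (F i) = {\<zero>\<^bsub>F i\<^esub>}"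
    and "graded_iso R (homology F d 0) M"
    and "\<forall>i. graded_iso R (F (int i))
           (direct_sum (E i) (\<lambda>j. shift (regular_module R) (- \<gamma> i j)))"
    and "\<forall>i. T i = {\<gamma> i j | j. j \<in> E i}"
    and "\<forall>j\<ge>1. cohomological_dim R fs (homology F d (int j)) \<le> l + j"
  shows "Supp (cech_cohomology R fs M l) \<subseteq>
    (\<Union>i. Supp (cech_cohomology R fs (regular_module R) (l + i)) + T i)"
proof -
  have "graded_ring R" unfolding assms(3) using assms(2) by (rule cring.poly_gring_graded_ring)
  moreover have "carrier (F (- 1)) = {\<zero>\<^bsub>F (- 1)\<^esub>}" using assms(10) by simp
  ultimately have "Supp (cech_cohomology R fs M l) \<subseteq>
      (\<Union>i. Supp (cech_cohomology R fs (regular_module R) (l + i)) + \<gamma> i ` E i)"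
    using assms by (intro Supp_cech_cohomology_subset[where F = F and d = d]) auto
  moreover have "T i = \<gamma> i ` E i" for i using assms(13) by auto
  ultimately show ?thesis by simp
qed

end
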